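(* Let $D$ be a commutative group and let $A=\bigoplus_{d\in D}A_d$ be a $D$-graded commutative ring such that every homogeneous ideal is, up to radical, generated by its degree zero part; that is, for every homogeneous ideal $\mathfrak{a}\subseteq A$ the ideals $\mathfrak{a}$ and $(\mathfrak{a}\cap A_0)A$ have the same radical. Then $\operatorname{Spec} A_0$, with the morphism $\operatorname{Spec} A\to\operatorname{Spec} A_0$ induced by the inclusion $A_0\subseteq A$, is the quotient, in the category of all locally ringed spaces, of $\operatorname{Spec} A$ under the group scheme action corresponding to the grading.
   Context: For a (additively written) commutative group $D$ and a commutative ring $K$, the group ring $K[D]$ is the free $K$-module with basis $T^d$, $d\in D$, and $T^dT^e=T^{d+e}$; $G=\operatorname{Spec} K[D]$ is a group scheme over $\operatorname{Spec} K$ with comultiplication $T^d\mapsto T^d\otimes T^d$. If $A$ is $D$-graded and $K\subseteq A_0$ is a subring (e.g. $K=A_0$), the grading corresponds to the action $m:G\times_K\operatorname{Spec} A\to\operatorname{Spec} A$ given on rings by $A\to A[D]=K[D]\otimes_K A$, $a_d\mapsto a_dT^d$ for $a_d\in A_d$. The quotient of $X=\operatorname{Spec} A$ by this action is the coequalizer of the two morphisms $m,p_2:G\times_K X\rightrightarrows X$ ($p_2$ the projection). Concretely (as a ringed space): points $x,x'\in X$ are identified if there is a point of $G\times_K X$ mapped to $x$ by one and to $x'$ by the other of the two maps, the set of classes $Y$ carries the quotient topology, and for $V\subseteq Y$ open with preimage $U\subseteq X$, $\mathcal{O}_Y(V)=\{f\in\mathcal{O}_X(U): m^*(f)=p_2^*(f)\}$.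 *)

theory Defs
  imports
    "HOL-Algebra.Ideal"
    "HOL-Algebra.RingHom"
    "HOL-Algebra.Subrings"
    "HOL-Analysis.Abstract_Topology"
begin

section \<open>Locally ringed spaces\<close>

text \<open>
  All section rings of a ringed space live in one type \<open>'r\<close>; this is no restriction, since a
  family of rings can always be embedded into a common (sum) type.
\<close>

record ('p, 'r) rspace =
  topol :: "'p topology"
  sect :: "'p set \<Rightarrow> 'r ring"
  restr :: "'p set \<Rightarrow> 'p set \<Rightarrow> 'r \<Rightarrow> 'r"

locale ringed_space =
  fixes X :: "('p, 'r) rspace"
  assumes cring_sect: "openin (topol X) U \<Longrightarrow> cring (sect X U)"
    and restr_hom: "\<lbrakk>openin (topol X) U; openin (topol X) V; V \<subseteq> U\<rbrakk>
          \<Longrightarrow> restr X U V \<in> ring_hom (sect X U) (sect X V)"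
    and restr_id: "\<lbrakk>openin (topol X) U; s \<in> carrier (sect X U)\<rbrakk> \<Longrightarrow> restr X U U s = s"
    and restr_restr: "\<lbrakk>openin (topol X) U; openin (topol X) V; openin (topol X) W; V \<subseteq> U; W \<subseteq> V;
          s \<in> carrier (sect X U)\<rbrakk> \<Longrightarrow> restr X V W (restr X U V s) = restr X U W s"
    and locality: "\<lbrakk>\<And>V. V \<in> \<U> \<Longrightarrow> openin (topol X) V;
          s \<in> carrier (sect X (\<Union>\<U>)); t \<in> carrier (sect X (\<Union>\<U>));
          \<And>V. V \<in> \<U> \<Longrightarrow> restr X (\<Union>\<U>) V s = restr X (\<Union>\<U>) V t\<rbrakk> \<Longrightarrow> s = t"
    and gluing: "\<lbrakk>\<And>V. V \<in> \<U> \<Longrightarrow> openin (topol X) V;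
          \<And>V. V \<in> \<U> \<Longrightarrow> \<sigma> V \<in> carrier (sect X V);
          \<And>V W. \<lbrakk>V \<in> \<U>; W \<in> \<U>\<rbrakk> \<Longrightarrow> restr X V (V \<inter> W) (\<sigma> V) = restr X W (V \<inter> W) (\<sigma> W)\<rbrakk>
          \<Longrightarrow> \<exists>s\<in>carrier (sect X (\<Union>\<U>)). \<forall>V\<in>\<U>. restr X (\<Union>\<U>) V s = \<sigma> V"

definition presections :: "('p, 'r) rspace \<Rightarrow> 'p \<Rightarrow> ('p set \<times> 'r) set" where
  "presections X x = {(U, s). openin (topol X) U \<and> x \<in> U \<and> s \<in> carrier (sect X U)}"

definition germ_rel :: "('p, 'r) rspace \<Rightarrow> 'p \<Rightarrow> (('p set \<times> 'r) \<times> ('p set \<times> 'r)) set" where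
  "germ_rel X x = {((U, s), (V, t)). (U, s) \<in> presections X x \<and> (V, t) \<in> presections X x \<and>
     (\<exists>W. openin (topol X) W \<and> x \<in> W \<and> W \<subseteq> U \<inter> V \<and> restr X U W s = restr X V W t)}"

definition germ :: "('p, 'r) rspace \<Rightarrow> 'p \<Rightarrow> 'p set \<Rightarrow> 'r \<Rightarrow> ('p set \<times> 'r) set" where
  "germ X x U s = germ_rel X x `` {(U, s)}"

definition stalk :: "('p, 'r) rspace \<Rightarrow> 'p \<Rightarrow> ('p set \<times> 'r) set ring" where
  "stalk X x = \<lparr>
     carrier = presections X x // germ_rel X x,
     mult = (\<lambda>S T. \<Union>(U, s)\<in>S. \<Union>(V, t)\<in>T.
       germ X x (U \<inter> V) (restr X U (U \<inter> V) s \<otimes>\<^bsub>sect X (U \<inter> V)\<^esub> restr X V (U \<inter> V) t)),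
     one = germ X x (topspace (topol X)) \<one>\<^bsub>sect X (topspace (topol X))\<^esub>,
     zero = germ X x (topspace (topol X)) \<zero>\<^bsub>sect X (topspace (topol X))\<^esub>,
     add = (\<lambda>S T. \<Union>(U, s)\<in>S. \<Union>(V, t)\<in>T.
       germ X x (U \<inter> V) (restr X U (U \<inter> V) s \<oplus>\<^bsub>sect X (U \<inter> V)\<^esub> restr X V (U \<inter> V) t))\<rparr>"

definition local_ring :: "('a, 'm) ring_scheme \<Rightarrow> bool" where
  "local_ring R \<longleftrightarrow> cring R \<and> (\<exists>!M. maximalideal M R)"

definition local_hom :: "('a, 'm) ring_scheme \<Rightarrow> ('b, 'n) ring_scheme \<Rightarrow> ('a \<Rightarrow> 'b) \<Rightarrow> bool" where
  "local_hom R S h \<longleftrightarrow> h \<in> ring_hom R S \<and>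
     (\<forall>M N. maximalideal M R \<and> maximalideal N S \<longrightarrow> h ` M \<subseteq> N)"

locale locally_ringed_space = ringed_space +
  assumes local_stalk: "x \<in> topspace (topol X) \<Longrightarrow> local_ring (stalk X x)"

record ('p, 'r, 'q, 's) rs_map =
  pmap :: "'p \<Rightarrow> 'q"
  comorph :: "'q set \<Rightarrow> 's \<Rightarrow> 'r"

definition preim :: "('p, 'r) rspace \<Rightarrow> ('p, 'r, 'q, 's) rs_map \<Rightarrow> 'q set \<Rightarrow> 'p set" where
  "preim X f V = {x \<in> topspace (topol X). pmap f x \<in> V}"

definition stalk_map ::
  "('p, 'r) rspace \<Rightarrow> ('p, 'r, 'q, 's) rs_map \<Rightarrow> 'p \<Rightarrow> ('q set \<times> 's) set \<Rightarrow> ('p set \<times> 'r) set" where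
  "stalk_map X f x T = (\<Union>(V, t)\<in>T. germ X x (preim X f V) (comorph f V t))"

locale lrs_morphism =
  source: locally_ringed_space X + target: locally_ringed_space Y
  for X :: "('p, 'r) rspace" and Y :: "('q, 's) rspace" and f :: "('p, 'r, 'q, 's) rs_map" +
  assumes continuous: "continuous_map (topol X) (topol Y) (pmap f)"
    and comorph_hom: "openin (topol Y) V
          \<Longrightarrow> comorph f V \<in> ring_hom (sect Y V) (sect X (preim X f V))"
    and comorph_restr: "\<lbrakk>openin (topol Y) V; openin (topol Y) W; W \<subseteq> V; t \<in> carrier (sect Y V)\<rbrakk>
          \<Longrightarrow> comorph f W (restr Y V W t) = restr X (preim X f V) (preim X f W) (comorph f V t)"
    and local_stalk_map: "x \<in> topspace (topol X)
          \<Longrightarrow> local_hom (stalk Y (pmap f x)) (stalk X x) (stalk_map X f x)"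

text \<open>
  The fields of a morphism are total functions; what they do outside the space, on non-open
  sets or on non-sections is irrelevant. Hence equality of morphisms is \<open>rs_map_eq\<close>, not \<open>=\<close>.
\<close>

definition rs_map_eq ::
  "('p, 'r) rspace \<Rightarrow> ('q, 's) rspace \<Rightarrow> ('p, 'r, 'q, 's) rs_map \<Rightarrow> ('p, 'r, 'q, 's) rs_map \<Rightarrow> bool"
where
  "rs_map_eq X Y f g \<longleftrightarrow> (\<forall>x\<in>topspace (topol X). pmap f x = pmap g x) \<and>
     (\<forall>V t. openin (topol Y) V \<and> t \<in> carrier (sect Y V) \<longrightarrow> comorph f V t = comorph g V t)"

text \<open>\<open>rs_comp Y g f\<close> is the composite \<open>g \<circ> f\<close>, where \<open>Y\<close> is the source of \<open>g\<close>.\<close>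

definition rs_comp ::
  "('q, 's) rspace \<Rightarrow> ('q, 's, 'z, 't) rs_map \<Rightarrow> ('p, 'r, 'q, 's) rs_map \<Rightarrow> ('p, 'r, 'z, 't) rs_map"
where
  "rs_comp Y g f = \<lparr>
     pmap = (\<lambda>x. pmap g (pmap f x)),
     comorph = (\<lambda>W t. comorph f (preim Y g W) (comorph g W t))\<rparr>"

text \<open>
  \<open>q : X \<rightarrow> E\<close> is a coequalizer of \<open>f, g : P \<rightrightarrows> X\<close> in the category of locally ringed spaces. As HOL
  cannot quantify over types inside a formula, the types of the points and of the sections of the
  test objects are passed as a type argument; for the full universal property the statement has
  to be made with \<open>'z\<close> and \<open>'t\<close> arbitrary.
\<close>

definition lrs_coequalizer ::
  "('z \<times> 't) itself \<Rightarrow> ('p, 'r) rspace \<Rightarrow> ('x, 's) rspace \<Rightarrow> ('p, 'r, 'x, 's) rs_map \<Rightarrow>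
   ('p, 'r, 'x, 's) rs_map \<Rightarrow> ('e, 'u) rspace \<Rightarrow> ('x, 's, 'e, 'u) rs_map \<Rightarrow> bool"
where
  "lrs_coequalizer T P X f g E q \<longleftrightarrow>
     lrs_morphism P X f \<and> lrs_morphism P X g \<and> lrs_morphism X E q \<and>
     rs_map_eq P E (rs_comp X q f) (rs_comp X q g) \<and>
     (\<forall>(Z :: ('z, 't) rspace) h.
        lrs_morphism X Z h \<and> rs_map_eq P Z (rs_comp X h f) (rs_comp X h g) \<longrightarrow>
        (\<exists>k. lrs_morphism E Z k \<and> rs_map_eq X Z (rs_comp E k q) h) \<and>
        (\<forall>k k'. lrs_morphism E Z k \<and> rs_map_eq X Z (rs_comp E k q) h \<and>
                lrs_morphism E Z k' \<and> rs_map_eq X Z (rs_comp E k' q) h \<longrightarrow> rs_map_eq E Z k k'))"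


section \<open>Spectra of rings\<close>

definition loc_rel :: "('a, 'm) ring_scheme \<Rightarrow> 'a set \<Rightarrow> (('a \<times> 'a) \<times> ('a \<times> 'a)) set" where
  "loc_rel R S = {((a, s), (b, t)). a \<in> carrier R \<and> s \<in> S \<and> b \<in> carrier R \<and> t \<in> S \<and>
     (\<exists>u\<in>S. u \<otimes>\<^bsub>R\<^esub> (a \<otimes>\<^bsub>R\<^esub> t) = u \<otimes>\<^bsub>R\<^esub> (b \<otimes>\<^bsub>R\<^esub> s))}"

definition frac :: "('a, 'm) ring_scheme \<Rightarrow> 'a set \<Rightarrow> 'a \<Rightarrow> 'a \<Rightarrow> ('a \<times> 'a) set" where
  "frac R S a s = loc_rel R S `` {(a, s)}"

definition localization :: "('a, 'm) ring_scheme \<Rightarrow> 'a set \<Rightarrow> ('a \<times> 'a) set ring" where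
  "localization R S = \<lparr>
     carrier = (carrier R \<times> S) // loc_rel R S,
     mult = (\<lambda>Q Q'. \<Union>(a, s)\<in>Q. \<Union>(b, t)\<in>Q'. frac R S (a \<otimes>\<^bsub>R\<^esub> b) (s \<otimes>\<^bsub>R\<^esub> t)),
     one = frac R S \<one>\<^bsub>R\<^esub> \<one>\<^bsub>R\<^esub>,
     zero = frac R S \<zero>\<^bsub>R\<^esub> \<one>\<^bsub>R\<^esub>,
     add = (\<lambda>Q Q'. \<Union>(a, s)\<in>Q. \<Union>(b, t)\<in>Q'.
       frac R S (a \<otimes>\<^bsub>R\<^esub> t \<oplus>\<^bsub>R\<^esub> b \<otimes>\<^bsub>R\<^esub> s) (s \<otimes>\<^bsub>R\<^esub> t))\<rparr>"

abbreviation loc_at :: "('a, 'm) ring_scheme \<Rightarrow> 'a set \<Rightarrow> ('a \<times> 'a) set ring" where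
  "loc_at R p \<equiv> localization R (carrier R - p)"

definition zariski :: "('a, 'm) ring_scheme \<Rightarrow> 'a set topology" where
  "zariski R = topology (\<lambda>U. \<exists>E. E \<subseteq> carrier R \<and> U = {p. primeideal p R \<and> \<not> E \<subseteq> p})"

lemma prime_product_subset:
  assumes "primeideal p R" "E \<subseteq> carrier R" "F \<subseteq> carrier R"
  shows "(\<lambda>(e, f). e \<otimes>\<^bsub>R\<^esub> f) ` (E \<times> F) \<subseteq> p \<longleftrightarrow> E \<subseteq> p \<or> F \<subseteq> p"
proof
  interpret primeideal p R by fact
  assume G: "(\<lambda>(e, f). e \<otimes>\<^bsub>R\<^esub> f) ` (E \<times> F) \<subseteq> p"
  show "E \<subseteq> p \<or> F \<subseteq> p"
  proof (rule ccontr)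
    assume "\<not> (E \<subseteq> p \<or> F \<subseteq> p)"
    then obtain e f where ef: "e \<in> E" "f \<in> F" "e \<notin> p" "f \<notin> p" by (auto simp: subset_iff)
    then have "e \<otimes>\<^bsub>R\<^esub> f \<in> p" using G by (auto simp: image_subset_iff)
    then show False using ef assms(2,3) I_prime[of e f] by (auto simp: subset_iff)
  qed
next
  interpret primeideal p R by fact
  assume "E \<subseteq> p \<or> F \<subseteq> p"
  then show "(\<lambda>(e, f). e \<otimes>\<^bsub>R\<^esub> f) ` (E \<times> F) \<subseteq> p"
    using assms(2,3) I_l_closed I_r_closed by (auto simp: subset_iff)
qed

lemma openin_zariski:
  "openin (zariski R) U \<longleftrightarrow> (\<exists>E. E \<subseteq> carrier R \<and> U = {p. primeideal p R \<and> \<not> E \<subseteq> p})"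
proof -
  define N where "N E = {p. primeideal p R \<and> \<not> E \<subseteq> p}" for E
  have "istopology (\<lambda>U. \<exists>E. E \<subseteq> carrier R \<and> U = N E)"
    unfolding istopology_def
  proof (intro conjI allI impI)
    fix U V
    assume "\<exists>E. E \<subseteq> carrier R \<and> U = N E" "\<exists>E. E \<subseteq> carrier R \<and> V = N E"
    then obtain E F where EF: "E \<subseteq> carrier R" "U = N E" "F \<subseteq> carrier R" "V = N F"
      by metis
    show "\<exists>E. E \<subseteq> carrier R \<and> U \<inter> V = N E"
    proof (cases "cring R")
      case True
      then interpret cring R .
      let ?G = "(\<lambda>(e, f). e \<otimes>\<^bsub>R\<^esub> f) ` (E \<times> F)"
      have "U \<inter> V = N ?G"
        unfolding EF N_def
        using prime_product_subset[OF _ EF(1,3)] by (simp add: set_eq_iff) metis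
      moreover have "?G \<subseteq> carrier R" using EF(1,3) by (auto simp: subset_iff)
      ultimately show ?thesis by (intro exI[of _ ?G] conjI)
    next
      case False
      then have "\<not> primeideal p R" for p by (auto simp: primeideal_def)
      then have "U \<inter> V = N {}" unfolding EF N_def by simp
      then show ?thesis by (intro exI[of _ "{}"] conjI) auto
    qed
  next
    fix \<K>
    assume "\<forall>K\<in>\<K>. \<exists>E. E \<subseteq> carrier R \<and> K = N E"
    then obtain E where "\<forall>K\<in>\<K>. E K \<subseteq> carrier R \<and> K = N (E K)"
      using bchoice[of \<K> "\<lambda>K E. E \<subseteq> carrier R \<and> K = N E"] by metis
    then have E: "\<And>K. K \<in> \<K> \<Longrightarrow> E K \<subseteq> carrier R" "\<And>K. K \<in> \<K> \<Longrightarrow> N (E K) = K"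
      by metis+
    have "\<Union>\<K> = (\<Union>K\<in>\<K>. N (E K))" by (simp add: E(2))
    also have "\<dots> = N (\<Union>K\<in>\<K>. E K)" by (auto simp: N_def)
    finally have "\<Union>\<K> = N (\<Union>K\<in>\<K>. E K)" .
    moreover have "(\<Union>K\<in>\<K>. E K) \<subseteq> carrier R" using E(1) by (simp add: UN_subset_iff)
    ultimately show "\<exists>E. E \<subseteq> carrier R \<and> \<Union>\<K> = N E" by (intro exI[of _ "\<Union>K\<in>\<K>. E K"] conjI)
  qed
  then show ?thesis by (simp add: zariski_def N_def)
qed

definition spec_sections :: "('a, 'm) ring_scheme \<Rightarrow> 'a set set \<Rightarrow> ('a set \<Rightarrow> ('a \<times> 'a) set) set" where
  "spec_sections R U = {s \<in> (\<Pi>\<^sub>E p\<in>U. carrier (loc_at R p)).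
     \<forall>p\<in>U. \<exists>V. openin (zariski R) V \<and> p \<in> V \<and> V \<subseteq> U \<and>
       (\<exists>a\<in>carrier R. \<exists>f\<in>carrier R. \<forall>q\<in>V. f \<notin> q \<and> s q = frac R (carrier R - q) a f)}"

definition Spec :: "('a, 'm) ring_scheme \<Rightarrow> ('a set, 'a set \<Rightarrow> ('a \<times> 'a) set) rspace" where
  "Spec R = \<lparr>
     topol = zariski R,
     sect = (\<lambda>U. \<lparr>
       carrier = spec_sections R U,
       mult = (\<lambda>s t. \<lambda>p\<in>U. s p \<otimes>\<^bsub>loc_at R p\<^esub> t p),
       one = (\<lambda>p\<in>U. \<one>\<^bsub>loc_at R p\<^esub>),
       zero = (\<lambda>p\<in>U. \<zero>\<^bsub>loc_at R p\<^esub>),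
       add = (\<lambda>s t. \<lambda>p\<in>U. s p \<oplus>\<^bsub>loc_at R p\<^esub> t p)\<rparr>),
     restr = (\<lambda>U V s. restrict s V)\<rparr>"

definition contraction :: "('a, 'm) ring_scheme \<Rightarrow> ('a \<Rightarrow> 'b) \<Rightarrow> 'b set \<Rightarrow> 'a set" where
  "contraction R h q = {a \<in> carrier R. h a \<in> q}"

definition loc_map :: "('b, 'n) ring_scheme \<Rightarrow> ('a \<Rightarrow> 'b) \<Rightarrow> 'b set \<Rightarrow> ('a \<times> 'a) set \<Rightarrow> ('b \<times> 'b) set"
where
  "loc_map S h q Q = (\<Union>(a, s)\<in>Q. frac S (carrier S - q) (h a) (h s))"

text \<open>The morphism \<open>Spec S \<rightarrow> Spec R\<close> induced by a ring homomorphism \<open>h : R \<rightarrow> S\<close>.\<close>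

definition Spec_map ::
  "('a, 'm) ring_scheme \<Rightarrow> ('b, 'n) ring_scheme \<Rightarrow> ('a \<Rightarrow> 'b) \<Rightarrow>
   ('b set, 'b set \<Rightarrow> ('b \<times> 'b) set, 'a set, 'a set \<Rightarrow> ('a \<times> 'a) set) rs_map"
where
  "Spec_map R S h = \<lparr>
     pmap = contraction R h,
     comorph = (\<lambda>V t. \<lambda>q\<in>{q. primeideal q S \<and> contraction R h q \<in> V}.
       loc_map S h q (t (contraction R h q)))\<rparr>"


section \<open>Graded rings and group rings\<close>

text \<open>
  The grading group \<open>D\<close> is a commutative group in the sense of HOL-Algebra, hence written
  multiplicatively: \<open>\<one>\<^bsub>D\<^esub>\<close> is the degree zero, and \<open>\<A> \<one>\<^bsub>D\<^esub>\<close> is the degree zero part of the ring.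
\<close>

definition supp :: "('a, 'm) ring_scheme \<Rightarrow> ('d, 'n) monoid_scheme \<Rightarrow> ('d \<Rightarrow> 'a) \<Rightarrow> 'd set" where
  "supp A D x = {d \<in> carrier D. x d \<noteq> \<zero>\<^bsub>A\<^esub>}"

definition decomposition ::
  "('a, 'm) ring_scheme \<Rightarrow> ('d, 'n) monoid_scheme \<Rightarrow> ('d \<Rightarrow> 'a set) \<Rightarrow> 'a \<Rightarrow> ('d \<Rightarrow> 'a) \<Rightarrow> bool" where
  "decomposition A D \<A> a c \<longleftrightarrow> c \<in> (\<Pi>\<^sub>E d\<in>carrier D. \<A> d) \<and> finite (supp A D c) \<and>
     a = (\<Oplus>\<^bsub>A\<^esub>d\<in>supp A D c. c d)"

locale graded_cring = cring A + D: comm_group D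
  for A :: "('a, 'm) ring_scheme" (structure) and D :: "('d, 'n) monoid_scheme"
    and \<A> :: "'d \<Rightarrow> 'a set" +
  assumes additive: "d \<in> carrier D \<Longrightarrow> additive_subgroup (\<A> d) A"
    and graded_mult: "\<lbrakk>d \<in> carrier D; e \<in> carrier D; a \<in> \<A> d; b \<in> \<A> e\<rbrakk> \<Longrightarrow> a \<otimes> b \<in> \<A> (d \<otimes>\<^bsub>D\<^esub> e)"
    and direct_sum: "a \<in> carrier A \<Longrightarrow> \<exists>!c. decomposition A D \<A> a c"

definition components ::
  "('a, 'm) ring_scheme \<Rightarrow> ('d, 'n) monoid_scheme \<Rightarrow> ('d \<Rightarrow> 'a set) \<Rightarrow> 'a \<Rightarrow> 'd \<Rightarrow> 'a" where
  "components A D \<A> a = (THE c. decomposition A D \<A> a c)"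

definition homogeneous_ideal ::
  "('a, 'm) ring_scheme \<Rightarrow> ('d, 'n) monoid_scheme \<Rightarrow> ('d \<Rightarrow> 'a set) \<Rightarrow> 'a set \<Rightarrow> bool" where
  "homogeneous_ideal A D \<A> I \<longleftrightarrow> ideal I A \<and>
     (\<forall>a\<in>I. \<forall>d\<in>carrier D. components A D \<A> a d \<in> I)"

definition radical :: "('a, 'm) ring_scheme \<Rightarrow> 'a set \<Rightarrow> 'a set" where
  "radical A I = {a \<in> carrier A. \<exists>n::nat. a [^]\<^bsub>A\<^esub> n \<in> I}"

abbreviation degree_zero_ring ::
  "('a, 'm) ring_scheme \<Rightarrow> ('d, 'n) monoid_scheme \<Rightarrow> ('d \<Rightarrow> 'a set) \<Rightarrow> ('a, 'm) ring_scheme" where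
  "degree_zero_ring A D \<A> \<equiv> A\<lparr>carrier := \<A> \<one>\<^bsub>D\<^esub>\<rparr>"

text \<open>
  An element \<open>\<Sum>\<^sub>d x\<^sub>d T\<^sup>d\<close> of the group ring \<open>A[D]\<close> is represented by its coefficient function.
\<close>

definition group_ring ::
  "('a, 'm) ring_scheme \<Rightarrow> ('d, 'n) monoid_scheme \<Rightarrow> ('d \<Rightarrow> 'a) ring" where
  "group_ring A D = \<lparr>
     carrier = {x \<in> (\<Pi>\<^sub>E d\<in>carrier D. carrier A). finite (supp A D x)},
     mult = (\<lambda>x y. \<lambda>d\<in>carrier D. \<Oplus>\<^bsub>A\<^esub>e\<in>supp A D x. x e \<otimes>\<^bsub>A\<^esub> y (inv\<^bsub>D\<^esub> e \<otimes>\<^bsub>D\<^esub> d)),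
     one = (\<lambda>d\<in>carrier D. if d = \<one>\<^bsub>D\<^esub> then \<one>\<^bsub>A\<^esub> else \<zero>\<^bsub>A\<^esub>),
     zero = (\<lambda>d\<in>carrier D. \<zero>\<^bsub>A\<^esub>),
     add = (\<lambda>x y. \<lambda>d\<in>carrier D. x d \<oplus>\<^bsub>A\<^esub> y d)\<rparr>"

definition gmonom ::
  "('a, 'm) ring_scheme \<Rightarrow> ('d, 'n) monoid_scheme \<Rightarrow> 'a \<Rightarrow> 'd \<Rightarrow> 'd \<Rightarrow> 'a" where
  "gmonom A D a d = (\<lambda>e\<in>carrier D. if e = d then a else \<zero>\<^bsub>A\<^esub>)"


context
  fixes A :: "('a, 'm) ring_scheme" (structure) and D :: "('d, 'n) monoid_scheme"
  assumes A: "cring A" and D: "comm_group D"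
begin

interpretation A: cring A by (rule A)
interpretation D: comm_group D by (rule D)

lemma group_ring_memD:
  assumes "x \<in> carrier (group_ring A D)"
  shows "d \<in> carrier D \<Longrightarrow> x d \<in> carrier A" "x \<in> extensional (carrier D)"
    "finite (supp A D x)" "supp A D x \<subseteq> carrier D"
    "\<lbrakk>d \<in> carrier D; d \<notin> supp A D x\<rbrakk> \<Longrightarrow> x d = \<zero>"
  using assms by (auto simp: group_ring_def supp_def PiE_def)

lemma group_ring_memI:
  assumes "\<And>d. d \<in> carrier D \<Longrightarrow> x d \<in> carrier A" "x \<in> extensional (carrier D)"
    "finite F" "\<And>d. \<lbrakk>d \<in> carrier D; d \<notin> F\<rbrakk> \<Longrightarrow> x d = \<zero>"
  shows "x \<in> carrier (group_ring A D)"
proof -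
  have "supp A D x \<subseteq> F" using assms(4) by (auto simp: supp_def)
  then show ?thesis
    using assms(1-3) finite_subset by (auto simp: group_ring_def PiE_def)
qed

lemma group_ring_eqI:
  assumes "x \<in> carrier (group_ring A D)" "y \<in> carrier (group_ring A D)"
    "\<And>d. d \<in> carrier D \<Longrightarrow> x d = y d"
  shows "x = y"
  using assms by (meson extensionalityI group_ring_memD(2))

lemma gmonom_closed: "a \<in> carrier A \<Longrightarrow> gmonom A D a d \<in> carrier (group_ring A D)"
  by (rule group_ring_memI[where F = "{d}"]) (auto simp: gmonom_def)

lemma group_ring_one: "\<one>\<^bsub>group_ring A D\<^esub> = gmonom A D \<one> \<one>\<^bsub>D\<^esub>"
  by (simp add: group_ring_def gmonom_def)

lemma group_ring_add_app:
  "d \<in> carrier D \<Longrightarrow> (x \<oplus>\<^bsub>group_ring A D\<^esub> y) d = x d \<oplus> y d"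
  by (simp add: group_ring_def)

lemma group_ring_zero_app: "d \<in> carrier D \<Longrightarrow> \<zero>\<^bsub>group_ring A D\<^esub> d = \<zero>"
  by (simp add: group_ring_def)

lemma shift_closed:
  "\<lbrakk>y \<in> carrier (group_ring A D); e \<in> carrier D; d \<in> carrier D\<rbrakk>
    \<Longrightarrow> y (inv\<^bsub>D\<^esub> e \<otimes>\<^bsub>D\<^esub> d) \<in> carrier A"
  by (simp add: group_ring_memD)

lemma group_ring_mult_app:
  assumes x: "x \<in> carrier (group_ring A D)" and y: "y \<in> carrier (group_ring A D)"
    and d: "d \<in> carrier D" and F: "finite F" "supp A D x \<subseteq> F" "F \<subseteq> carrier D"
  shows "(x \<otimes>\<^bsub>group_ring A D\<^esub> y) d = (\<Oplus>e\<in>F. x e \<otimes> y (inv\<^bsub>D\<^esub> e \<otimes>\<^bsub>D\<^esub> d))"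
proof -
  have "(x \<otimes>\<^bsub>group_ring A D\<^esub> y) d = (\<Oplus>e\<in>supp A D x. x e \<otimes> y (inv\<^bsub>D\<^esub> e \<otimes>\<^bsub>D\<^esub> d))"
    using d by (simp add: group_ring_def)
  also have "\<dots> = (\<Oplus>e\<in>F. x e \<otimes> y (inv\<^bsub>D\<^esub> e \<otimes>\<^bsub>D\<^esub> d))"
    using F group_ring_memD[OF x] shift_closed[OF y _ d]
    by (intro A.add.finprod_mono_neutral_cong_left) (auto simp: subset_iff)
  finally show ?thesis .
qed

abbreviation (input) supp_prod :: "('d \<Rightarrow> 'a) \<Rightarrow> ('d \<Rightarrow> 'a) \<Rightarrow> 'd set" where
  "supp_prod x y \<equiv> (\<lambda>(e, f). e \<otimes>\<^bsub>D\<^esub> f) ` (supp A D x \<times> supp A D y)"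

lemma supp_prod_finite:
  assumes "x \<in> carrier (group_ring A D)" "y \<in> carrier (group_ring A D)"
  shows "finite (supp_prod x y)" "supp_prod x y \<subseteq> carrier D"
  using assms group_ring_memD(3,4) by (auto simp: subset_iff)

lemma group_ring_mult_zero:
  assumes x: "x \<in> carrier (group_ring A D)" and y: "y \<in> carrier (group_ring A D)"
    and d: "d \<in> carrier D" and nd: "d \<notin> supp_prod x y"
  shows "(x \<otimes>\<^bsub>group_ring A D\<^esub> y) d = \<zero>"
proof -
  have "x e \<otimes> y (inv\<^bsub>D\<^esub> e \<otimes>\<^bsub>D\<^esub> d) = \<zero>" if e: "e \<in> supp A D x" for e
  proof -
    have eD: "e \<in> carrier D" using e by (simp add: supp_def)
    have "inv\<^bsub>D\<^esub> e \<otimes>\<^bsub>D\<^esub> d \<notin> supp A D y"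
    proof
      assume "inv\<^bsub>D\<^esub> e \<otimes>\<^bsub>D\<^esub> d \<in> supp A D y"
      moreover have "d = e \<otimes>\<^bsub>D\<^esub> (inv\<^bsub>D\<^esub> e \<otimes>\<^bsub>D\<^esub> d)"
        using eD d by (simp add: D.m_assoc[symmetric])
      ultimately show False using nd e by (auto simp: image_iff)
    qed
    then have "y (inv\<^bsub>D\<^esub> e \<otimes>\<^bsub>D\<^esub> d) = \<zero>" using group_ring_memD(5)[OF y] eD d by simp
    then show ?thesis using group_ring_memD(1)[OF x eD] by simp
  qed
  then have "(\<Oplus>e\<in>supp A D x. x e \<otimes> y (inv\<^bsub>D\<^esub> e \<otimes>\<^bsub>D\<^esub> d)) = \<zero>"
    by (rule A.add.finprod_one_eqI)
  then show ?thesis using d by (simp add: group_ring_def)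
qed

lemma group_ring_mult_closed:
  assumes x: "x \<in> carrier (group_ring A D)" and y: "y \<in> carrier (group_ring A D)"
  shows "x \<otimes>\<^bsub>group_ring A D\<^esub> y \<in> carrier (group_ring A D)"
proof (rule group_ring_memI[where F = "supp_prod x y"])
  fix d assume d: "d \<in> carrier D"
  show "(x \<otimes>\<^bsub>group_ring A D\<^esub> y) d \<in> carrier A"
    unfolding group_ring_mult_app[OF x y d group_ring_memD(3)[OF x] order.refl group_ring_memD(4)[OF x]]
    using group_ring_memD[OF x] shift_closed[OF y _ d]
    by (intro A.finsum_closed) (auto simp: subset_iff)
next
  show "x \<otimes>\<^bsub>group_ring A D\<^esub> y \<in> extensional (carrier D)"
    by (simp add: group_ring_def)
qed (use supp_prod_finite[OF x y] group_ring_mult_zero[OF x y] in auto)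

lemma finsum_swap:
  assumes "finite F" "finite G" "\<And>i j. \<lbrakk>i \<in> F; j \<in> G\<rbrakk> \<Longrightarrow> t i j \<in> carrier A"
  shows "(\<Oplus>i\<in>F. \<Oplus>j\<in>G. t i j) = (\<Oplus>j\<in>G. \<Oplus>i\<in>F. t i j)"
  using assms(1,3)
proof (induction F rule: finite_induct)
  case empty
  then show ?case using assms(2) by simp
next
  case (insert i F)
  have "(\<Oplus>i\<in>insert i F. \<Oplus>j\<in>G. t i j) = (\<Oplus>j\<in>G. t i j) \<oplus> (\<Oplus>i\<in>F. \<Oplus>j\<in>G. t i j)"
    using insert assms(2) by (intro A.finsum_insert) auto
  also have "\<dots> = (\<Oplus>j\<in>G. t i j) \<oplus> (\<Oplus>j\<in>G. \<Oplus>i\<in>F. t i j)"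
    using insert by simp
  also have "\<dots> = (\<Oplus>j\<in>G. t i j \<oplus> (\<Oplus>i\<in>F. t i j))"
    using insert by (intro A.finsum_addf[symmetric]) auto
  also have "\<dots> = (\<Oplus>j\<in>G. \<Oplus>i\<in>insert i F. t i j)"
    using insert by (intro A.finsum_cong') auto
  finally show ?case .
qed

lemma group_ring_mult_comm:
  assumes x: "x \<in> carrier (group_ring A D)" and y: "y \<in> carrier (group_ring A D)"
  shows "x \<otimes>\<^bsub>group_ring A D\<^esub> y = y \<otimes>\<^bsub>group_ring A D\<^esub> x"
proof (rule group_ring_eqI)
  fix d assume d: "d \<in> carrier D"
  define F where "F = supp A D x \<union> (\<lambda>e. inv\<^bsub>D\<^esub> e \<otimes>\<^bsub>D\<^esub> d) ` supp A D y"
  have F: "finite F" "F \<subseteq> carrier D" "supp A D x \<subseteq> F"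
    using group_ring_memD(3,4)[OF x] group_ring_memD(3,4)[OF y] d by (auto simp: F_def)
  have inj: "inj_on (\<lambda>e. inv\<^bsub>D\<^esub> e \<otimes>\<^bsub>D\<^esub> d) F"
    using F(2) d by (auto simp: inj_on_def subset_iff)
  have inv2: "inv\<^bsub>D\<^esub> (inv\<^bsub>D\<^esub> e \<otimes>\<^bsub>D\<^esub> d) \<otimes>\<^bsub>D\<^esub> d = e" if "e \<in> carrier D" for e
    using that d by (simp add: D.inv_mult D.m_assoc D.m_comm[of "inv\<^bsub>D\<^esub> d"] D.m_lcomm[of d])
  have sub: "supp A D y \<subseteq> (\<lambda>e. inv\<^bsub>D\<^esub> e \<otimes>\<^bsub>D\<^esub> d) ` F"
  proof
    fix e assume e: "e \<in> supp A D y"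
    then have "e \<in> carrier D" by (simp add: supp_def)
    then show "e \<in> (\<lambda>e. inv\<^bsub>D\<^esub> e \<otimes>\<^bsub>D\<^esub> d) ` F"
      using inv2[of e] e by (auto simp: F_def intro!: image_eqI[of e _ "inv\<^bsub>D\<^esub> e \<otimes>\<^bsub>D\<^esub> d"])
  qed
  have "(y \<otimes>\<^bsub>group_ring A D\<^esub> x) d = (\<Oplus>e\<in>(\<lambda>e. inv\<^bsub>D\<^esub> e \<otimes>\<^bsub>D\<^esub> d) ` F. y e \<otimes> x (inv\<^bsub>D\<^esub> e \<otimes>\<^bsub>D\<^esub> d))"
    using F d sub by (intro group_ring_mult_app[OF y x d]) auto
  also have "\<dots> = (\<Oplus>e\<in>F. y (inv\<^bsub>D\<^esub> e \<otimes>\<^bsub>D\<^esub> d) \<otimes> x (inv\<^bsub>D\<^esub> (inv\<^bsub>D\<^esub> e \<otimes>\<^bsub>D\<^esub> d) \<otimes>\<^bsub>D\<^esub> d))"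
    using F(2) d by (intro A.finsum_reindex inj) (auto simp: subset_iff group_ring_memD[OF x] group_ring_memD[OF y])
  also have "\<dots> = (\<Oplus>e\<in>F. x e \<otimes> y (inv\<^bsub>D\<^esub> e \<otimes>\<^bsub>D\<^esub> d))"
    using F(2) d
    by (intro A.finsum_cong')
      (auto simp: subset_iff inv2 A.m_comm group_ring_memD[OF x] group_ring_memD[OF y])
  also have "\<dots> = (x \<otimes>\<^bsub>group_ring A D\<^esub> y) d"
    using F by (intro group_ring_mult_app[OF x y d, symmetric]) auto
  finally show "(x \<otimes>\<^bsub>group_ring A D\<^esub> y) d = (y \<otimes>\<^bsub>group_ring A D\<^esub> x) d" by simp
qed (intro group_ring_mult_closed x y)+

lemma group_ring_mult_assoc:
  assumes x: "x \<in> carrier (group_ring A D)" and y: "y \<in> carrier (group_ring A D)"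
    and z: "z \<in> carrier (group_ring A D)"
  shows "(x \<otimes>\<^bsub>group_ring A D\<^esub> y) \<otimes>\<^bsub>group_ring A D\<^esub> z
       = x \<otimes>\<^bsub>group_ring A D\<^esub> (y \<otimes>\<^bsub>group_ring A D\<^esub> z)"
proof (rule group_ring_eqI)
  note [simp] = group_ring_memD(1)[OF x] group_ring_memD(1)[OF y] group_ring_memD(1)[OF z]
  fix d assume d: "d \<in> carrier D"
  define P where "P = supp_prod x y"
  have P: "finite P" "P \<subseteq> carrier D" unfolding P_def using supp_prod_finite[OF x y] by auto
  note X = group_ring_memD(3,4)[OF x]
  note Y = group_ring_memD(3,4)[OF y]
  have xD: "e \<in> supp A D x \<Longrightarrow> e \<in> carrier D" for e using X by auto
  have pD: "e \<in> P \<Longrightarrow> e \<in> carrier D" for e using P by auto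
  have sp: "supp A D (x \<otimes>\<^bsub>group_ring A D\<^esub> y) \<subseteq> P"
    using group_ring_mult_zero[OF x y] by (auto simp: supp_def P_def)
  have inner: "(\<Oplus>e\<in>P. y (inv\<^bsub>D\<^esub> f \<otimes>\<^bsub>D\<^esub> e) \<otimes> z (inv\<^bsub>D\<^esub> e \<otimes>\<^bsub>D\<^esub> d))
      = (y \<otimes>\<^bsub>group_ring A D\<^esub> z) (inv\<^bsub>D\<^esub> f \<otimes>\<^bsub>D\<^esub> d)" if f: "f \<in> supp A D x" for f
  proof -
    have fD: "f \<in> carrier D" using f xD by simp
    let ?F = "(\<lambda>e. inv\<^bsub>D\<^esub> f \<otimes>\<^bsub>D\<^esub> e) ` P"
    have inj: "inj_on (\<lambda>e. inv\<^bsub>D\<^esub> f \<otimes>\<^bsub>D\<^esub> e) P" using fD pD by (auto simp: inj_on_def)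
    have sub: "supp A D y \<subseteq> ?F"
    proof
      fix e assume e: "e \<in> supp A D y"
      then have eD: "e \<in> carrier D" using Y by auto
      have "f \<otimes>\<^bsub>D\<^esub> e \<in> P" using e f by (auto simp: P_def)
      moreover have "e = inv\<^bsub>D\<^esub> f \<otimes>\<^bsub>D\<^esub> (f \<otimes>\<^bsub>D\<^esub> e)" using eD fD by (simp add: D.m_assoc[symmetric])
      ultimately show "e \<in> ?F" by blast
    qed
    have idx: "inv\<^bsub>D\<^esub> (inv\<^bsub>D\<^esub> f \<otimes>\<^bsub>D\<^esub> e) \<otimes>\<^bsub>D\<^esub> (inv\<^bsub>D\<^esub> f \<otimes>\<^bsub>D\<^esub> d) = inv\<^bsub>D\<^esub> e \<otimes>\<^bsub>D\<^esub> d"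
      if "e \<in> carrier D" for e
    proof -
      have "inv\<^bsub>D\<^esub> (inv\<^bsub>D\<^esub> f \<otimes>\<^bsub>D\<^esub> e) \<otimes>\<^bsub>D\<^esub> (inv\<^bsub>D\<^esub> f \<otimes>\<^bsub>D\<^esub> d)
          = inv\<^bsub>D\<^esub> e \<otimes>\<^bsub>D\<^esub> (f \<otimes>\<^bsub>D\<^esub> (inv\<^bsub>D\<^esub> f \<otimes>\<^bsub>D\<^esub> d))"
        using that fD d by (simp add: D.inv_mult_group D.m_assoc)
      also have "\<dots> = inv\<^bsub>D\<^esub> e \<otimes>\<^bsub>D\<^esub> d"
        using that fD d by (simp add: D.m_assoc[symmetric])
      finally show ?thesis .
    qed
    have "(y \<otimes>\<^bsub>group_ring A D\<^esub> z) (inv\<^bsub>D\<^esub> f \<otimes>\<^bsub>D\<^esub> d)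
        = (\<Oplus>e\<in>?F. y e \<otimes> z (inv\<^bsub>D\<^esub> e \<otimes>\<^bsub>D\<^esub> (inv\<^bsub>D\<^esub> f \<otimes>\<^bsub>D\<^esub> d)))"
      using fD d P sub pD by (intro group_ring_mult_app[OF y z]) auto
    also have "\<dots> = (\<Oplus>e\<in>P. y (inv\<^bsub>D\<^esub> f \<otimes>\<^bsub>D\<^esub> e) \<otimes>
        z (inv\<^bsub>D\<^esub> (inv\<^bsub>D\<^esub> f \<otimes>\<^bsub>D\<^esub> e) \<otimes>\<^bsub>D\<^esub> (inv\<^bsub>D\<^esub> f \<otimes>\<^bsub>D\<^esub> d)))"
      using fD d pD by (intro A.finsum_reindex inj) auto
    also have "\<dots> = (\<Oplus>e\<in>P. y (inv\<^bsub>D\<^esub> f \<otimes>\<^bsub>D\<^esub> e) \<otimes> z (inv\<^bsub>D\<^esub> e \<otimes>\<^bsub>D\<^esub> d))"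
      using fD d pD by (intro A.finsum_cong') (auto simp: idx)
    finally show ?thesis by simp
  qed
  have "((x \<otimes>\<^bsub>group_ring A D\<^esub> y) \<otimes>\<^bsub>group_ring A D\<^esub> z) d
      = (\<Oplus>e\<in>P. (x \<otimes>\<^bsub>group_ring A D\<^esub> y) e \<otimes> z (inv\<^bsub>D\<^esub> e \<otimes>\<^bsub>D\<^esub> d))"
    using P sp by (intro group_ring_mult_app group_ring_mult_closed x y z d) auto
  also have "\<dots> = (\<Oplus>e\<in>P. \<Oplus>f\<in>supp A D x. x f \<otimes> (y (inv\<^bsub>D\<^esub> f \<otimes>\<^bsub>D\<^esub> e) \<otimes> z (inv\<^bsub>D\<^esub> e \<otimes>\<^bsub>D\<^esub> d)))"
  proof (intro A.finsum_cong' refl)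
    fix e assume e: "e \<in> P"
    have "(x \<otimes>\<^bsub>group_ring A D\<^esub> y) e \<otimes> z (inv\<^bsub>D\<^esub> e \<otimes>\<^bsub>D\<^esub> d)
        = (\<Oplus>f\<in>supp A D x. x f \<otimes> y (inv\<^bsub>D\<^esub> f \<otimes>\<^bsub>D\<^esub> e)) \<otimes> z (inv\<^bsub>D\<^esub> e \<otimes>\<^bsub>D\<^esub> d)"
      using X pD[OF e] by (subst group_ring_mult_app[OF x y, of _ "supp A D x"]) auto
    also have "\<dots> = (\<Oplus>f\<in>supp A D x. x f \<otimes> y (inv\<^bsub>D\<^esub> f \<otimes>\<^bsub>D\<^esub> e) \<otimes> z (inv\<^bsub>D\<^esub> e \<otimes>\<^bsub>D\<^esub> d))"
      using X pD[OF e] d xD by (intro A.finsum_ldistr) auto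
    also have "\<dots> = (\<Oplus>f\<in>supp A D x. x f \<otimes> (y (inv\<^bsub>D\<^esub> f \<otimes>\<^bsub>D\<^esub> e) \<otimes> z (inv\<^bsub>D\<^esub> e \<otimes>\<^bsub>D\<^esub> d)))"
      using pD[OF e] d xD by (intro A.finsum_cong') (auto simp: A.m_assoc)
    finally show "(x \<otimes>\<^bsub>group_ring A D\<^esub> y) e \<otimes> z (inv\<^bsub>D\<^esub> e \<otimes>\<^bsub>D\<^esub> d) = \<dots>" .
  qed (use pD xD d in auto)
  also have "\<dots> = (\<Oplus>f\<in>supp A D x. \<Oplus>e\<in>P. x f \<otimes> (y (inv\<^bsub>D\<^esub> f \<otimes>\<^bsub>D\<^esub> e) \<otimes> z (inv\<^bsub>D\<^esub> e \<otimes>\<^bsub>D\<^esub> d)))"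
    using P X pD xD d by (intro finsum_swap) auto
  also have "\<dots> = (\<Oplus>f\<in>supp A D x. x f \<otimes> (y \<otimes>\<^bsub>group_ring A D\<^esub> z) (inv\<^bsub>D\<^esub> f \<otimes>\<^bsub>D\<^esub> d))"
  proof (intro A.finsum_cong' refl)
    fix f assume f: "f \<in> supp A D x"
    show "(\<Oplus>e\<in>P. x f \<otimes> (y (inv\<^bsub>D\<^esub> f \<otimes>\<^bsub>D\<^esub> e) \<otimes> z (inv\<^bsub>D\<^esub> e \<otimes>\<^bsub>D\<^esub> d)))
        = x f \<otimes> (y \<otimes>\<^bsub>group_ring A D\<^esub> z) (inv\<^bsub>D\<^esub> f \<otimes>\<^bsub>D\<^esub> d)"
      unfolding inner[OF f, symmetric]
      using P pD xD[OF f] d by (intro A.finsum_rdistr[symmetric]) auto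
  qed (use pD xD d shift_closed[OF group_ring_mult_closed[OF y z]] in auto)
  also have "\<dots> = (x \<otimes>\<^bsub>group_ring A D\<^esub> (y \<otimes>\<^bsub>group_ring A D\<^esub> z)) d"
    using X by (intro group_ring_mult_app[symmetric] group_ring_mult_closed x y z d) auto
  finally show "((x \<otimes>\<^bsub>group_ring A D\<^esub> y) \<otimes>\<^bsub>group_ring A D\<^esub> z) d
      = (x \<otimes>\<^bsub>group_ring A D\<^esub> (y \<otimes>\<^bsub>group_ring A D\<^esub> z)) d" .
qed (intro group_ring_mult_closed x y z)+

lemma gmonom_mult_app:
  assumes x: "x \<in> carrier (group_ring A D)" and a: "a \<in> carrier A"
    and d: "d \<in> carrier D" and e: "e \<in> carrier D"
  shows "(gmonom A D a e \<otimes>\<^bsub>group_ring A D\<^esub> x) d = a \<otimes> x (inv\<^bsub>D\<^esub> e \<otimes>\<^bsub>D\<^esub> d)"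
proof -
  have "(gmonom A D a e \<otimes>\<^bsub>group_ring A D\<^esub> x) d
      = (\<Oplus>f\<in>{e}. gmonom A D a e f \<otimes> x (inv\<^bsub>D\<^esub> f \<otimes>\<^bsub>D\<^esub> d))"
    using e by (intro group_ring_mult_app gmonom_closed x a d) (auto simp: supp_def gmonom_def split: if_splits)
  then show ?thesis using e a d group_ring_memD(1)[OF x] by (simp add: gmonom_def)
qed

lemma group_ring_cring: "cring (group_ring A D)"
proof (rule cringI)
  show "abelian_group (group_ring A D)"
  proof (rule abelian_groupI)
    fix x y assume x: "x \<in> carrier (group_ring A D)" and y: "y \<in> carrier (group_ring A D)"
    show "x \<oplus>\<^bsub>group_ring A D\<^esub> y \<in> carrier (group_ring A D)"
      using group_ring_memD[OF x] group_ring_memD[OF y]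
      by (intro group_ring_memI[where F = "supp A D x \<union> supp A D y"])
        (auto simp: group_ring_add_app, auto simp: group_ring_def)
  next
    show "\<zero>\<^bsub>group_ring A D\<^esub> \<in> carrier (group_ring A D)"
      by (rule group_ring_memI[where F = "{}"]) (auto simp: group_ring_def)
  next
    fix x assume x: "x \<in> carrier (group_ring A D)"
    let ?y = "\<lambda>d\<in>carrier D. \<ominus> x d"
    have "?y \<in> carrier (group_ring A D)"
      using group_ring_memD[OF x] by (intro group_ring_memI[where F = "supp A D x"]) auto
    moreover have "?y \<oplus>\<^bsub>group_ring A D\<^esub> x = \<zero>\<^bsub>group_ring A D\<^esub>"
      using group_ring_memD(1)[OF x] by (auto simp: group_ring_def A.l_neg intro!: restrict_ext)
    ultimately show "\<exists>y\<in>carrier (group_ring A D). y \<oplus>\<^bsub>group_ring A D\<^esub> x = \<zero>\<^bsub>group_ring A D\<^esub>"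
      by blast
  next
    fix x assume x: "x \<in> carrier (group_ring A D)"
    show "\<zero>\<^bsub>group_ring A D\<^esub> \<oplus>\<^bsub>group_ring A D\<^esub> x = x"
      using group_ring_memD(1,2)[OF x]
      by (intro extensionalityI[of _ "carrier D"]) (auto simp: group_ring_def)
  qed (auto simp: group_ring_def A.a_ac PiE_def Pi_def intro!: restrict_ext)
next
  show "Group.comm_monoid (group_ring A D)"
  proof (rule comm_monoidI)
    show "\<one>\<^bsub>group_ring A D\<^esub> \<in> carrier (group_ring A D)"
      by (simp add: group_ring_one gmonom_closed)
  next
    fix x assume x: "x \<in> carrier (group_ring A D)"
    show "\<one>\<^bsub>group_ring A D\<^esub> \<otimes>\<^bsub>group_ring A D\<^esub> x = x"
      unfolding group_ring_one
      by (rule group_ring_eqI)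
        (auto simp: gmonom_mult_app x gmonom_closed group_ring_mult_closed group_ring_memD(1)[OF x])
  qed (fact group_ring_mult_closed group_ring_mult_assoc group_ring_mult_comm)+
next
  fix x y z
  assume x: "x \<in> carrier (group_ring A D)" and y: "y \<in> carrier (group_ring A D)"
    and z: "z \<in> carrier (group_ring A D)"
  have add_closed: "u \<oplus>\<^bsub>group_ring A D\<^esub> v \<in> carrier (group_ring A D)"
    if "u \<in> carrier (group_ring A D)" "v \<in> carrier (group_ring A D)" for u v
    using group_ring_memD[OF that(1)] group_ring_memD[OF that(2)]
    by (intro group_ring_memI[where F = "supp A D u \<union> supp A D v"])
      (auto simp: group_ring_add_app, auto simp: group_ring_def)
  show "(x \<oplus>\<^bsub>group_ring A D\<^esub> y) \<otimes>\<^bsub>group_ring A D\<^esub> z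
      = x \<otimes>\<^bsub>group_ring A D\<^esub> z \<oplus>\<^bsub>group_ring A D\<^esub> y \<otimes>\<^bsub>group_ring A D\<^esub> z"
  proof (rule group_ring_eqI)
    note [simp] = group_ring_memD(1)[OF x] group_ring_memD(1)[OF y] group_ring_memD(1)[OF z]
    fix d assume d: "d \<in> carrier D"
    let ?F = "supp A D x \<union> supp A D y"
    have F: "finite ?F" "?F \<subseteq> carrier D"
      using group_ring_memD(3,4)[OF x] group_ring_memD(3,4)[OF y] by auto
    have FD: "e \<in> ?F \<Longrightarrow> e \<in> carrier D" for e using F by auto
    have sub: "supp A D (x \<oplus>\<^bsub>group_ring A D\<^esub> y) \<subseteq> ?F"
      by (auto simp: supp_def group_ring_add_app)
    have "((x \<oplus>\<^bsub>group_ring A D\<^esub> y) \<otimes>\<^bsub>group_ring A D\<^esub> z) d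
        = (\<Oplus>e\<in>?F. (x \<oplus>\<^bsub>group_ring A D\<^esub> y) e \<otimes> z (inv\<^bsub>D\<^esub> e \<otimes>\<^bsub>D\<^esub> d))"
      using F sub by (intro group_ring_mult_app add_closed x y z d) auto
    also have "\<dots> = (\<Oplus>e\<in>?F. x e \<otimes> z (inv\<^bsub>D\<^esub> e \<otimes>\<^bsub>D\<^esub> d) \<oplus> y e \<otimes> z (inv\<^bsub>D\<^esub> e \<otimes>\<^bsub>D\<^esub> d))"
      using FD d by (intro A.finsum_cong') (auto simp: group_ring_add_app A.l_distr)
    also have "\<dots> = (\<Oplus>e\<in>?F. x e \<otimes> z (inv\<^bsub>D\<^esub> e \<otimes>\<^bsub>D\<^esub> d)) \<oplus> (\<Oplus>e\<in>?F. y e \<otimes> z (inv\<^bsub>D\<^esub> e \<otimes>\<^bsub>D\<^esub> d))"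
      using FD d by (intro A.finsum_addf) auto
    also have "\<dots> = (x \<otimes>\<^bsub>group_ring A D\<^esub> z) d \<oplus> (y \<otimes>\<^bsub>group_ring A D\<^esub> z) d"
      using F group_ring_mult_app[OF x z d, of ?F] group_ring_mult_app[OF y z d, of ?F] by simp
    finally show "((x \<oplus>\<^bsub>group_ring A D\<^esub> y) \<otimes>\<^bsub>group_ring A D\<^esub> z) d
        = (x \<otimes>\<^bsub>group_ring A D\<^esub> z \<oplus>\<^bsub>group_ring A D\<^esub> y \<otimes>\<^bsub>group_ring A D\<^esub> z) d"
      using d by (simp add: group_ring_add_app)
  qed (intro add_closed group_ring_mult_closed x y z)+
qed

lemma gmonom_mult_gmonom:
  assumes "a \<in> carrier A" "b \<in> carrier A" "d \<in> carrier D" "e \<in> carrier D"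
  shows "gmonom A D a d \<otimes>\<^bsub>group_ring A D\<^esub> gmonom A D b e = gmonom A D (a \<otimes> b) (d \<otimes>\<^bsub>D\<^esub> e)"
proof (rule group_ring_eqI)
  fix f assume f: "f \<in> carrier D"
  have "inv\<^bsub>D\<^esub> d \<otimes>\<^bsub>D\<^esub> f = e \<longleftrightarrow> f = d \<otimes>\<^bsub>D\<^esub> e"
    using assms f by (auto simp: D.m_assoc[symmetric])
  then show "(gmonom A D a d \<otimes>\<^bsub>group_ring A D\<^esub> gmonom A D b e) f = gmonom A D (a \<otimes> b) (d \<otimes>\<^bsub>D\<^esub> e) f"
    using assms f by (auto simp: gmonom_mult_app gmonom_closed, auto simp: gmonom_def)
qed (use assms in \<open>auto intro: group_ring_mult_closed gmonom_closed\<close>)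

lemma const_ring_hom: "(\<lambda>a. gmonom A D a \<one>\<^bsub>D\<^esub>) \<in> ring_hom A (group_ring A D)"
proof (rule ring_hom_memI)
  fix a b assume "a \<in> carrier A" "b \<in> carrier A"
  then show "gmonom A D (a \<oplus> b) \<one>\<^bsub>D\<^esub> = gmonom A D a \<one>\<^bsub>D\<^esub> \<oplus>\<^bsub>group_ring A D\<^esub> gmonom A D b \<one>\<^bsub>D\<^esub>"
    by (auto simp: gmonom_def group_ring_def intro!: restrict_ext)
qed (auto simp: gmonom_closed gmonom_mult_gmonom group_ring_one)

lemma group_ring_finsum_app:
  assumes "finite F" "\<And>i. i \<in> F \<Longrightarrow> t i \<in> carrier (group_ring A D)" "d \<in> carrier D"
  shows "(\<Oplus>\<^bsub>group_ring A D\<^esub>i\<in>F. t i) d = (\<Oplus>i\<in>F. t i d)"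
proof -
  interpret G: cring "group_ring A D" by (rule group_ring_cring)
  show ?thesis
    using assms(1,2)
  proof (induction F rule: finite_induct)
    case empty
    then show ?case using assms(3) by (simp add: group_ring_zero_app)
  next
    case (insert i F)
    then show ?case using assms(3) group_ring_memD(1)
      by (simp add: group_ring_add_app Pi_def)
  qed
qed

lemma group_ring_expand:
  assumes x: "x \<in> carrier (group_ring A D)"
  shows "x = (\<Oplus>\<^bsub>group_ring A D\<^esub>d\<in>supp A D x. gmonom A D (x d) d)"
proof -
  interpret G: cring "group_ring A D" by (rule group_ring_cring)
  note X = group_ring_memD(3,4)[OF x]
  have cl: "gmonom A D (x d) d \<in> carrier (group_ring A D)" if "d \<in> supp A D x" for d
    using that X group_ring_memD(1)[OF x] by (intro gmonom_closed) auto
  show ?thesis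
  proof (rule group_ring_eqI)
    fix e assume e: "e \<in> carrier D"
    have "(\<Oplus>\<^bsub>group_ring A D\<^esub>d\<in>supp A D x. gmonom A D (x d) d) e
        = (\<Oplus>d\<in>supp A D x. gmonom A D (x d) d e)"
      using X cl e by (intro group_ring_finsum_app) auto
    also have "\<dots> = (\<Oplus>d\<in>supp A D x. if e = d then x d else \<zero>)"
      using e X group_ring_memD(1)[OF x] by (intro A.finsum_cong') (auto simp: gmonom_def)
    also have "\<dots> = x e"
    proof (cases "e \<in> supp A D x")
      case True
      then show ?thesis
        using X group_ring_memD(1)[OF x] by (intro A.finsum_singleton) auto
    next
      case False
      then have "(\<Oplus>d\<in>supp A D x. if e = d then x d else \<zero>) = \<zero>"
        by (intro A.add.finprod_one_eqI) auto
      then show ?thesis using False group_ring_memD(5)[OF x e] by simp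
    qed
    finally show "x e = (\<Oplus>\<^bsub>group_ring A D\<^esub>d\<in>supp A D x. gmonom A D (x d) d) e" by simp
  qed (use cl x in auto)
qed

end

text \<open>
  For a subring \<open>K\<close> of \<open>A\<close>, the ring \<open>A[D]\<close> is the tensor product \<open>K[D] \<otimes>\<^sub>K A\<close>: it is
  the pushout of \<open>K[D] \<leftarrow> K \<rightarrow> A\<close>. Hence \<open>Spec A[D]\<close> is \<open>G \<times>\<^sub>K Spec A\<close> for \<open>G = Spec K[D]\<close>, whatever
  base ring \<open>K\<close> is used.
\<close>

lemma group_ring_pushout:
  fixes A :: "('a, 'm) ring_scheme" (structure) and D :: "('d, 'n) monoid_scheme"
    and B :: "('b, 'k) ring_scheme"
  assumes A: "cring A" and D: "comm_group D" and K: "subring K A" and B: "cring B"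
    and f: "f \<in> ring_hom (group_ring (A\<lparr>carrier := K\<rparr>) D) B" and g: "g \<in> ring_hom A B"
    and fg: "\<And>k. k \<in> K \<Longrightarrow> f (gmonom A D k \<one>\<^bsub>D\<^esub>) = g k"
  shows "\<exists>h\<in>ring_hom (group_ring A D) B.
           (\<forall>x\<in>carrier (group_ring (A\<lparr>carrier := K\<rparr>) D). h x = f x) \<and>
           (\<forall>a\<in>carrier A. h (gmonom A D a \<one>\<^bsub>D\<^esub>) = g a) \<and>
           (\<forall>h'\<in>ring_hom (group_ring A D) B.
              (\<forall>x\<in>carrier (group_ring (A\<lparr>carrier := K\<rparr>) D). h' x = f x) \<and>
              (\<forall>a\<in>carrier A. h' (gmonom A D a \<one>\<^bsub>D\<^esub>) = g a) \<longrightarrow>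
              (\<forall>x\<in>carrier (group_ring A D). h' x = h x))"
proof -
  interpret A: cring A by (rule A)
  interpret D: comm_group D by (rule D)
  interpret B: cring B by (rule B)
  interpret K: subring K A by (rule K)
  let ?K = "A\<lparr>carrier := K\<rparr>"
  let ?AD = "group_ring A D" and ?KD = "group_ring ?K D"
  have KA: "K \<subseteq> carrier A" by (rule K.subset)
  have cK: "cring ?K"
    using A.subcring_iff[OF KA] A.subcringI'[OF K] by simp
  interpret AD: cring ?AD by (rule group_ring_cring[OF A D])
  interpret KD: cring ?KD by (rule group_ring_cring[OF cK D])
  interpret g: ring_hom_cring A B g
    by (rule ring_hom_cringI[OF A B g])
  interpret f: ring_hom_cring ?KD B f
    by (rule ring_hom_cringI[OF KD.is_cring B f])
  have suppK: "supp ?K D x = supp A D x" for x by (simp add: supp_def)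
  have monK: "gmonom ?K D k d = gmonom A D k d" for k d
    by (simp add: gmonom_def cong: if_cong)
  have KD_sub: "x \<in> carrier ?AD" if "x \<in> carrier ?KD" for x
    using that KA by (auto simp: group_ring_def suppK PiE_def Pi_def)
  define \<tau> where "\<tau> d = f (gmonom A D \<one> d)" for d
  have monK_closed: "gmonom A D k d \<in> carrier ?KD" if "k \<in> K" for k d
    using gmonom_closed[OF cK D, of k d] that by (simp add: monK)
  have \<tau>_closed [simp]: "\<tau> d \<in> carrier B" for d
    unfolding \<tau>_def by (rule f.hom_closed) (simp add: monK_closed)
  have \<tau>_mult: "\<tau> (d \<otimes>\<^bsub>D\<^esub> e) = \<tau> d \<otimes>\<^bsub>B\<^esub> \<tau> e" if "d \<in> carrier D" "e \<in> carrier D" for d e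
  proof -
    have "gmonom A D \<one> (d \<otimes>\<^bsub>D\<^esub> e) = gmonom A D \<one> d \<otimes>\<^bsub>?KD\<^esub> gmonom A D \<one> e"
      using gmonom_mult_gmonom[OF cK D, of \<one> \<one> d e] that by (simp add: monK)
    then show ?thesis unfolding \<tau>_def by (simp add: monK_closed)
  qed
  have f_mon: "f (gmonom A D k d) = g k \<otimes>\<^bsub>B\<^esub> \<tau> d" if "k \<in> K" "d \<in> carrier D" for k d
  proof -
    have "gmonom A D k d = gmonom A D k \<one>\<^bsub>D\<^esub> \<otimes>\<^bsub>?KD\<^esub> gmonom A D \<one> d"
      using gmonom_mult_gmonom[OF cK D, of k \<one> "\<one>\<^bsub>D\<^esub>" d] that KA by (auto simp: monK)
    then show ?thesis unfolding \<tau>_def using that by (simp add: monK_closed fg)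
  qed
  define h where "h x = (\<Oplus>\<^bsub>B\<^esub>d\<in>supp A D x. g (x d) \<otimes>\<^bsub>B\<^esub> \<tau> d)" for x
  note mD = group_ring_memD[OF A D]
  have h_on: "h x = (\<Oplus>\<^bsub>B\<^esub>d\<in>F. g (x d) \<otimes>\<^bsub>B\<^esub> \<tau> d)"
    if x: "x \<in> carrier ?AD" and F: "finite F" "supp A D x \<subseteq> F" "F \<subseteq> carrier D" for x F
    unfolding h_def using F mD[OF x]
    by (intro B.add.finprod_mono_neutral_cong_left) (auto simp: subset_iff)
  have h_closed: "h x \<in> carrier B" if x: "x \<in> carrier ?AD" for x
    unfolding h_def using mD[OF x] by (intro B.finsum_closed) (auto simp: subset_iff)
  have h_add: "h (x \<oplus>\<^bsub>?AD\<^esub> y) = h x \<oplus>\<^bsub>B\<^esub> h y"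
    if x: "x \<in> carrier ?AD" and y: "y \<in> carrier ?AD" for x y
  proof -
    let ?F = "supp A D x \<union> supp A D y"
    have F: "finite ?F" "?F \<subseteq> carrier D" using mD(3,4)[OF x] mD(3,4)[OF y] by auto
    have FD: "d \<in> ?F \<Longrightarrow> d \<in> carrier D" for d using F by auto
    have sub: "supp A D (x \<oplus>\<^bsub>?AD\<^esub> y) \<subseteq> ?F"
      by (auto simp: supp_def group_ring_add_app[OF A D])
    have "h (x \<oplus>\<^bsub>?AD\<^esub> y) = (\<Oplus>\<^bsub>B\<^esub>d\<in>?F. g ((x \<oplus>\<^bsub>?AD\<^esub> y) d) \<otimes>\<^bsub>B\<^esub> \<tau> d)"
      using F sub x y by (intro h_on) auto
    also have "\<dots> = (\<Oplus>\<^bsub>B\<^esub>d\<in>?F. g (x d) \<otimes>\<^bsub>B\<^esub> \<tau> d \<oplus>\<^bsub>B\<^esub> g (y d) \<otimes>\<^bsub>B\<^esub> \<tau> d)"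
      using FD mD(1)[OF x] mD(1)[OF y]
      by (intro B.finsum_cong') (auto simp: group_ring_add_app[OF A D] B.l_distr)
    also have "\<dots> = (\<Oplus>\<^bsub>B\<^esub>d\<in>?F. g (x d) \<otimes>\<^bsub>B\<^esub> \<tau> d) \<oplus>\<^bsub>B\<^esub> (\<Oplus>\<^bsub>B\<^esub>d\<in>?F. g (y d) \<otimes>\<^bsub>B\<^esub> \<tau> d)"
      using FD mD(1)[OF x] mD(1)[OF y] by (intro B.finsum_addf) auto
    also have "\<dots> = h x \<oplus>\<^bsub>B\<^esub> h y"
      using F h_on[OF x, of ?F] h_on[OF y, of ?F] by simp
    finally show ?thesis .
  qed
  have h_gmonom: "h (gmonom A D a d) = g a \<otimes>\<^bsub>B\<^esub> \<tau> d" if "a \<in> carrier A" "d \<in> carrier D" for a d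
  proof -
    have "h (gmonom A D a d) = (\<Oplus>\<^bsub>B\<^esub>e\<in>{d}. g (gmonom A D a d e) \<otimes>\<^bsub>B\<^esub> \<tau> e)"
      using that by (intro h_on gmonom_closed[OF A D]) (auto simp: supp_def gmonom_def split: if_splits)
    then show ?thesis using that by (simp add: gmonom_def)
  qed
  have \<tau>_one: "\<tau> \<one>\<^bsub>D\<^esub> = \<one>\<^bsub>B\<^esub>" using fg[of \<one>] by (simp add: \<tau>_def)
  have add_hom_finsum: "k (\<Oplus>\<^bsub>?AD\<^esub>i\<in>F. t i) = (\<Oplus>\<^bsub>B\<^esub>i\<in>F. k (t i))"
    if "finite F" "\<And>i. i \<in> F \<Longrightarrow> t i \<in> carrier ?AD"
      and k: "\<And>x. x \<in> carrier ?AD \<Longrightarrow> k x \<in> carrier B" "k \<zero>\<^bsub>?AD\<^esub> = \<zero>\<^bsub>B\<^esub>"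
      "\<And>x y. \<lbrakk>x \<in> carrier ?AD; y \<in> carrier ?AD\<rbrakk> \<Longrightarrow> k (x \<oplus>\<^bsub>?AD\<^esub> y) = k x \<oplus>\<^bsub>B\<^esub> k y"
    for k F and t :: "'d \<Rightarrow> 'd \<Rightarrow> 'a"
    using that(1,2)
  proof (induction F rule: finite_induct)
    case (insert i F)
    then show ?case by (simp add: k Pi_def AD.finsum_closed)
  qed (simp add: k)
  have h_zero: "h \<zero>\<^bsub>?AD\<^esub> = \<zero>\<^bsub>B\<^esub>"
  proof -
    have "supp A D \<zero>\<^bsub>?AD\<^esub> = {}" by (auto simp: supp_def group_ring_zero_app[OF A D])
    then show ?thesis by (simp add: h_def)
  qed
  have h_mon_mult: "h (gmonom A D a d \<otimes>\<^bsub>?AD\<^esub> y) = h (gmonom A D a d) \<otimes>\<^bsub>B\<^esub> h y"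
    if a: "a \<in> carrier A" and d: "d \<in> carrier D" and y: "y \<in> carrier ?AD" for a d y
  proof -
    let ?m = "gmonom A D a d"
    have m: "?m \<in> carrier ?AD" using a by (rule gmonom_closed[OF A D])
    let ?F = "(\<lambda>e. d \<otimes>\<^bsub>D\<^esub> e) ` supp A D y"
    note Y = mD(3,4)[OF y]
    have yD: "e \<in> supp A D y \<Longrightarrow> e \<in> carrier D" for e using Y by auto
    have idx: "inv\<^bsub>D\<^esub> d \<otimes>\<^bsub>D\<^esub> (d \<otimes>\<^bsub>D\<^esub> e) = e" if "e \<in> carrier D" for e
      using that d by (simp add: D.m_assoc[symmetric])
    have sub: "supp A D (?m \<otimes>\<^bsub>?AD\<^esub> y) \<subseteq> ?F"
    proof
      fix e assume e: "e \<in> supp A D (?m \<otimes>\<^bsub>?AD\<^esub> y)"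
      then have eD: "e \<in> carrier D" by (simp add: supp_def)
      have "a \<otimes> y (inv\<^bsub>D\<^esub> d \<otimes>\<^bsub>D\<^esub> e) \<noteq> \<zero>"
        using e gmonom_mult_app[OF A D y a eD d] by (simp add: supp_def)
      then have "inv\<^bsub>D\<^esub> d \<otimes>\<^bsub>D\<^esub> e \<in> supp A D y" using a d eD by (auto simp: supp_def)
      moreover have "e = d \<otimes>\<^bsub>D\<^esub> (inv\<^bsub>D\<^esub> d \<otimes>\<^bsub>D\<^esub> e)" using d eD by (simp add: D.m_assoc[symmetric])
      ultimately show "e \<in> ?F" by blast
    qed
    have "h (?m \<otimes>\<^bsub>?AD\<^esub> y) = (\<Oplus>\<^bsub>B\<^esub>e\<in>?F. g ((?m \<otimes>\<^bsub>?AD\<^esub> y) e) \<otimes>\<^bsub>B\<^esub> \<tau> e)"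
      using Y sub d yD m y by (intro h_on) auto
    also have "\<dots> = (\<Oplus>\<^bsub>B\<^esub>e\<in>?F. g (a \<otimes> y (inv\<^bsub>D\<^esub> d \<otimes>\<^bsub>D\<^esub> e)) \<otimes>\<^bsub>B\<^esub> \<tau> e)"
      using d yD a mD(1)[OF y] by (intro B.finsum_cong') (auto simp: gmonom_mult_app[OF A D y a _ d])
    also have "\<dots> = (\<Oplus>\<^bsub>B\<^esub>e\<in>supp A D y. g (a \<otimes> y (inv\<^bsub>D\<^esub> d \<otimes>\<^bsub>D\<^esub> (d \<otimes>\<^bsub>D\<^esub> e))) \<otimes>\<^bsub>B\<^esub> \<tau> (d \<otimes>\<^bsub>D\<^esub> e))"
      using d yD a mD(1)[OF y] by (intro B.finsum_reindex) (auto simp: inj_on_def)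
    also have "\<dots> = (\<Oplus>\<^bsub>B\<^esub>e\<in>supp A D y. (g a \<otimes>\<^bsub>B\<^esub> \<tau> d) \<otimes>\<^bsub>B\<^esub> (g (y e) \<otimes>\<^bsub>B\<^esub> \<tau> e))"
      using d yD a mD(1)[OF y]
      by (intro B.finsum_cong') (auto simp: idx \<tau>_mult B.m_ac)
    also have "\<dots> = (g a \<otimes>\<^bsub>B\<^esub> \<tau> d) \<otimes>\<^bsub>B\<^esub> h y"
      unfolding h_def using Y a yD mD(1)[OF y] by (intro B.finsum_rdistr[symmetric]) auto
    finally show ?thesis using a d by (simp add: h_gmonom)
  qed
  have h_mult: "h (x \<otimes>\<^bsub>?AD\<^esub> y) = h x \<otimes>\<^bsub>B\<^esub> h y"
    if x: "x \<in> carrier ?AD" and y: "y \<in> carrier ?AD" for x y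
  proof -
    note X = mD(3,4)[OF x]
    have xD: "e \<in> supp A D x \<Longrightarrow> e \<in> carrier D" for e using X by auto
    have mc: "e \<in> supp A D x \<Longrightarrow> gmonom A D (x e) e \<in> carrier ?AD" for e
      using xD mD(1)[OF x] gmonom_closed[OF A D] by blast
    have "h (x \<otimes>\<^bsub>?AD\<^esub> y) = h ((\<Oplus>\<^bsub>?AD\<^esub>d\<in>supp A D x. gmonom A D (x d) d) \<otimes>\<^bsub>?AD\<^esub> y)"
      using group_ring_expand[OF A D x] by simp
    also have "\<dots> = h (\<Oplus>\<^bsub>?AD\<^esub>d\<in>supp A D x. gmonom A D (x d) d \<otimes>\<^bsub>?AD\<^esub> y)"
      using X mc y by (subst AD.finsum_ldistr) auto
    also have "\<dots> = (\<Oplus>\<^bsub>B\<^esub>d\<in>supp A D x. h (gmonom A D (x d) d \<otimes>\<^bsub>?AD\<^esub> y))"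
      using X mc y h_closed h_zero h_add by (intro add_hom_finsum) auto
    also have "\<dots> = (\<Oplus>\<^bsub>B\<^esub>d\<in>supp A D x. h (gmonom A D (x d) d) \<otimes>\<^bsub>B\<^esub> h y)"
      using xD mD(1)[OF x] y mc h_closed by (intro B.finsum_cong') (auto simp: h_mon_mult)
    also have "\<dots> = (\<Oplus>\<^bsub>B\<^esub>d\<in>supp A D x. h (gmonom A D (x d) d)) \<otimes>\<^bsub>B\<^esub> h y"
      using X mc h_closed y by (intro B.finsum_ldistr[symmetric]) auto
    also have "(\<Oplus>\<^bsub>B\<^esub>d\<in>supp A D x. h (gmonom A D (x d) d)) = h (\<Oplus>\<^bsub>?AD\<^esub>d\<in>supp A D x. gmonom A D (x d) d)"
      using X mc h_closed h_zero h_add by (intro add_hom_finsum[symmetric]) auto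
    also have "\<dots> = h x" using group_ring_expand[OF A D x] by simp
    finally show ?thesis .
  qed
  have hom: "h \<in> ring_hom ?AD B"
    by (rule ring_hom_memI)
      (auto simp: h_closed h_mult h_add group_ring_one[OF A D] h_gmonom \<tau>_one)
  have h_f: "h x = f x" if x: "x \<in> carrier ?KD" for x
  proof -
    note X = mD(3,4)[OF KD_sub[OF x]]
    have xK: "e \<in> supp A D x \<Longrightarrow> x e \<in> K \<and> e \<in> carrier D" for e
      using X group_ring_memD(1)[OF cK D x] by auto
    have "f x = f (\<Oplus>\<^bsub>?KD\<^esub>d\<in>supp A D x. gmonom A D (x d) d)"
      using group_ring_expand[OF cK D x] by (simp add: suppK monK)
    also have "\<dots> = (\<Oplus>\<^bsub>B\<^esub>d\<in>supp A D x. (f \<circ> (\<lambda>d. gmonom A D (x d) d)) d)"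
      using X xK monK_closed by (subst f.hom_finsum) auto
    also have "\<dots> = h x"
      unfolding h_def using xK KA by (intro B.finsum_cong') (auto simp: f_mon)
    finally show ?thesis by simp
  qed
  have h_g: "h (gmonom A D a \<one>\<^bsub>D\<^esub>) = g a" if "a \<in> carrier A" for a
    using that by (simp add: h_gmonom \<tau>_one)
  have uniq: "h' x = h x"
    if h': "h' \<in> ring_hom ?AD B" "\<forall>x\<in>carrier ?KD. h' x = f x"
      "\<forall>a\<in>carrier A. h' (gmonom A D a \<one>\<^bsub>D\<^esub>) = g a" and x: "x \<in> carrier ?AD" for h' x
  proof -
    interpret h': ring_hom_cring ?AD B h'
      by (rule ring_hom_cringI[OF AD.is_cring B h'(1)])
    note X = mD(3,4)[OF x]
    have xD: "e \<in> supp A D x \<Longrightarrow> x e \<in> carrier A \<and> e \<in> carrier D" for e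
      using X mD(1)[OF x] by auto
    have h'_mon: "h' (gmonom A D a d) = g a \<otimes>\<^bsub>B\<^esub> \<tau> d" if "a \<in> carrier A" "d \<in> carrier D" for a d
    proof -
      have "gmonom A D a d = gmonom A D a \<one>\<^bsub>D\<^esub> \<otimes>\<^bsub>?AD\<^esub> gmonom A D \<one> d"
        using gmonom_mult_gmonom[OF A D, of a \<one> "\<one>\<^bsub>D\<^esub>" d] that by simp
      then show ?thesis
        using that h'(2,3) by (simp add: gmonom_closed[OF A D] monK_closed \<tau>_def)
    qed
    have "h' x = h' (\<Oplus>\<^bsub>?AD\<^esub>d\<in>supp A D x. gmonom A D (x d) d)"
      using group_ring_expand[OF A D x] by simp
    also have "\<dots> = (\<Oplus>\<^bsub>B\<^esub>d\<in>supp A D x. (h' \<circ> (\<lambda>d. gmonom A D (x d) d)) d)"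
      using X xD gmonom_closed[OF A D] by (subst h'.hom_finsum) auto
    also have "\<dots> = h x"
      unfolding h_def using xD by (intro B.finsum_cong') (auto simp: h'_mon)
    finally show ?thesis .
  qed
  show ?thesis
    using hom h_f h_g uniq by (intro bexI[of _ h]) auto
qed

lemma (in graded_cring) components_homogeneous:
  assumes d: "d \<in> carrier D" and a: "a \<in> \<A> d"
  shows "components A D \<A> a = gmonom A D a d"
proof -
  have sub: "\<A> e \<subseteq> carrier A" "\<zero> \<in> \<A> e" if "e \<in> carrier D" for e
    using additive_subgroup.a_subset[OF additive[OF that]]
      additive_subgroup.zero_closed[OF additive[OF that]] by auto
  have aA: "a \<in> carrier A" using a sub(1)[OF d] by blast
  have "(\<Oplus>e\<in>supp A D (gmonom A D a d). gmonom A D a d e) = (\<Oplus>e\<in>{d}. gmonom A D a d e)"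
    using d aA by (intro add.finprod_mono_neutral_cong_left)
      (auto simp: supp_def gmonom_def split: if_splits)
  also have "\<dots> = a" using d aA by (simp add: gmonom_def)
  finally have sum: "(\<Oplus>e\<in>supp A D (gmonom A D a d). gmonom A D a d e) = a" .
  have "supp A D (gmonom A D a d) \<subseteq> {d}" by (auto simp: supp_def gmonom_def split: if_splits)
  then have "finite (supp A D (gmonom A D a d))" using finite_subset by blast
  moreover have "gmonom A D a d \<in> (\<Pi>\<^sub>E e\<in>carrier D. \<A> e)"
    using a sub(2) by (auto simp: gmonom_def)
  ultimately have "decomposition A D \<A> a (gmonom A D a d)"
    using sum by (simp add: decomposition_def)
  then show ?thesis
    unfolding components_def using direct_sum[OF aA] by (intro the1_equality)
qed

text \<open>
  The coaction \<open>A \<rightarrow> A[D]\<close> sends \<open>a = \<Sum>\<^sub>d a\<^sub>d\<close> to \<open>\<Sum>\<^sub>d a\<^sub>d T\<^sup>d\<close>, that is, to its family of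
  components.
\<close>

definition coaction ::
  "('a, 'm) ring_scheme \<Rightarrow> ('d, 'n) monoid_scheme \<Rightarrow> ('d \<Rightarrow> 'a set) \<Rightarrow> 'a \<Rightarrow> 'd \<Rightarrow> 'a" where
  "coaction A D \<A> a = components A D \<A> a"

lemma (in graded_cring) coaction_homogeneous:
  "\<lbrakk>d \<in> carrier D; a \<in> \<A> d\<rbrakk> \<Longrightarrow> coaction A D \<A> a = gmonom A D a d"
  by (simp add: coaction_def components_homogeneous)

text \<open>The two morphisms \<open>m, p\<^sub>2 : G \<times>\<^sub>K Spec A \<rightrightarrows> Spec A\<close>, where \<open>G \<times>\<^sub>K Spec A = Spec A[D]\<close>.\<close>

definition action_map ::
  "('a, 'm) ring_scheme \<Rightarrow> ('d, 'n) monoid_scheme \<Rightarrow> ('d \<Rightarrow> 'a set) \<Rightarrow>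
   (('d \<Rightarrow> 'a) set, ('d \<Rightarrow> 'a) set \<Rightarrow> (('d \<Rightarrow> 'a) \<times> ('d \<Rightarrow> 'a)) set,
    'a set, 'a set \<Rightarrow> ('a \<times> 'a) set) rs_map" where
  "action_map A D \<A> = Spec_map A (group_ring A D) (coaction A D \<A>)"

definition proj_map ::
  "('a, 'm) ring_scheme \<Rightarrow> ('d, 'n) monoid_scheme \<Rightarrow>
   (('d \<Rightarrow> 'a) set, ('d \<Rightarrow> 'a) set \<Rightarrow> (('d \<Rightarrow> 'a) \<times> ('d \<Rightarrow> 'a)) set,
    'a set, 'a set \<Rightarrow> ('a \<times> 'a) set) rs_map" where
  "proj_map A D = Spec_map A (group_ring A D) (\<lambda>a. gmonom A D a \<one>\<^bsub>D\<^esub>)"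

end

theory Submission
  imports Defs "HOL-Algebra.Ring_Divisibility"
begin

text \<open>
  Let \<open>\<pi> : Spec A \<rightarrow> Spec A\<^sub>0\<close>. The hypothesis says that a homogeneous ideal is contained in a prime as
  soon as its degree zero part is. Three applications of this give the theorem.

  Two primes \<open>P, Q\<close> in the same fibre of \<open>\<pi>\<close> have the same homogeneous core, and a minimal prime
  over this core is related to both of them by a point of \<open>Spec A[D]\<close>; so invariant maps are constant
  on the fibres. If the preimage under \<open>\<pi>\<close> of a set \<open>U\<close> is the complement of \<open>V(J)\<close>, then \<open>V(J)\<close> is also
  defined by the homogeneous core of \<open>J\<close>, hence by elements of \<open>A\<^sub>0\<close>, so that \<open>U\<close> is open. Finally
  \<open>(A\<^sub>0)\<^sub>p \<rightarrow> A\<^sub>P\<close> is injective for \<open>P\<close> over \<open>p\<close>, because annihilators of elements of \<open>A\<^sub>0\<close> are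
  homogeneous.

  An invariant section is locally of the form \<open>a / f\<close> with \<open>a f\<^sub>d = f a\<^sub>d\<close> for all degrees \<open>d\<close>, hence
  also \<open>a\<^sub>d / f\<^sub>d\<close> where \<open>f\<^sub>d\<close> does not vanish at the given point, and \<open>f\<^sub>d\<close> has a multiple in \<open>A\<^sub>0\<close> with the
  same property. So invariant sections are locally fractions over \<open>A\<^sub>0\<close>; by the first and the third
  application these fractions glue to a section on \<open>Spec A\<^sub>0\<close>. The morphism induced on \<open>Spec A\<^sub>0\<close> is local
  on stalks, as \<open>\<pi>\<close> is surjective and ring homomorphisms preserve units.
\<close>

text \<open>The action is given by points of \<open>Spec A[D]\<close>, so primes of A[D] with
  prescribed images are needed. All of them come from one device: a prime that contains J[D] and
  avoids every product of a constant c with the coaction of a. This product has the coefficients c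
  a_d, so the existence of the prime becomes a question about components. With J = P and c ranging
  outside P, the device fixes the projection of the new point completely but bounds its image under
  the action only from above. Hence the choice of a minimal prime N over the homogeneous core: the
  core is contained in that image, and minimality closes the gap. The core itself cannot replace N,
  because for a grading group with torsion the core of a prime need not be prime. The values of an
  invariant section at P and Q are therefore compared through a third point. The map of points and
  the comorphism of the factorization are obtained by choice; their algebraic properties are read
  off on \<open>Spec A\<close>, to which sections over A_0 pull back injectively.\<close>

section \<open>Prime ideals\<close>

text \<open>Krull's lemma. An ideal M maximal among those that contain I and miss S is prime: if a
  and b lie outside M, then M + (a) and M + (b) both meet S, and the product of the two elements
  found lies in S and, should a b be in M, also in M.\<close>

lemma (in cring) exists_primeideal_disjoint:
  assumes I: "ideal I R" and S: "submonoid S R" and disj: "I \<inter> S = {}"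
  obtains p where "primeideal p R" "I \<subseteq> p" "p \<inter> S = {}"
proof -
  interpret S: submonoid S R by (rule S)
  let ?Q = "{J. ideal J R \<and> I \<subseteq> J \<and> J \<inter> S = {}}"
  have "\<exists>M\<in>?Q. \<forall>X\<in>?Q. M \<subseteq> X \<longrightarrow> X = M"
  proof (rule subset_Zorn_nonempty)
    have "I \<in> ?Q" using I disj by simp
    then show "?Q \<noteq> {}" by blast
  next
    fix C assume C: "C \<noteq> {}" "subset.chain ?Q C"
    have CQ: "C \<subseteq> ?Q" using C(2) by (simp add: pred_on.chain_def)
    have "subset.chain {I. ideal I R} C"
      using C(2) CQ by (auto simp: pred_on.chain_def)
    from chain_Union_is_ideal[OF this] C(1) have "ideal (\<Union>C) R" by simp
    moreover have "I \<subseteq> \<Union>C" using C(1) CQ by auto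
    moreover have "\<Union>C \<inter> S = {}" using CQ by auto
    ultimately show "\<Union>C \<in> ?Q" by simp
  qed
  then obtain M where MQ: "M \<in> ?Q" and maxQ: "\<forall>X\<in>?Q. M \<subseteq> X \<longrightarrow> X = M"
    by (rule bexE)
  from MQ have M: "ideal M R" "I \<subseteq> M" "M \<inter> S = {}" by simp_all
  have max: "X = M" if "ideal X R" "M \<subseteq> X" "X \<inter> S = {}" for X
    using maxQ that M(2) by simp
  interpret M: ideal M R by (rule M(1))
  have hit: "\<exists>m\<in>M. \<exists>x\<in>carrier R. m \<oplus> x \<otimes> a \<in> S" if a: "a \<in> carrier R" "a \<notin> M" for a
  proof -
    have aP: "a \<in> PIdl a" using a(1) by (rule cgenideal_self)
    have id: "ideal (set_add R M (PIdl a)) R" by (intro add_ideals M(1) cgenideal_ideal a(1))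
    have sub: "M \<subseteq> set_add R M (PIdl a)"
    proof
      fix m assume m: "m \<in> M"
      then have "m = m \<oplus> \<zero> \<otimes> a" using a(1) by simp
      then show "m \<in> set_add R M (PIdl a)"
        using m by (auto simp: set_add_def' cgenideal_def)
    qed
    have "\<zero> \<oplus> a \<in> set_add R M (PIdl a)"
      using aP M.zero_closed unfolding set_add_def' by blast
    then have "a \<in> set_add R M (PIdl a)" using a(1) by simp
    then have "set_add R M (PIdl a) \<noteq> M" using a(2) by auto
    then have "(set_add R M (PIdl a)) \<inter> S \<noteq> {}"
      using max[OF id sub] by auto
    then obtain s where s: "s \<in> set_add R M (PIdl a)" "s \<in> S" by blast
    then obtain m x where "m \<in> M" "x \<in> carrier R" "s = m \<oplus> x \<otimes> a"
      by (auto simp: set_add_def' cgenideal_def)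
    then show ?thesis using s(2) by blast
  qed
  have "primeideal M R"
  proof (rule primeidealI[OF M(1) is_cring])
    show "carrier R \<noteq> M" using M(3) S.one_closed by blast
  next
    fix a b assume ab: "a \<in> carrier R" "b \<in> carrier R" "a \<otimes> b \<in> M"
    show "a \<in> M \<or> b \<in> M"
    proof (rule ccontr)
      assume "\<not> (a \<in> M \<or> b \<in> M)"
      then have nab: "a \<notin> M" "b \<notin> M" by simp_all
      obtain m x where "m \<in> M" "x \<in> carrier R" "m \<oplus> x \<otimes> a \<in> S"
        using hit[OF ab(1) nab(1)] by blast
      moreover obtain n y where "n \<in> M" "y \<in> carrier R" "n \<oplus> y \<otimes> b \<in> S"
        using hit[OF ab(2) nab(2)] by blast
      ultimately have *: "m \<in> M" "x \<in> carrier R" "m \<oplus> x \<otimes> a \<in> S"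
        "n \<in> M" "y \<in> carrier R" "n \<oplus> y \<otimes> b \<in> S" by simp_all
      have mn: "m \<in> carrier R" "n \<in> carrier R" using * M.Icarr by blast+
      have "(m \<oplus> x \<otimes> a) \<otimes> (n \<oplus> y \<otimes> b)
          = m \<otimes> (n \<oplus> y \<otimes> b) \<oplus> (x \<otimes> a \<otimes> n \<oplus> (x \<otimes> y) \<otimes> (a \<otimes> b))"
        using * ab mn by (simp add: l_distr r_distr m_ac a_ac)
      also have "\<dots> \<in> M"
        using * ab mn M.I_r_closed[of m "n \<oplus> y \<otimes> b"] M.I_l_closed[of n "x \<otimes> a"]
          M.I_l_closed[of "a \<otimes> b" "x \<otimes> y"] by simp
      finally show False using * M(3) by blast
    qed
  qed
  then show thesis using that M by blast
qed

lemma (in primeideal) submonoid_compl: "submonoid (carrier R - I) R"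
proof
  show "x \<otimes> y \<in> carrier R - I" if "x \<in> carrier R - I" "y \<in> carrier R - I" for x y
    using that I_prime[of x y] by auto
  show "\<one> \<in> carrier R - I" using I_notcarr one_imp_carrier by auto
qed auto

lemma (in primeideal) pow_mem: "\<lbrakk>a \<in> carrier R; a [^] (n::nat) \<in> I\<rbrakk> \<Longrightarrow> a \<in> I"
proof (induction n)
  case 0
  then show ?case using submonoid_compl by (auto simp: submonoid_def)
next
  case (Suc n)
  then show ?case using I_prime[of "a [^] n" a] by auto
qed

text \<open>If no power of f were in I, some prime over I would avoid all powers, in particular f.
  This serves to replace a condition at every prime by a single equation that involves a power of
  f.\<close>

lemma (in cring) mem_radical_if_mem_primes:
  assumes I: "ideal I R" and f: "f \<in> carrier R"
    and all: "\<And>p. \<lbrakk>primeideal p R; I \<subseteq> p\<rbrakk> \<Longrightarrow> f \<in> p"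
  obtains n :: nat where "f [^] n \<in> I"
proof -
  let ?S = "range (\<lambda>n::nat. f [^] n)"
  have "submonoid ?S R"
  proof
    fix x y assume "x \<in> ?S" "y \<in> ?S"
    then obtain m n :: nat where "x = f [^] m" "y = f [^] n" by blast
    then have "x \<otimes> y = f [^] (m + n)" using f by (simp add: nat_pow_mult)
    then show "x \<otimes> y \<in> ?S" by blast
  next
    have "\<one> = f [^] (0::nat)" by simp
    then show "\<one> \<in> ?S" by blast
  qed (use f in auto)
  note ex = exists_primeideal_disjoint[OF I this]
  have "I \<inter> ?S \<noteq> {}"
  proof
    assume "I \<inter> ?S = {}"
    then obtain p where p: "primeideal p R" "I \<subseteq> p" "p \<inter> ?S = {}" using ex by blast
    have "f [^] (1::nat) = f" using f by simp
    then have "f \<in> ?S" by (metis rangeI)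
    then show False using all p by blast
  qed
  then show thesis using that by blast
qed

lemma (in cring) exists_minimal_prime:
  assumes p: "primeideal p R" "I \<subseteq> p"
  obtains q where "primeideal q R" "I \<subseteq> q" "q \<subseteq> p"
    "\<And>q'. \<lbrakk>primeideal q' R; I \<subseteq> q'; q' \<subseteq> q\<rbrakk> \<Longrightarrow> q' = q"
proof -
  define P where "P = {q. primeideal q R \<and> I \<subseteq> q \<and> q \<subseteq> p}"
  \<comment> \<open>\<open>subset_Zorn_nonempty\<close> yields maximal sets. Complements turn a
    minimal prime into a maximal set, and the intersection of a chain into a union.\<close>
  define compl where "compl q = carrier R - q" for q
  have psub: "q \<subseteq> carrier R" if "q \<in> P" for q
    using that additive_subgroup.a_subset ideal.axioms(1) primeideal.axioms(1)
    unfolding P_def by blast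
  have compl_le: "compl q \<subseteq> compl q' \<longleftrightarrow> q' \<subseteq> q" if "q \<in> P" "q' \<in> P" for q q'
    using psub[OF that(1)] psub[OF that(2)] unfolding compl_def by blast
  have "\<exists>M\<in>compl ` P. \<forall>X\<in>compl ` P. M \<subseteq> X \<longrightarrow> X = M"
  proof (rule subset_Zorn_nonempty)
    show "compl ` P \<noteq> {}" using p by (auto simp: P_def)
  next
    fix C assume C: "C \<noteq> {}" "subset.chain (compl ` P) C"
    then obtain K where KP: "K \<subseteq> P" and C_eq: "C = compl ` K"
      by (auto simp: pred_on.chain_def subset_image_iff)
    have K: "K \<noteq> {}" using C(1) C_eq by simp
    have tot: "q \<subseteq> q' \<or> q' \<subseteq> q" if "q \<in> K" "q' \<in> K" for q q'
    proof -
      have "compl q \<subseteq> compl q' \<or> compl q' \<subseteq> compl q"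
        using C(2) that C_eq by (simp add: subset_chain_def)
      moreover have "q \<in> P" "q' \<in> P" using KP that by auto
      ultimately show ?thesis using compl_le[of q q'] compl_le[of q' q] by blast
    qed
    have prime: "primeideal q R" if "q \<in> K" for q using that KP by (auto simp: P_def)
    have "ideal (\<Inter>K) R"
      using K by (intro i_Intersect) (auto intro: primeideal.axioms(1) prime)
    then have "primeideal (\<Inter>K) R"
    proof (rule primeidealI[OF _ is_cring])
      obtain q where q: "q \<in> K" using K by auto
      then have "\<one> \<notin> q"
        using primeideal.submonoid_compl[OF prime[OF q]] by (auto simp: submonoid_def)
      then show "carrier R \<noteq> \<Inter>K" using q by auto
    next
      fix a b assume ab: "a \<in> carrier R" "b \<in> carrier R" "a \<otimes> b \<in> \<Inter>K"
      show "a \<in> \<Inter>K \<or> b \<in> \<Inter>K"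
      proof (rule ccontr)
        assume "\<not> (a \<in> \<Inter>K \<or> b \<in> \<Inter>K)"
        \<comment> \<open>Of two members of a chain one contains the other, and the smaller one
          omits both a and b.\<close>
        then obtain q q' where q: "q \<in> K" "q' \<in> K" "a \<notin> q" "b \<notin> q'" by auto
        then obtain r where "r \<in> K" "a \<notin> r" "b \<notin> r" using tot[OF q(1,2)] by auto
        then show False using ab primeideal.I_prime[OF prime, of r a b] by auto
      qed
    qed
    moreover have "I \<subseteq> \<Inter>K" using KP by (auto simp: P_def)
    moreover obtain q where "q \<in> K" using K by auto
    then have "\<Inter>K \<subseteq> p" using KP by (auto simp: P_def)
    ultimately have "\<Inter>K \<in> P" by (simp add: P_def)
    moreover have "\<Union>C = compl (\<Inter>K)" unfolding C_eq compl_def by auto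
    ultimately show "\<Union>C \<in> compl ` P" by simp
  qed
  then obtain q where q: "q \<in> P" and max: "\<forall>X\<in>compl ` P. compl q \<subseteq> X \<longrightarrow> X = compl q" by auto
  show thesis
  proof (rule that)
    show "primeideal q R" "I \<subseteq> q" "q \<subseteq> p" using q by (simp_all add: P_def)
    fix q' assume q': "primeideal q' R" "I \<subseteq> q'" "q' \<subseteq> q"
    then have P: "q' \<in> P" using q by (auto simp: P_def)
    then have "compl q' = compl q" using max compl_le[OF q P] q'(3) by simp
    then show "q' = q" using compl_le[OF q P] compl_le[OF P q] by auto
  qed
qed


section \<open>Finite sums in ideals and annihilators\<close>

lemma (in ideal) finsum_mem:
  assumes "finite F" "\<And>i. i \<in> F \<Longrightarrow> f i \<in> I"
  shows "finsum R f F \<in> I"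
  using assms
proof (induction F rule: finite_induct)
  case (insert i F)
  then have "finsum R f (insert i F) = f i \<oplus> finsum R f F"
    using Icarr by (intro finsum_insert) auto
  then show ?case using insert by (simp add: a_closed)
qed simp

lemma (in cring) annihilator_ideal:
  assumes x: "x \<in> carrier R"
  shows "ideal {w \<in> carrier R. w \<otimes> x = \<zero>} R"
proof (rule idealI[OF ring_axioms])
  show "subgroup {w \<in> carrier R. w \<otimes> x = \<zero>} (add_monoid R)"
  proof (rule subgroup.intro)
    fix w assume "w \<in> {w \<in> carrier R. w \<otimes> x = \<zero>}"
    then show "inv\<^bsub>add_monoid R\<^esub> w \<in> {w \<in> carrier R. w \<otimes> x = \<zero>}"
      using x by (simp add: l_minus flip: a_inv_def)
  qed (use x in \<open>auto simp: l_distr\<close>)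
next
  fix w y assume w: "w \<in> {w \<in> carrier R. w \<otimes> x = \<zero>}" and y: "y \<in> carrier R"
  then have "y \<otimes> w \<otimes> x = \<zero>" using x by (simp add: m_assoc)
  then show "y \<otimes> w \<in> {w \<in> carrier R. w \<otimes> x = \<zero>}" "w \<otimes> y \<in> {w \<in> carrier R. w \<otimes> x = \<zero>}"
    using w y by (simp_all add: m_comm[of w y])
qed


section \<open>Localizations\<close>

locale localized_cring = cring R + S: submonoid S R for R (structure) and S
begin

abbreviation (input) L where "L \<equiv> localization R S"

lemma S_closed: "s \<in> S \<Longrightarrow> s \<in> carrier R"
  using S.subset by blast

context
  notes S_closed [simp]
begin

lemma equiv_loc_rel: "equiv (carrier R \<times> S) (loc_rel R S)"
proof (rule equivI)
  show "loc_rel R S \<subseteq> (carrier R \<times> S) \<times> (carrier R \<times> S)"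
    by (auto simp: loc_rel_def)
  show "refl_on (carrier R \<times> S) (loc_rel R S)"
    by (auto simp: refl_on_def loc_rel_def intro: bexI[of _ \<one>])
  show "sym (loc_rel R S)"
    by (auto simp: sym_def loc_rel_def) metis
  show "trans (loc_rel R S)"
  proof (rule transI)
    fix x y z assume xy: "(x, y) \<in> loc_rel R S" and yz: "(y, z) \<in> loc_rel R S"
    obtain a s b t c r where [simp]: "x = (a, s)" "y = (b, t)" "z = (c, r)"
      by (metis surj_pair)
    obtain u v where mem: "a \<in> carrier R" "b \<in> carrier R" "c \<in> carrier R" "s \<in> S" "t \<in> S" "r \<in> S"
      "u \<in> S" "v \<in> S" and u: "u \<otimes> (a \<otimes> t) = u \<otimes> (b \<otimes> s)" and v: "v \<otimes> (b \<otimes> r) = v \<otimes> (c \<otimes> t)"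
      using xy yz by (auto simp: loc_rel_def)
    \<comment> \<open>The middle denominator t has to enter the witness: only with it can both given
      equations be applied in turn.\<close>
    have "(u \<otimes> v \<otimes> t) \<otimes> (a \<otimes> r) = v \<otimes> r \<otimes> (u \<otimes> (a \<otimes> t))"
      using mem by (simp add: m_ac)
    also have "\<dots> = u \<otimes> s \<otimes> (v \<otimes> (b \<otimes> r))"
      unfolding u using mem by (simp add: m_ac)
    also have "\<dots> = (u \<otimes> v \<otimes> t) \<otimes> (c \<otimes> s)"
      unfolding v using mem by (simp add: m_ac)
    finally have "(u \<otimes> v \<otimes> t) \<otimes> (a \<otimes> r) = (u \<otimes> v \<otimes> t) \<otimes> (c \<otimes> s)" .
    then show "(x, z) \<in> loc_rel R S"
      using mem S.m_closed by (auto simp: loc_rel_def intro!: bexI[of _ "u \<otimes> v \<otimes> t"])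
  qed
qed

lemma frac_eq_iff:
  assumes "a \<in> carrier R" "s \<in> S" "b \<in> carrier R" "t \<in> S"
  shows "frac R S a s = frac R S b t \<longleftrightarrow> (\<exists>u\<in>S. u \<otimes> (a \<otimes> t) = u \<otimes> (b \<otimes> s))"
  unfolding frac_def
  using eq_equiv_class_iff[OF equiv_loc_rel, of "(a, s)" "(b, t)"] assms
  by (simp add: loc_rel_def)

lemma frac_eqI:
  assumes "a \<in> carrier R" "s \<in> S" "b \<in> carrier R" "t \<in> S" "a \<otimes> t = b \<otimes> s"
  shows "frac R S a s = frac R S b t"
  using assms by (subst frac_eq_iff) (auto intro: bexI[of _ \<one>])

lemma frac_mem_iff:
  assumes "a \<in> carrier R" "s \<in> S"
  shows "(b, t) \<in> frac R S a s \<longleftrightarrow> b \<in> carrier R \<and> t \<in> S \<and> frac R S a s = frac R S b t"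
proof -
  have "(b, t) \<in> frac R S a s \<longleftrightarrow> ((a, s), (b, t)) \<in> loc_rel R S" by (simp add: frac_def)
  also have "\<dots> \<longleftrightarrow> b \<in> carrier R \<and> t \<in> S \<and> frac R S a s = frac R S b t"
    using assms by (simp add: loc_rel_def frac_eq_iff cong: conj_cong)
  finally show ?thesis .
qed

text \<open>The operations of \<open>localization\<close> and the map \<open>loc_map\<close> are
  unions over all representatives of a fraction. If the union does not depend on the representative,
  it collapses to its value at any one of them.\<close>

lemma UN_frac:
  assumes "a \<in> carrier R" "s \<in> S"
    and "\<And>b t. \<lbrakk>b \<in> carrier R; t \<in> S; frac R S b t = frac R S a s\<rbrakk> \<Longrightarrow> f b t = f a s"
  shows "(\<Union>(b, t)\<in>frac R S a s. f b t) = f a s"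
proof
  show "(\<Union>(b, t)\<in>frac R S a s. f b t) \<subseteq> f a s"
  proof
    fix x assume "x \<in> (\<Union>(b, t)\<in>frac R S a s. f b t)"
    then obtain b t where "(b, t) \<in> frac R S a s" "x \<in> f b t" by auto
    then show "x \<in> f a s" using assms(3)[of b t] assms(1,2) by (simp add: frac_mem_iff)
  qed
  have "(a, s) \<in> frac R S a s" using assms(1,2) by (simp add: frac_mem_iff)
  then show "f a s \<subseteq> (\<Union>(b, t)\<in>frac R S a s. f b t)" by blast
qed

lemma UN_frac2:
  assumes a: "a \<in> carrier R" "s \<in> S" and b: "b \<in> carrier R" "t \<in> S"
    and cong: "\<And>a' s' b' t'. \<lbrakk>a' \<in> carrier R; s' \<in> S; b' \<in> carrier R; t' \<in> S;
      frac R S a' s' = frac R S a s; frac R S b' t' = frac R S b t\<rbrakk> \<Longrightarrow> f a' s' b' t' = f a s b t"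
  shows "(\<Union>(a', s')\<in>frac R S a s. \<Union>(b', t')\<in>frac R S b t. f a' s' b' t') = f a s b t"
proof -
  have inner: "(\<Union>(b', t')\<in>frac R S b t. f a' s' b' t') = f a' s' b t"
    if "a' \<in> carrier R" "s' \<in> S" "frac R S a' s' = frac R S a s" for a' s'
  proof (rule UN_frac[OF b])
    fix b' t' assume b': "b' \<in> carrier R" "t' \<in> S" "frac R S b' t' = frac R S b t"
    show "f a' s' b' t' = f a' s' b t"
      using cong[OF that(1,2) b'(1,2) that(3) b'(3)] cong[OF that(1,2) b that(3) refl] by simp
  qed
  have "(\<Union>(a', s')\<in>frac R S a s. \<Union>(b', t')\<in>frac R S b t. f a' s' b' t')
      = (\<Union>(b', t')\<in>frac R S b t. f a s b' t')"
  proof (rule UN_frac[OF a])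
    fix a' s' assume a': "a' \<in> carrier R" "s' \<in> S" "frac R S a' s' = frac R S a s"
    show "(\<Union>(b', t')\<in>frac R S b t. f a' s' b' t') = (\<Union>(b', t')\<in>frac R S b t. f a s b' t')"
      unfolding inner[OF a'] inner[OF a refl] by (rule cong[OF a'(1,2) b a'(3) refl])
  qed
  also have "\<dots> = f a s b t" by (rule inner[OF a refl])
  finally show ?thesis .
qed

lemma frac_closed [simp]:
  "\<lbrakk>a \<in> carrier R; s \<in> S\<rbrakk> \<Longrightarrow> frac R S a s \<in> carrier L"
  by (auto simp: localization_def frac_def intro!: quotientI)

lemma localizationE:
  assumes "x \<in> carrier L"
  obtains a s where "a \<in> carrier R" "s \<in> S" "x = frac R S a s"
  using assms by (auto simp: localization_def frac_def elim!: quotientE)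

lemma frac_expand:
  assumes "a \<in> carrier R" "s \<in> S" "t \<in> S"
  shows "frac R S (a \<otimes> t) (s \<otimes> t) = frac R S a s"
  using assms S.m_closed by (intro frac_eqI) (auto simp: m_ac)

lemma frac_mult [simp]:
  assumes "a \<in> carrier R" "s \<in> S" "b \<in> carrier R" "t \<in> S"
  shows "frac R S a s \<otimes>\<^bsub>L\<^esub> frac R S b t = frac R S (a \<otimes> b) (s \<otimes> t)"
proof -
  have "(\<Union>(a', s')\<in>frac R S a s. \<Union>(b', t')\<in>frac R S b t. frac R S (a' \<otimes> b') (s' \<otimes> t'))
      = frac R S (a \<otimes> b) (s \<otimes> t)"
  proof (rule UN_frac2[OF assms])
    fix a' s' b' t' assume mem': "a' \<in> carrier R" "s' \<in> S" "b' \<in> carrier R" "t' \<in> S"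
      and eq: "frac R S a' s' = frac R S a s" "frac R S b' t' = frac R S b t"
    note mem = mem' assms
    obtain u where u: "u \<in> S" "u \<otimes> (a' \<otimes> s) = u \<otimes> (a \<otimes> s')"
      using frac_eq_iff[OF mem(1,2,5,6)] eq(1) by auto
    obtain v where v: "v \<in> S" "v \<otimes> (b' \<otimes> t) = v \<otimes> (b \<otimes> t')"
      using frac_eq_iff[OF mem(3,4,7,8)] eq(2) by auto
    note uv = u(1) v(1)
    have "(u \<otimes> v) \<otimes> ((a' \<otimes> b') \<otimes> (s \<otimes> t)) = (u \<otimes> (a' \<otimes> s)) \<otimes> (v \<otimes> (b' \<otimes> t))"
      using mem uv by (simp add: m_ac)
    also have "\<dots> = (u \<otimes> v) \<otimes> ((a \<otimes> b) \<otimes> (s' \<otimes> t'))"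
      unfolding u(2) v(2) using mem uv by (simp add: m_ac)
    finally show "frac R S (a' \<otimes> b') (s' \<otimes> t') = frac R S (a \<otimes> b) (s \<otimes> t)"
      using mem uv S.m_closed by (subst frac_eq_iff) (auto intro!: bexI[of _ "u \<otimes> v"])
  qed
  then show ?thesis by (simp add: localization_def)
qed

lemma frac_add:
  assumes "a \<in> carrier R" "s \<in> S" "b \<in> carrier R" "t \<in> S"
  shows "frac R S a s \<oplus>\<^bsub>L\<^esub> frac R S b t = frac R S (a \<otimes> t \<oplus> b \<otimes> s) (s \<otimes> t)"
proof -
  have "(\<Union>(a', s')\<in>frac R S a s. \<Union>(b', t')\<in>frac R S b t. frac R S (a' \<otimes> t' \<oplus> b' \<otimes> s') (s' \<otimes> t'))
      = frac R S (a \<otimes> t \<oplus> b \<otimes> s) (s \<otimes> t)"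
  proof (rule UN_frac2[OF assms])
    fix a' s' b' t' assume mem': "a' \<in> carrier R" "s' \<in> S" "b' \<in> carrier R" "t' \<in> S"
      and eq: "frac R S a' s' = frac R S a s" "frac R S b' t' = frac R S b t"
    note mem = mem' assms
    obtain u where u: "u \<in> S" "u \<otimes> (a' \<otimes> s) = u \<otimes> (a \<otimes> s')"
      using frac_eq_iff[OF mem(1,2,5,6)] eq(1) by auto
    obtain v where v: "v \<in> S" "v \<otimes> (b' \<otimes> t) = v \<otimes> (b \<otimes> t')"
      using frac_eq_iff[OF mem(3,4,7,8)] eq(2) by auto
    note uv = u(1) v(1)
    have "(u \<otimes> v) \<otimes> ((a' \<otimes> t' \<oplus> b' \<otimes> s') \<otimes> (s \<otimes> t))
        = (v \<otimes> t \<otimes> t') \<otimes> (u \<otimes> (a' \<otimes> s)) \<oplus> (u \<otimes> s \<otimes> s') \<otimes> (v \<otimes> (b' \<otimes> t))"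
      using mem uv by (simp add: m_ac l_distr r_distr)
    also have "\<dots> = (u \<otimes> v) \<otimes> ((a \<otimes> t \<oplus> b \<otimes> s) \<otimes> (s' \<otimes> t'))"
      unfolding u(2) v(2) using mem uv by (simp add: m_ac l_distr r_distr)
    finally show "frac R S (a' \<otimes> t' \<oplus> b' \<otimes> s') (s' \<otimes> t') = frac R S (a \<otimes> t \<oplus> b \<otimes> s) (s \<otimes> t)"
      using mem uv S.m_closed by (subst frac_eq_iff) (auto intro!: bexI[of _ "u \<otimes> v"])
  qed
  then show ?thesis by (simp add: localization_def)
qed

text \<open>The ring axioms are checked on fractions with a common denominator, where addition takes
  place in the numerators only.\<close>

lemma frac_add_same [simp]:
  assumes "a \<in> carrier R" "b \<in> carrier R" "s \<in> S"
  shows "frac R S a s \<oplus>\<^bsub>L\<^esub> frac R S b s = frac R S (a \<oplus> b) s"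
proof -
  have "frac R S a s \<oplus>\<^bsub>L\<^esub> frac R S b s = frac R S ((a \<oplus> b) \<otimes> s) (s \<otimes> s)"
    using assms by (simp add: frac_add l_distr)
  then show ?thesis using assms by (simp add: frac_expand)
qed

lemma localization_zero: "s \<in> S \<Longrightarrow> \<zero>\<^bsub>L\<^esub> = frac R S \<zero> s"
  unfolding localization_def by simp (rule frac_eqI, auto)

lemma localization_one: "s \<in> S \<Longrightarrow> \<one>\<^bsub>L\<^esub> = frac R S s s"
  unfolding localization_def by simp (rule frac_eqI, auto)

lemma common_denom2:
  assumes "x \<in> carrier L" "y \<in> carrier L"
  obtains a b s where "a \<in> carrier R" "b \<in> carrier R" "s \<in> S" "x = frac R S a s" "y = frac R S b s"
proof -
  obtain a s b t where "a \<in> carrier R" "s \<in> S" "x = frac R S a s" "b \<in> carrier R" "t \<in> S" "y = frac R S b t"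
    using assms by (elim localizationE)
  then show thesis
    using that[of "a \<otimes> t" "b \<otimes> s" "s \<otimes> t"] frac_expand[of a s t] frac_expand[of b t s]
    by (simp add: m_comm)
qed

lemma common_denom3:
  assumes "x \<in> carrier L" "y \<in> carrier L"
    "z \<in> carrier L"
  obtains a b c s where "a \<in> carrier R" "b \<in> carrier R" "c \<in> carrier R" "s \<in> S"
    "x = frac R S a s" "y = frac R S b s" "z = frac R S c s"
proof -
  obtain a b s where *: "a \<in> carrier R" "b \<in> carrier R" "s \<in> S" "x = frac R S a s" "y = frac R S b s"
    using common_denom2[OF assms(1,2)] .
  obtain c t where **: "c \<in> carrier R" "t \<in> S" "z = frac R S c t"
    using localizationE[OF assms(3)] .
  show thesis
    using that[of "a \<otimes> t" "b \<otimes> t" "c \<otimes> s" "s \<otimes> t"] * ** frac_expand[of a s t] frac_expand[of b s t]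
      frac_expand[of c t s] by (simp add: m_comm)
qed

lemma localization_cring: "cring L"
proof (rule cringI)
  show "abelian_group L"
  proof (rule abelian_groupI)
    fix x y z
    assume "x \<in> carrier L" "y \<in> carrier L"
      "z \<in> carrier L"
    then obtain a b c s where "a \<in> carrier R" "b \<in> carrier R" "c \<in> carrier R" "s \<in> S"
      "x = frac R S a s" "y = frac R S b s" "z = frac R S c s"
      by (rule common_denom3)
    then show "x \<oplus>\<^bsub>L\<^esub> y \<oplus>\<^bsub>L\<^esub> z
        = x \<oplus>\<^bsub>L\<^esub> (y \<oplus>\<^bsub>L\<^esub> z)"
      by (simp add: a_assoc)
  next
    fix x y
    assume "x \<in> carrier L" "y \<in> carrier L"
    then obtain a b s where "a \<in> carrier R" "b \<in> carrier R" "s \<in> S"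
      "x = frac R S a s" "y = frac R S b s"
      by (rule common_denom2)
    then show "x \<oplus>\<^bsub>L\<^esub> y \<in> carrier L"
      "x \<oplus>\<^bsub>L\<^esub> y = y \<oplus>\<^bsub>L\<^esub> x"
      by (simp_all add: a_comm)
  next
    fix x assume "x \<in> carrier L"
    then obtain a s where *: "a \<in> carrier R" "s \<in> S" "x = frac R S a s" by (rule localizationE)
    then show "\<zero>\<^bsub>L\<^esub> \<oplus>\<^bsub>L\<^esub> x = x"
      by (simp add: localization_zero[of s])
    have "frac R S (\<ominus> a) s \<oplus>\<^bsub>L\<^esub> x = \<zero>\<^bsub>L\<^esub>"
      using * by (simp add: localization_zero[of s] l_neg)
    then show "\<exists>y\<in>carrier L. y \<oplus>\<^bsub>L\<^esub> x = \<zero>\<^bsub>L\<^esub>"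
      using * by (intro bexI[of _ "frac R S (\<ominus> a) s"]) auto
  qed (simp add: localization_zero[of \<one>])
next
  show "Group.comm_monoid L"
  proof (rule comm_monoidI)
    fix x y
    assume "x \<in> carrier L" "y \<in> carrier L"
    then obtain a b s where "a \<in> carrier R" "b \<in> carrier R" "s \<in> S"
      "x = frac R S a s" "y = frac R S b s"
      by (rule common_denom2)
    then show "x \<otimes>\<^bsub>L\<^esub> y \<in> carrier L"
      "x \<otimes>\<^bsub>L\<^esub> y = y \<otimes>\<^bsub>L\<^esub> x"
      by (simp_all add: m_comm)
  next
    fix x y z
    assume "x \<in> carrier L" "y \<in> carrier L"
      "z \<in> carrier L"
    then obtain a b c s where "a \<in> carrier R" "b \<in> carrier R" "c \<in> carrier R" "s \<in> S"
      "x = frac R S a s" "y = frac R S b s" "z = frac R S c s"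
      by (rule common_denom3)
    then show "x \<otimes>\<^bsub>L\<^esub> y \<otimes>\<^bsub>L\<^esub> z
        = x \<otimes>\<^bsub>L\<^esub> (y \<otimes>\<^bsub>L\<^esub> z)"
      by (simp add: m_assoc)
  next
    fix x assume "x \<in> carrier L"
    then show "\<one>\<^bsub>L\<^esub> \<otimes>\<^bsub>L\<^esub> x = x"
      by (auto simp: localization_one[of \<one>] elim!: localizationE)
  qed (simp add: localization_one[of \<one>])
next
  fix x y z
  assume "x \<in> carrier L" "y \<in> carrier L"
    "z \<in> carrier L"
  then obtain a b c s where "a \<in> carrier R" "b \<in> carrier R" "c \<in> carrier R" "s \<in> S"
    "x = frac R S a s" "y = frac R S b s" "z = frac R S c s"
    by (rule common_denom3)
  then show "(x \<oplus>\<^bsub>L\<^esub> y) \<otimes>\<^bsub>L\<^esub> z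
      = x \<otimes>\<^bsub>L\<^esub> z \<oplus>\<^bsub>L\<^esub> y \<otimes>\<^bsub>L\<^esub> z"
    by (simp add: l_distr)
qed

end

end

abbreviation (input) frac_at where "frac_at R p \<equiv> frac R (carrier R - p)"

lemma (in primeideal) localized_cring_compl: "localized_cring R (carrier R - I)"
  by (intro localized_cring.intro submonoid_compl is_cring)

text \<open>For a outside I the inverse is s / a. Conversely (a / s) (b / t) = 1 gives u a b = u s t
  for some u outside I; the right hand side is outside the prime I, so a is as well.\<close>

lemma (in primeideal) frac_in_Units_iff:
  assumes "a \<in> carrier R" "s \<in> carrier R - I"
  shows "frac_at R I a s \<in> Units (loc_at R I) \<longleftrightarrow> a \<notin> I"
proof -
  interpret L: localized_cring R "carrier R - I" by (rule localized_cring_compl)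
  interpret LR: cring "loc_at R I" by (rule L.localization_cring)
  show ?thesis
  proof
    assume "a \<notin> I"
    then have a: "a \<in> carrier R - I" using assms(1) by simp
    have "frac_at R I a s \<otimes>\<^bsub>loc_at R I\<^esub> frac_at R I s a
        = frac_at R I (a \<otimes> s) (s \<otimes> a)"
      using a assms by (intro L.frac_mult) auto
    also have "\<dots> = \<one>\<^bsub>loc_at R I\<^esub>"
      using L.localization_one[OF L.S.m_closed[OF assms(2) a]] a assms by (simp add: m_comm)
    finally have one: "frac_at R I a s \<otimes>\<^bsub>loc_at R I\<^esub> frac_at R I s a
        = \<one>\<^bsub>loc_at R I\<^esub>" .
    have cl: "frac_at R I s a \<in> carrier (loc_at R I)"
      "frac_at R I a s \<in> carrier (loc_at R I)"
      using a assms by (intro L.frac_closed; simp)+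
    show "frac_at R I a s \<in> Units (loc_at R I)"
      using one cl LR.m_comm[OF cl] unfolding Units_def by auto
  next
    assume "frac_at R I a s \<in> Units (loc_at R I)"
    then obtain y where y: "y \<in> carrier (loc_at R I)"
      "frac_at R I a s \<otimes>\<^bsub>loc_at R I\<^esub> y = \<one>\<^bsub>loc_at R I\<^esub>"
      unfolding Units_def by auto
    obtain b t where b: "b \<in> carrier R" "t \<in> carrier R - I" "y = frac_at R I b t"
      using y(1) by (rule L.localizationE)
    have st: "s \<otimes> t \<in> carrier R - I" by (rule L.S.m_closed[OF assms(2) b(2)])
    have "frac_at R I (a \<otimes> b) (s \<otimes> t) = frac_at R I \<one> \<one>"
      using y(2) L.frac_mult[OF assms b(1,2)] b(3) L.localization_one[OF L.S.one_closed] by simp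
    then obtain u where u: "u \<in> carrier R - I" "u \<otimes> (a \<otimes> b \<otimes> \<one>) = u \<otimes> (\<one> \<otimes> (s \<otimes> t))"
      using L.frac_eq_iff[OF _ st _ L.S.one_closed, of "a \<otimes> b" \<one>] assms(1) b(1) by auto
    have "u \<otimes> (s \<otimes> t) \<in> carrier R - I" by (rule L.S.m_closed[OF u(1) st])
    then have "u \<otimes> (a \<otimes> b) \<notin> I" using u assms b(1,2) by simp
    moreover have "u \<otimes> (a \<otimes> b) \<in> I" if "a \<in> I"
      using that u(1) b(1) by (intro I_l_closed I_r_closed) auto
    ultimately show "a \<notin> I" by blast
  qed
qed

section \<open>Contraction of primes and the induced maps of local rings\<close>

lemma contraction_ideal:
  assumes "cring R" "cring S" "h \<in> ring_hom R S" "ideal J S"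
  shows "ideal (contraction R h J) R"
proof -
  interpret J: ideal J S by fact
  interpret h: ring_hom_cring R S h by (rule ring_hom_cringI[OF assms(1-3)])
  show ?thesis
  proof (rule idealI[OF h.R.ring_axioms])
    show "subgroup (contraction R h J) (add_monoid R)"
    proof (rule subgroup.intro)
      fix x assume "x \<in> contraction R h J"
      then show "inv\<^bsub>add_monoid R\<^esub> x \<in> contraction R h J"
        by (simp add: contraction_def flip: a_inv_def)
    qed (auto simp: contraction_def)
  qed (auto simp: contraction_def J.I_l_closed J.I_r_closed)
qed

lemma contraction_primeideal:
  assumes "cring R" "h \<in> ring_hom R S" "primeideal q S"
  shows "primeideal (contraction R h q) R"
proof -
  interpret q: primeideal q S by fact
  interpret h: ring_hom_cring R S h
    by (rule ring_hom_cringI[OF assms(1) q.is_cring assms(2)])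
  show ?thesis
  proof (rule primeidealI)
    show "ideal (contraction R h q) R"
      by (rule contraction_ideal[OF assms(1) q.is_cring assms(2) q.is_ideal])
    have "\<one>\<^bsub>S\<^esub> \<notin> q" using q.I_notcarr q.one_imp_carrier by auto
    then have "\<one>\<^bsub>R\<^esub> \<notin> contraction R h q" by (simp add: contraction_def)
    moreover have "\<one>\<^bsub>R\<^esub> \<in> carrier R" by simp
    ultimately show "carrier R \<noteq> contraction R h q" by blast
    show "a \<in> contraction R h q \<or> b \<in> contraction R h q"
      if "a \<in> carrier R" "b \<in> carrier R" "a \<otimes>\<^bsub>R\<^esub> b \<in> contraction R h q" for a b
      using that q.I_prime[of "h a" "h b"] by (auto simp: contraction_def)
  qed (rule h.R.is_cring)
qed

lemma contraction_compl:
  "\<lbrakk>h \<in> ring_hom R S; t \<in> carrier R - contraction R h q\<rbrakk> \<Longrightarrow> h t \<in> carrier S - q"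
  by (auto simp: contraction_def ring_hom_closed)

text \<open>The union in \<open>loc_map\<close> collapses because h sends a witness for the equality
  of two fractions at the contraction of q to a witness outside q.\<close>

lemma loc_map_frac:
  assumes "cring R" "h \<in> ring_hom R S" "primeideal q S"
    and "a \<in> carrier R" "s \<in> carrier R - contraction R h q"
  shows "loc_map S h q (frac_at R (contraction R h q) a s)
    = frac_at S q (h a) (h s)"
proof -
  let ?p = "contraction R h q"
  interpret q: primeideal q S by fact
  interpret h: ring_hom_cring R S h
    by (rule ring_hom_cringI[OF assms(1) q.is_cring assms(2)])
  interpret p: primeideal ?p R by (rule contraction_primeideal[OF assms(1-3)])
  interpret L: localized_cring R "carrier R - ?p" by (rule p.localized_cring_compl)
  interpret M: localized_cring S "carrier S - q" by (rule q.localized_cring_compl)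
  note hs = contraction_compl[OF assms(2)]
  show ?thesis
    unfolding loc_map_def
  proof (rule L.UN_frac[OF assms(4,5)])
    fix b t assume bt: "b \<in> carrier R" "t \<in> carrier R - ?p"
      "frac_at R ?p b t = frac_at R ?p a s"
    then obtain u where u: "u \<in> carrier R - ?p"
      "u \<otimes>\<^bsub>R\<^esub> (b \<otimes>\<^bsub>R\<^esub> s) = u \<otimes>\<^bsub>R\<^esub> (a \<otimes>\<^bsub>R\<^esub> t)"
      using L.frac_eq_iff[OF bt(1,2) assms(4,5)] by auto
    have mem: "u \<in> carrier R" "t \<in> carrier R" "s \<in> carrier R" using u(1) bt(2) assms(5) by simp_all
    have "h u \<otimes>\<^bsub>S\<^esub> (h b \<otimes>\<^bsub>S\<^esub> h s) = h (u \<otimes>\<^bsub>R\<^esub> (b \<otimes>\<^bsub>R\<^esub> s))"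
      using mem bt(1) by simp
    also have "\<dots> = h (u \<otimes>\<^bsub>R\<^esub> (a \<otimes>\<^bsub>R\<^esub> t))" by (simp only: u(2))
    also have "\<dots> = h u \<otimes>\<^bsub>S\<^esub> (h a \<otimes>\<^bsub>S\<^esub> h t)" using mem assms(4) by simp
    finally show "frac_at S q (h b) (h t) = frac_at S q (h a) (h s)"
      using M.frac_eq_iff[OF h.hom_closed[OF bt(1)] hs[OF bt(2)] h.hom_closed[OF assms(4)] hs[OF assms(5)]]
        bexI[OF _ hs[OF u(1)]] by simp
  qed
qed

lemma loc_map_ring_hom:
  assumes "cring R" "h \<in> ring_hom R S" "primeideal q S"
  shows "loc_map S h q \<in> ring_hom (loc_at R (contraction R h q)) (loc_at S q)"
proof -
  let ?p = "contraction R h q"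
  interpret q: primeideal q S by fact
  interpret h: ring_hom_cring R S h
    by (rule ring_hom_cringI[OF assms(1) q.is_cring assms(2)])
  interpret p: primeideal ?p R by (rule contraction_primeideal[OF assms(1-3)])
  interpret L: localized_cring R "carrier R - ?p" by (rule p.localized_cring_compl)
  interpret M: localized_cring S "carrier S - q" by (rule q.localized_cring_compl)
  note hs = contraction_compl[OF assms(2)]
  note lf = loc_map_frac[OF assms]
  show ?thesis
  proof (rule ring_hom_memI)
    fix x assume "x \<in> carrier (loc_at R ?p)"
    then obtain a s where "a \<in> carrier R" "s \<in> carrier R - ?p" "x = frac_at R ?p a s"
      by (rule L.localizationE)
    then show "loc_map S h q x \<in> carrier (loc_at S q)" using hs by (simp add: lf)
  next
    fix x y assume "x \<in> carrier (loc_at R ?p)" "y \<in> carrier (loc_at R ?p)"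
    then obtain a b s where *: "a \<in> carrier R" "b \<in> carrier R" "s \<in> carrier R - ?p"
      "x = frac_at R ?p a s" "y = frac_at R ?p b s"
      by (rule L.common_denom2)
    have ss: "s \<otimes>\<^bsub>R\<^esub> s \<in> carrier R - ?p" using L.S.m_closed *(3) by blast
    have sc: "s \<in> carrier R" "h s \<in> carrier S - q" using *(3) hs by auto
    show "loc_map S h q (x \<otimes>\<^bsub>loc_at R ?p\<^esub> y) = loc_map S h q x \<otimes>\<^bsub>loc_at S q\<^esub> loc_map S h q y"
      using * sc ss by (simp add: lf del: Diff_iff)
    show "loc_map S h q (x \<oplus>\<^bsub>loc_at R ?p\<^esub> y) = loc_map S h q x \<oplus>\<^bsub>loc_at S q\<^esub> loc_map S h q y"
      using * sc by (simp add: lf del: Diff_iff)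
  next
    have o: "\<one>\<^bsub>R\<^esub> \<in> carrier R - ?p" "\<one>\<^bsub>S\<^esub> \<in> carrier S - q" by (rule L.S.one_closed M.S.one_closed)+
    show "loc_map S h q \<one>\<^bsub>loc_at R ?p\<^esub> = \<one>\<^bsub>loc_at S q\<^esub>"
      unfolding L.localization_one[OF o(1)] M.localization_one[OF o(2)]
      using lf[OF _ o(1), of "\<one>\<^bsub>R\<^esub>"] by simp
  qed
qed


section \<open>Local rings\<close>

lemma (in cring) Units_I:
  "\<lbrakk>x \<in> carrier R; y \<in> carrier R; x \<otimes> y = \<one>\<rbrakk> \<Longrightarrow> x \<in> Units R"
  using m_comm[of x y] unfolding Units_def by auto

lemma (in cring) proper_ideal_subset_nonunits:
  assumes J: "ideal J R" "J \<noteq> carrier R"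
  shows "J \<subseteq> carrier R - Units R"
proof
  interpret J: ideal J R by (rule J(1))
  fix x assume x: "x \<in> J"
  have "x \<notin> Units R"
  proof
    assume u: "x \<in> Units R"
    then have "inv x \<otimes> x \<in> J" using x by (intro J.I_l_closed) auto
    then show False using u J.one_imp_carrier J(2) by simp
  qed
  then show "x \<in> carrier R - Units R" using x J.Icarr by simp
qed

text \<open>Proper ideals contain no units. If the nonunits form an ideal, it contains all proper
  ideals and is the only maximal one, so locality of rings and of homomorphisms can be tested on
  units.\<close>

lemma (in cring) maximalideal_iff_nonunits:
  assumes I: "ideal (carrier R - Units R) R"
  shows "maximalideal M R \<longleftrightarrow> M = carrier R - Units R"
proof
  assume "maximalideal M R"
  then interpret M: maximalideal M R .
  have "M \<subseteq> carrier R - Units R"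
    using proper_ideal_subset_nonunits[OF M.is_ideal] M.I_notcarr by auto
  moreover have "carrier R - Units R \<noteq> carrier R" using Units_one_closed by auto
  ultimately show "M = carrier R - Units R" using M.I_maximal[OF I] by auto
next
  assume M: "M = carrier R - Units R"
  show "maximalideal M R"
    unfolding M
  proof (rule maximalidealI[OF I])
    show "carrier R \<noteq> carrier R - Units R" using Units_one_closed by auto
    show "J = carrier R - Units R \<or> J = carrier R"
      if "ideal J R" "carrier R - Units R \<subseteq> J" "J \<subseteq> carrier R" for J
      using proper_ideal_subset_nonunits[OF that(1)] that by auto
  qed
qed

lemma (in cring) local_ringI: "ideal (carrier R - Units R) R \<Longrightarrow> local_ring R"
  unfolding local_ring_def using maximalideal_iff_nonunits is_cring by auto

text \<open>Closure under sums is the essential assumption: a factor of a unit is a unit, which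
  gives closure under multiplication, and negatives are multiples by -1.\<close>

lemma (in cring) nonunits_ideal:
  assumes "\<zero> \<notin> Units R"
    and add: "\<And>x y. \<lbrakk>x \<in> carrier R - Units R; y \<in> carrier R - Units R\<rbrakk> \<Longrightarrow> x \<oplus> y \<notin> Units R"
  shows "ideal (carrier R - Units R) R"
proof -
  have mult: "x \<otimes> a \<in> carrier R - Units R" if a: "a \<in> carrier R - Units R" and x: "x \<in> carrier R" for a x
  proof -
    have "x \<otimes> a \<notin> Units R"
    proof
      assume "x \<otimes> a \<in> Units R"
      then obtain y where y: "y \<in> carrier R" "y \<otimes> (x \<otimes> a) = \<one>" unfolding Units_def by auto
      then have "(y \<otimes> x) \<otimes> a = \<one>" "a \<otimes> (y \<otimes> x) = \<one>" using a x by (simp_all add: m_ac)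
      then have "a \<in> Units R" using a x y(1) unfolding Units_def by auto
      then show False using a by simp
    qed
    then show ?thesis using a x by simp
  qed
  show ?thesis
  proof (rule idealI[OF ring_axioms])
    show "subgroup (carrier R - Units R) (add_monoid R)"
    proof (rule subgroup.intro)
      fix x assume x: "x \<in> carrier R - Units R"
      then have "\<ominus> x = (\<ominus> \<one>) \<otimes> x" by (simp add: l_minus)
      then have "\<ominus> x \<in> carrier R - Units R" using mult[OF x, of "\<ominus> \<one>"] by simp
      then show "inv\<^bsub>add_monoid R\<^esub> x \<in> carrier R - Units R" by (simp flip: a_inv_def)
    qed (use assms in auto)
    show "x \<otimes> a \<in> carrier R - Units R" "a \<otimes> x \<in> carrier R - Units R"
      if "a \<in> carrier R - Units R" "x \<in> carrier R" for a x
      using mult[OF that] that by (simp_all add: m_comm)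
  qed
qed

lemma ring_hom_Units:
  assumes "ring R" "ring S" "h \<in> ring_hom R S" "x \<in> Units R"
  shows "h x \<in> Units S"
proof -
  interpret R: ring R by fact
  interpret S: ring S by fact
  have "h x \<otimes>\<^bsub>S\<^esub> h (inv\<^bsub>R\<^esub> x) = \<one>\<^bsub>S\<^esub>" "h (inv\<^bsub>R\<^esub> x) \<otimes>\<^bsub>S\<^esub> h x = \<one>\<^bsub>S\<^esub>"
    using assms(3,4) by (simp_all flip: ring_hom_mult ring_hom_one add: R.Units_closed)
  then show ?thesis
    unfolding Units_def using assms(3,4) by (auto simp: R.Units_closed ring_hom_closed)
qed

lemma local_homI:
  assumes "cring R" "cring S" "h \<in> ring_hom R S"
    and "ideal (carrier R - Units R) R" "ideal (carrier S - Units S) S"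
    and "\<And>x. \<lbrakk>x \<in> carrier R; h x \<in> Units S\<rbrakk> \<Longrightarrow> x \<in> Units R"
  shows "local_hom R S h"
  unfolding local_hom_def
  using assms cring.maximalideal_iff_nonunits[OF assms(1,4)] cring.maximalideal_iff_nonunits[OF assms(2,5)]
  by (auto simp: ring_hom_closed)

text \<open>In the application h is a stalk map of a test morphism, g the stalk map of its
  factorization and p the one of the quotient. If x lies in the maximal ideal of R, then p (g x) = h
  x is no unit; as p preserves units, g x is no unit either.\<close>

lemma local_hom_factor:
  assumes S: "cring S" and T: "cring T" and loc: "local_hom R T h"
    and g: "g \<in> ring_hom R S" and p: "p \<in> ring_hom S T"
    and hpg: "\<And>x. x \<in> carrier R \<Longrightarrow> h x = p (g x)"
    and N: "maximalideal N T" and I: "ideal (carrier S - Units S) S"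
  shows "local_hom R S g"
  unfolding local_hom_def
proof (intro conjI allI impI)
  interpret S: cring S by (rule S)
  interpret T: cring T by (rule T)
  interpret N: maximalideal N T by (rule N)
  show "g \<in> ring_hom R S" by (rule g)
  fix M M' assume M: "maximalideal M R \<and> maximalideal M' S"
  then interpret M: maximalideal M R by simp
  have M': "M' = carrier S - Units S" using S.maximalideal_iff_nonunits[OF I] M by simp
  show "g ` M \<subseteq> M'"
  proof
    fix y assume "y \<in> g ` M"
    then obtain x where x: "x \<in> M" "y = g x" by auto
    have "h x \<in> N" using loc M N x(1) by (auto simp: local_hom_def)
    then have "p (g x) \<notin> Units T"
      using hpg M.Icarr[OF x(1)] T.proper_ideal_subset_nonunits[OF N.is_ideal] N.I_notcarr by auto
    then have "g x \<notin> Units S" using ring_hom_Units[OF S.ring_axioms T.ring_axioms p] by auto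
    then show "y \<in> M'" using x(2) M' ring_hom_closed[OF g M.Icarr[OF x(1)]] by simp
  qed
qed


section \<open>Stalks of ringed spaces\<close>

context ringed_space
begin

lemma restr_closed:
  "\<lbrakk>openin (topol X) U; openin (topol X) V; V \<subseteq> U; s \<in> carrier (sect X U)\<rbrakk>
    \<Longrightarrow> restr X U V s \<in> carrier (sect X V)"
  using restr_hom ring_hom_closed by metis

lemma presections_iff:
  "(U, s) \<in> presections X x \<longleftrightarrow> openin (topol X) U \<and> x \<in> U \<and> s \<in> carrier (sect X U)"
  by (simp add: presections_def)

lemma equiv_germ_rel: "equiv (presections X x) (germ_rel X x)"
proof (rule equivI)
  show "germ_rel X x \<subseteq> presections X x \<times> presections X x"
    by (auto simp: germ_rel_def)
  show "refl_on (presections X x) (germ_rel X x)"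
    by (auto simp: refl_on_def germ_rel_def presections_iff)
  show "sym (germ_rel X x)"
    by (auto simp: sym_def germ_rel_def)
  show "trans (germ_rel X x)"
  proof (rule transI)
    fix a b c assume ab: "(a, b) \<in> germ_rel X x" and bc: "(b, c) \<in> germ_rel X x"
    obtain U s V t W r where [simp]: "a = (U, s)" "b = (V, t)" "c = (W, r)" by (metis surj_pair)
    have p: "(U, s) \<in> presections X x" "(V, t) \<in> presections X x" "(W, r) \<in> presections X x"
      using ab bc by (auto simp: germ_rel_def)
    obtain M where M: "openin (topol X) M" "x \<in> M" "M \<subseteq> U \<inter> V" "restr X U M s = restr X V M t"
      using ab by (auto simp: germ_rel_def)
    obtain N where N: "openin (topol X) N" "x \<in> N" "N \<subseteq> V \<inter> W" "restr X V N t = restr X W N r"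
      using bc by (auto simp: germ_rel_def)
    have MN: "openin (topol X) (M \<inter> N)" using M(1) N(1) by blast
    have "restr X U (M \<inter> N) s = restr X M (M \<inter> N) (restr X U M s)"
      using p M(1-3) MN by (intro restr_restr[symmetric]) (auto simp: presections_iff)
    also have "\<dots> = restr X V (M \<inter> N) t"
      unfolding M(4) using p M(1-3) MN by (intro restr_restr) (auto simp: presections_iff)
    also have "\<dots> = restr X N (M \<inter> N) (restr X V N t)"
      using p N(1-3) MN by (intro restr_restr[symmetric]) (auto simp: presections_iff)
    also have "\<dots> = restr X W (M \<inter> N) r"
      unfolding N(4) using p N(1-3) MN by (intro restr_restr) (auto simp: presections_iff)
    finally show "(a, c) \<in> germ_rel X x"
      using p MN M(2,3) N(2,3) by (auto simp: germ_rel_def intro!: exI[of _ "M \<inter> N"])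
  qed
qed

lemma germ_eq_iff:
  assumes "(U, s) \<in> presections X x" "(V, t) \<in> presections X x"
  shows "germ X x U s = germ X x V t \<longleftrightarrow>
    (\<exists>W. openin (topol X) W \<and> x \<in> W \<and> W \<subseteq> U \<inter> V \<and> restr X U W s = restr X V W t)"
  unfolding germ_def
  using eq_equiv_class_iff[OF equiv_germ_rel assms] assms by (simp add: germ_rel_def)

lemma germ_mem_iff:
  assumes "(U, s) \<in> presections X x"
  shows "(V, t) \<in> germ X x U s \<longleftrightarrow> (V, t) \<in> presections X x \<and> germ X x U s = germ X x V t"
proof -
  have "(V, t) \<in> germ X x U s \<longleftrightarrow> ((U, s), (V, t)) \<in> germ_rel X x" by (simp add: germ_def)
  also have "\<dots> \<longleftrightarrow> (V, t) \<in> presections X x \<and> germ X x U s = germ X x V t"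
    using assms by (simp add: germ_eq_iff germ_rel_def cong: conj_cong)
  finally show ?thesis .
qed

text \<open>The counterpart of \<open>UN_frac\<close> for germs: the stalk operations and
  \<open>stalk_map\<close> are unions over representatives.\<close>

lemma UN_germ:
  assumes "(U, s) \<in> presections X x"
    and "\<And>V t. \<lbrakk>(V, t) \<in> presections X x; germ X x U s = germ X x V t\<rbrakk> \<Longrightarrow> f V t = f U s"
  shows "(\<Union>(V, t)\<in>germ X x U s. f V t) = f U s"
proof
  show "(\<Union>(V, t)\<in>germ X x U s. f V t) \<subseteq> f U s"
  proof
    fix y assume "y \<in> (\<Union>(V, t)\<in>germ X x U s. f V t)"
    then obtain V t where "(V, t) \<in> germ X x U s" "y \<in> f V t" by auto
    then show "y \<in> f U s" using assms(2)[of V t] by (simp add: germ_mem_iff[OF assms(1)])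
  qed
  have "(U, s) \<in> germ X x U s" using assms(1) by (simp add: germ_mem_iff)
  then show "f U s \<subseteq> (\<Union>(V, t)\<in>germ X x U s. f V t)" by blast
qed

lemma presections_restr:
  "\<lbrakk>(U, s) \<in> presections X x; openin (topol X) W; x \<in> W; W \<subseteq> U\<rbrakk>
    \<Longrightarrow> (W, restr X U W s) \<in> presections X x"
  by (simp add: presections_iff restr_closed)

lemma germ_restr:
  assumes "(U, s) \<in> presections X x" "openin (topol X) W" "x \<in> W" "W \<subseteq> U"
  shows "germ X x W (restr X U W s) = germ X x U s"
proof -
  have "restr X W W (restr X U W s) = restr X U W s"
    using assms by (intro restr_restr) (auto simp: presections_iff)
  then show ?thesis
    using assms presections_restr[OF assms] by (subst germ_eq_iff) (auto intro!: exI[of _ W])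
qed

lemma germ_closed: "(U, s) \<in> presections X x \<Longrightarrow> germ X x U s \<in> carrier (stalk X x)"
  by (simp add: stalk_def germ_def quotientI)

lemma stalkE:
  assumes "T \<in> carrier (stalk X x)"
  obtains U s where "(U, s) \<in> presections X x" "T = germ X x U s"
  using assms by (auto simp: stalk_def germ_def elim!: quotientE)

lemma stalkE2:
  assumes "T \<in> carrier (stalk X x)" "T' \<in> carrier (stalk X x)"
  obtains U s t where "(U, s) \<in> presections X x" "(U, t) \<in> presections X x"
    "T = germ X x U s" "T' = germ X x U t"
proof -
  obtain U s where U: "(U, s) \<in> presections X x" "T = germ X x U s" using assms(1) by (rule stalkE)
  obtain V t where V: "(V, t) \<in> presections X x" "T' = germ X x V t" using assms(2) by (rule stalkE)
  have W: "openin (topol X) (U \<inter> V)" "x \<in> U \<inter> V" "U \<inter> V \<subseteq> U" "U \<inter> V \<subseteq> V"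
    using U(1) V(1) by (auto simp: presections_iff)
  show thesis
    using that[OF presections_restr[OF U(1) W(1-3)] presections_restr[OF V(1) W(1,2,4)]]
      germ_restr[OF U(1) W(1-3)] germ_restr[OF V(1) W(1,2,4)] U(2) V(2) by simp
qed

lemma stalkE3:
  assumes "T \<in> carrier (stalk X x)" "T' \<in> carrier (stalk X x)" "T'' \<in> carrier (stalk X x)"
  obtains U s t r where "(U, s) \<in> presections X x" "(U, t) \<in> presections X x" "(U, r) \<in> presections X x"
    "T = germ X x U s" "T' = germ X x U t" "T'' = germ X x U r"
proof -
  obtain U s t where U: "(U, s) \<in> presections X x" "(U, t) \<in> presections X x"
    "T = germ X x U s" "T' = germ X x U t" using assms(1,2) by (rule stalkE2)
  obtain V r where V: "(V, r) \<in> presections X x" "T'' = germ X x V r" using assms(3) by (rule stalkE)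
  have W: "openin (topol X) (U \<inter> V)" "x \<in> U \<inter> V" "U \<inter> V \<subseteq> U" "U \<inter> V \<subseteq> V"
    using U(1) V(1) by (auto simp: presections_iff)
  show thesis
    using that[OF presections_restr[OF U(1) W(1-3)] presections_restr[OF U(2) W(1-3)]
        presections_restr[OF V(1) W(1,2,4)]]
      germ_restr[OF U(1) W(1-3)] germ_restr[OF U(2) W(1-3)] germ_restr[OF V(1) W(1,2,4)] U(3,4) V(2)
    by simp
qed

text \<open>Sum and product in a stalk are defined by the same pattern, so one argument covers every
  operation \<open>op\<close> that is compatible with restriction.\<close>

lemma UN_germ_binop:
  fixes op :: "'r ring \<Rightarrow> 'r \<Rightarrow> 'r \<Rightarrow> 'r"
  assumes cl: "\<And>U s t. \<lbrakk>openin (topol X) U; s \<in> carrier (sect X U); t \<in> carrier (sect X U)\<rbrakk>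
      \<Longrightarrow> op (sect X U) s t \<in> carrier (sect X U)"
    and hom: "\<And>U V s t. \<lbrakk>openin (topol X) U; openin (topol X) V; V \<subseteq> U;
      s \<in> carrier (sect X U); t \<in> carrier (sect X U)\<rbrakk>
      \<Longrightarrow> restr X U V (op (sect X U) s t) = op (sect X V) (restr X U V s) (restr X U V t)"
    and s: "(U, s) \<in> presections X x" and t: "(U, t) \<in> presections X x"
  shows "(\<Union>(V, s)\<in>germ X x U s. \<Union>(W, t)\<in>germ X x U t.
      germ X x (V \<inter> W) (op (sect X (V \<inter> W)) (restr X V (V \<inter> W) s) (restr X W (V \<inter> W) t)))
    = germ X x U (op (sect X U) s t)"
proof -
  define g where "g V W s t =
    germ X x (V \<inter> W) (op (sect X (V \<inter> W)) (restr X V (V \<inter> W) s) (restr X W (V \<inter> W) t))" for V W s t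
  \<comment> \<open>The resulting germ can be computed on any smaller neighbourhood N. Choosing N so
    small that the representatives agree on it gives independence of the representatives.\<close>
  have key: "g V W s t = germ X x N (op (sect X N) (restr X V N s) (restr X W N t))"
    if p: "(V, s) \<in> presections X x" "(W, t) \<in> presections X x"
      and N: "openin (topol X) N" "x \<in> N" "N \<subseteq> V \<inter> W" for V W N s t
  proof -
    have VW: "openin (topol X) (V \<inter> W)" "x \<in> V \<inter> W" using p by (auto simp: presections_iff)
    have ps: "(V \<inter> W, restr X V (V \<inter> W) s) \<in> presections X x"
      "(V \<inter> W, restr X W (V \<inter> W) t) \<in> presections X x"
      using p VW by (intro presections_restr; simp)+
    then have q: "(V \<inter> W, op (sect X (V \<inter> W)) (restr X V (V \<inter> W) s) (restr X W (V \<inter> W) t)) \<in> presections X x"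
      using VW cl by (simp add: presections_iff)
    have "restr X (V \<inter> W) N (restr X V (V \<inter> W) s) = restr X V N s"
      "restr X (V \<inter> W) N (restr X W (V \<inter> W) t) = restr X W N t"
      using p VW N by (intro restr_restr; auto simp: presections_iff)+
    then have "restr X (V \<inter> W) N (op (sect X (V \<inter> W)) (restr X V (V \<inter> W) s) (restr X W (V \<inter> W) t))
        = op (sect X N) (restr X V N s) (restr X W N t)"
      using hom[OF VW(1) N(1,3)] ps by (simp add: presections_iff)
    then show ?thesis unfolding g_def using germ_restr[OF q N] by simp
  qed
  have cong: "g V W s' t' = g U U s t"
    if V: "(V, s') \<in> presections X x" "germ X x U s = germ X x V s'"
      and W: "(W, t') \<in> presections X x" "germ X x U t = germ X x W t'" for V W s' t'
  proof -
    obtain M where M: "openin (topol X) M" "x \<in> M" "M \<subseteq> U \<inter> V" "restr X U M s = restr X V M s'"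
      using germ_eq_iff[OF s V(1)] V(2) by auto
    obtain N where N: "openin (topol X) N" "x \<in> N" "N \<subseteq> U \<inter> W" "restr X U N t = restr X W N t'"
      using germ_eq_iff[OF t W(1)] W(2) by auto
    have MN: "openin (topol X) (M \<inter> N)" "x \<in> M \<inter> N" using M N by auto
    have sub: "M \<inter> N \<subseteq> V \<inter> W" "M \<inter> N \<subseteq> U \<inter> U" using M(3) N(3) by auto
    have "restr X V (M \<inter> N) s' = restr X M (M \<inter> N) (restr X V M s')"
      using V(1) M(1-3) MN by (intro restr_restr[symmetric]) (auto simp: presections_iff)
    also have "\<dots> = restr X U (M \<inter> N) s"
      unfolding M(4)[symmetric] using s M(1-3) MN by (intro restr_restr) (auto simp: presections_iff)
    finally have 1: "restr X V (M \<inter> N) s' = restr X U (M \<inter> N) s" .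
    have "restr X W (M \<inter> N) t' = restr X N (M \<inter> N) (restr X W N t')"
      using W(1) N(1-3) MN by (intro restr_restr[symmetric]) (auto simp: presections_iff)
    also have "\<dots> = restr X U (M \<inter> N) t"
      unfolding N(4)[symmetric] using t N(1-3) MN by (intro restr_restr) (auto simp: presections_iff)
    finally have 2: "restr X W (M \<inter> N) t' = restr X U (M \<inter> N) t" .
    show ?thesis
      using key[OF V(1) W(1) MN sub(1)] key[OF s t MN sub(2)] 1 2 by simp
  qed
  have inner: "(\<Union>(W, t)\<in>germ X x U t. g V W s' t) = g V U s' t"
    if "(V, s') \<in> presections X x" "germ X x U s = germ X x V s'" for V s'
  proof (rule UN_germ[OF t])
    fix W t' assume "(W, t') \<in> presections X x" "germ X x U t = germ X x W t'"
    then show "g V W s' t' = g V U s' t" using cong[OF that] t by simp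
  qed
  have "(\<Union>(V, s)\<in>germ X x U s. \<Union>(W, t)\<in>germ X x U t. g V W s t) = (\<Union>(W, t)\<in>germ X x U t. g U W s t)"
  proof (rule UN_germ[OF s])
    fix V s' assume V: "(V, s') \<in> presections X x" "germ X x U s = germ X x V s'"
    show "(\<Union>(W, t)\<in>germ X x U t. g V W s' t) = (\<Union>(W, t)\<in>germ X x U t. g U W s t)"
      unfolding inner[OF V] inner[OF s refl] using cong[OF V t refl] by simp
  qed
  also have "\<dots> = g U U s t" by (rule inner[OF s refl])
  also have "\<dots> = germ X x U (op (sect X U) s t)"
    using key[OF s t, of U] s t restr_id by (simp add: presections_iff)
  finally show ?thesis unfolding g_def .
qed

lemma stalk_mult:
  assumes "(U, s) \<in> presections X x" "(U, t) \<in> presections X x"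
  shows "germ X x U s \<otimes>\<^bsub>stalk X x\<^esub> germ X x U t = germ X x U (s \<otimes>\<^bsub>sect X U\<^esub> t)"
proof -
  have "(\<Union>(V, s)\<in>germ X x U s. \<Union>(W, t)\<in>germ X x U t.
      germ X x (V \<inter> W) (restr X V (V \<inter> W) s \<otimes>\<^bsub>sect X (V \<inter> W)\<^esub> restr X W (V \<inter> W) t))
    = germ X x U (s \<otimes>\<^bsub>sect X U\<^esub> t)"
  proof (rule UN_germ_binop[of monoid.mult, OF _ _ assms])
    show "s \<otimes>\<^bsub>sect X U\<^esub> t \<in> carrier (sect X U)"
      if "openin (topol X) U" "s \<in> carrier (sect X U)" "t \<in> carrier (sect X U)" for U s t
      using cring.cring_simprules(5)[OF cring_sect[OF that(1)]] that(2,3) by simp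
  qed (simp add: ring_hom_mult[OF restr_hom])
  then show ?thesis by (simp add: stalk_def)
qed

lemma stalk_add:
  assumes "(U, s) \<in> presections X x" "(U, t) \<in> presections X x"
  shows "germ X x U s \<oplus>\<^bsub>stalk X x\<^esub> germ X x U t = germ X x U (s \<oplus>\<^bsub>sect X U\<^esub> t)"
proof -
  have "(\<Union>(V, s)\<in>germ X x U s. \<Union>(W, t)\<in>germ X x U t.
      germ X x (V \<inter> W) (restr X V (V \<inter> W) s \<oplus>\<^bsub>sect X (V \<inter> W)\<^esub> restr X W (V \<inter> W) t))
    = germ X x U (s \<oplus>\<^bsub>sect X U\<^esub> t)"
  proof (rule UN_germ_binop[of ring.add, OF _ _ assms])
    show "s \<oplus>\<^bsub>sect X U\<^esub> t \<in> carrier (sect X U)"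
      if "openin (topol X) U" "s \<in> carrier (sect X U)" "t \<in> carrier (sect X U)" for U s t
      using cring.cring_simprules(1)[OF cring_sect[OF that(1)]] that(2,3) by simp
  qed (simp add: ring_hom_add[OF restr_hom])
  then show ?thesis by (simp add: stalk_def)
qed

lemma sect_cring: "(U, s) \<in> presections X x \<Longrightarrow> cring (sect X U)"
  by (simp add: presections_iff cring_sect)

lemma presections_one: "\<lbrakk>openin (topol X) U; x \<in> U\<rbrakk> \<Longrightarrow> (U, \<one>\<^bsub>sect X U\<^esub>) \<in> presections X x"
  using cring.cring_simprules(6)[OF cring_sect] by (simp add: presections_iff)

lemma presections_zero: "\<lbrakk>openin (topol X) U; x \<in> U\<rbrakk> \<Longrightarrow> (U, \<zero>\<^bsub>sect X U\<^esub>) \<in> presections X x"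
  using cring.cring_simprules(2)[OF cring_sect] by (simp add: presections_iff)

lemma stalk_one:
  assumes U: "openin (topol X) U" "x \<in> U"
  shows "\<one>\<^bsub>stalk X x\<^esub> = germ X x U \<one>\<^bsub>sect X U\<^esub>"
proof -
  let ?T = "topspace (topol X)"
  have T: "x \<in> ?T" "U \<subseteq> ?T" using openin_subset[OF U(1)] U(2) by auto
  have "restr X ?T U \<one>\<^bsub>sect X ?T\<^esub> = \<one>\<^bsub>sect X U\<^esub>"
    using U T by (intro ring_hom_one restr_hom) auto
  then show ?thesis
    using germ_restr[OF presections_one[OF openin_topspace T(1)] U T(2)] by (simp add: stalk_def)
qed

lemma stalk_zero:
  assumes U: "openin (topol X) U" "x \<in> U"
  shows "\<zero>\<^bsub>stalk X x\<^esub> = germ X x U \<zero>\<^bsub>sect X U\<^esub>"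
proof -
  let ?T = "topspace (topol X)"
  have T: "x \<in> ?T" "U \<subseteq> ?T" using openin_subset[OF U(1)] U(2) by auto
  have "restr X ?T U \<zero>\<^bsub>sect X ?T\<^esub> = \<zero>\<^bsub>sect X U\<^esub>"
    using U T by (intro ring_hom_zero restr_hom cring.axioms(1) cring_sect) auto
  then show ?thesis
    using germ_restr[OF presections_zero[OF openin_topspace T(1)] U T(2)] by (simp add: stalk_def)
qed

text \<open>At most three germs occur in each axiom. They have representatives over a common
  neighbourhood, and the axiom holds in the section ring there.\<close>

lemma stalk_cring:
  assumes x: "x \<in> topspace (topol X)"
  shows "cring (stalk X x)"
proof -
  note rules = cring.cring_simprules
  have p: "(U, s \<otimes>\<^bsub>sect X U\<^esub> t) \<in> presections X x" "(U, s \<oplus>\<^bsub>sect X U\<^esub> t) \<in> presections X x"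
    if "(U, s) \<in> presections X x" "(U, t) \<in> presections X x" for U s t
    using rules(1,5)[OF sect_cring[OF that(1)]] that by (simp_all add: presections_iff)
  have one: "\<one>\<^bsub>stalk X x\<^esub> = germ X x U \<one>\<^bsub>sect X U\<^esub>" "(U, \<one>\<^bsub>sect X U\<^esub>) \<in> presections X x"
    and zero: "\<zero>\<^bsub>stalk X x\<^esub> = germ X x U \<zero>\<^bsub>sect X U\<^esub>" "(U, \<zero>\<^bsub>sect X U\<^esub>) \<in> presections X x"
    if "(U, s) \<in> presections X x" for U s
    using that stalk_one stalk_zero presections_one presections_zero by (auto simp: presections_iff)
  have ops: "S \<oplus>\<^bsub>stalk X x\<^esub> T \<in> carrier (stalk X x)" "S \<oplus>\<^bsub>stalk X x\<^esub> T = T \<oplus>\<^bsub>stalk X x\<^esub> S"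
    "S \<otimes>\<^bsub>stalk X x\<^esub> T \<in> carrier (stalk X x)" "S \<otimes>\<^bsub>stalk X x\<^esub> T = T \<otimes>\<^bsub>stalk X x\<^esub> S"
    if ST: "S \<in> carrier (stalk X x)" "T \<in> carrier (stalk X x)" for S T
  proof -
    obtain U s t where U: "(U, s) \<in> presections X x" "(U, t) \<in> presections X x"
      "S = germ X x U s" "T = germ X x U t" using ST by (rule stalkE2)
    interpret sec: cring "sect X U" by (rule sect_cring[OF U(1)])
    show "S \<oplus>\<^bsub>stalk X x\<^esub> T \<in> carrier (stalk X x)" "S \<oplus>\<^bsub>stalk X x\<^esub> T = T \<oplus>\<^bsub>stalk X x\<^esub> S"
      "S \<otimes>\<^bsub>stalk X x\<^esub> T \<in> carrier (stalk X x)" "S \<otimes>\<^bsub>stalk X x\<^esub> T = T \<otimes>\<^bsub>stalk X x\<^esub> S"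
      using U p[OF U(1,2)] by (simp_all add: stalk_add stalk_mult germ_closed presections_iff sec.a_comm sec.m_comm)
  qed
  have ops3: "(S \<oplus>\<^bsub>stalk X x\<^esub> T) \<oplus>\<^bsub>stalk X x\<^esub> R = S \<oplus>\<^bsub>stalk X x\<^esub> (T \<oplus>\<^bsub>stalk X x\<^esub> R)"
    "(S \<otimes>\<^bsub>stalk X x\<^esub> T) \<otimes>\<^bsub>stalk X x\<^esub> R = S \<otimes>\<^bsub>stalk X x\<^esub> (T \<otimes>\<^bsub>stalk X x\<^esub> R)"
    "(S \<oplus>\<^bsub>stalk X x\<^esub> T) \<otimes>\<^bsub>stalk X x\<^esub> R
      = S \<otimes>\<^bsub>stalk X x\<^esub> R \<oplus>\<^bsub>stalk X x\<^esub> T \<otimes>\<^bsub>stalk X x\<^esub> R"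
    if STR: "S \<in> carrier (stalk X x)" "T \<in> carrier (stalk X x)" "R \<in> carrier (stalk X x)" for S T R
  proof -
    obtain U s t r where U: "(U, s) \<in> presections X x" "(U, t) \<in> presections X x"
      "(U, r) \<in> presections X x" "S = germ X x U s" "T = germ X x U t" "R = germ X x U r"
      using STR by (rule stalkE3)
    interpret sec: cring "sect X U" by (rule sect_cring[OF U(1)])
    have m: "s \<in> carrier (sect X U)" "t \<in> carrier (sect X U)" "r \<in> carrier (sect X U)"
      using U by (auto simp: presections_iff)
    show "(S \<oplus>\<^bsub>stalk X x\<^esub> T) \<oplus>\<^bsub>stalk X x\<^esub> R = S \<oplus>\<^bsub>stalk X x\<^esub> (T \<oplus>\<^bsub>stalk X x\<^esub> R)"
      "(S \<otimes>\<^bsub>stalk X x\<^esub> T) \<otimes>\<^bsub>stalk X x\<^esub> R = S \<otimes>\<^bsub>stalk X x\<^esub> (T \<otimes>\<^bsub>stalk X x\<^esub> R)"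
      "(S \<oplus>\<^bsub>stalk X x\<^esub> T) \<otimes>\<^bsub>stalk X x\<^esub> R
        = S \<otimes>\<^bsub>stalk X x\<^esub> R \<oplus>\<^bsub>stalk X x\<^esub> T \<otimes>\<^bsub>stalk X x\<^esub> R"
      using U p m by (simp_all add: stalk_add stalk_mult sec.a_assoc sec.m_assoc sec.l_distr)
  qed
  have units: "\<one>\<^bsub>stalk X x\<^esub> \<otimes>\<^bsub>stalk X x\<^esub> S = S" "\<zero>\<^bsub>stalk X x\<^esub> \<oplus>\<^bsub>stalk X x\<^esub> S = S"
    "\<exists>T\<in>carrier (stalk X x). T \<oplus>\<^bsub>stalk X x\<^esub> S = \<zero>\<^bsub>stalk X x\<^esub>"
    if S: "S \<in> carrier (stalk X x)" for S
  proof -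
    obtain U s where U: "(U, s) \<in> presections X x" "S = germ X x U s" using S by (rule stalkE)
    interpret sec: cring "sect X U" by (rule sect_cring[OF U(1)])
    have m: "s \<in> carrier (sect X U)" using U by (auto simp: presections_iff)
    have n: "(U, \<ominus>\<^bsub>sect X U\<^esub> s) \<in> presections X x" using U(1) by (simp add: presections_iff)
    show "\<one>\<^bsub>stalk X x\<^esub> \<otimes>\<^bsub>stalk X x\<^esub> S = S" "\<zero>\<^bsub>stalk X x\<^esub> \<oplus>\<^bsub>stalk X x\<^esub> S = S"
      using U m one[OF U(1)] zero[OF U(1)] by (simp_all add: stalk_add stalk_mult)
    have "germ X x U (\<ominus>\<^bsub>sect X U\<^esub> s) \<oplus>\<^bsub>stalk X x\<^esub> S = \<zero>\<^bsub>stalk X x\<^esub>"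
      using U m n zero[OF U(1)] by (simp add: stalk_add sec.l_neg)
    then show "\<exists>T\<in>carrier (stalk X x). T \<oplus>\<^bsub>stalk X x\<^esub> S = \<zero>\<^bsub>stalk X x\<^esub>"
      using germ_closed[OF n] by blast
  qed
  have "(topspace (topol X), \<zero>\<^bsub>sect X (topspace (topol X))\<^esub>) \<in> presections X x"
    using x by (simp add: presections_zero)
  then have "\<one>\<^bsub>stalk X x\<^esub> \<in> carrier (stalk X x)" "\<zero>\<^bsub>stalk X x\<^esub> \<in> carrier (stalk X x)"
    using one zero germ_closed by (metis)+
  then show ?thesis
    by (intro cringI abelian_groupI comm_monoidI ops ops3 units)
qed

end


section \<open>Morphisms of ringed spaces\<close>

text \<open>The conditions of \<open>lrs_morphism\<close> without locality on stalks. Stalk maps are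
  thus available as ring homomorphisms while locality of a morphism is still to be proved.\<close>

locale rs_morphism = source: ringed_space X + target: ringed_space Y
  for X :: "('p, 'r) rspace" and Y :: "('q, 's) rspace" and f :: "('p, 'r, 'q, 's) rs_map" +
  assumes continuous: "continuous_map (topol X) (topol Y) (pmap f)"
    and comorph_hom: "openin (topol Y) V
          \<Longrightarrow> comorph f V \<in> ring_hom (sect Y V) (sect X (preim X f V))"
    and comorph_restr: "\<lbrakk>openin (topol Y) V; openin (topol Y) W; W \<subseteq> V; t \<in> carrier (sect Y V)\<rbrakk>
          \<Longrightarrow> comorph f W (restr Y V W t) = restr X (preim X f V) (preim X f W) (comorph f V t)"
begin

lemma openin_preim: "openin (topol Y) V \<Longrightarrow> openin (topol X) (preim X f V)"
  unfolding preim_def by (rule openin_continuous_map_preimage[OF continuous])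

lemma presections_comorph:
  assumes "x \<in> topspace (topol X)" "(V, t) \<in> presections Y (pmap f x)"
  shows "(preim X f V, comorph f V t) \<in> presections X x"
  using assms openin_preim ring_hom_closed[OF comorph_hom]
  by (auto simp: source.presections_iff target.presections_iff preim_def)

text \<open>Representatives that agree on N have pullbacks that agree on the preimage of N.\<close>

lemma stalk_map_germ:
  assumes x: "x \<in> topspace (topol X)" and t: "(V, t) \<in> presections Y (pmap f x)"
  shows "stalk_map X f x (germ Y (pmap f x) V t) = germ X x (preim X f V) (comorph f V t)"
  unfolding stalk_map_def
proof (rule target.UN_germ[OF t])
  fix W r assume r: "(W, r) \<in> presections Y (pmap f x)" and "germ Y (pmap f x) V t = germ Y (pmap f x) W r"
  then obtain N where N: "openin (topol Y) N" "pmap f x \<in> N" "N \<subseteq> V \<inter> W" "restr Y V N t = restr Y W N r"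
    using target.germ_eq_iff[OF t r] by auto
  have N': "openin (topol X) (preim X f N)" "x \<in> preim X f N" "preim X f N \<subseteq> preim X f V"
    "preim X f N \<subseteq> preim X f W"
    using N x openin_preim by (auto simp: preim_def)
  have "germ X x (preim X f W) (comorph f W r)
      = germ X x (preim X f N) (restr X (preim X f W) (preim X f N) (comorph f W r))"
    by (rule source.germ_restr[OF presections_comorph[OF x r] N'(1,2,4), symmetric])
  also have "restr X (preim X f W) (preim X f N) (comorph f W r)
      = restr X (preim X f V) (preim X f N) (comorph f V t)"
    using comorph_restr[of W N r] comorph_restr[of V N t] N t r by (simp add: target.presections_iff)
  also have "germ X x (preim X f N) (restr X (preim X f V) (preim X f N) (comorph f V t))
      = germ X x (preim X f V) (comorph f V t)"
    by (rule source.germ_restr[OF presections_comorph[OF x t] N'(1,2,3)])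
  finally show "germ X x (preim X f W) (comorph f W r) = germ X x (preim X f V) (comorph f V t)" .
qed

lemma pmap_in_topspace: "x \<in> topspace (topol X) \<Longrightarrow> pmap f x \<in> topspace (topol Y)"
  using continuous by (auto simp: continuous_map_def)

lemma stalk_map_hom:
  assumes x: "x \<in> topspace (topol X)"
  shows "stalk_map X f x \<in> ring_hom (stalk Y (pmap f x)) (stalk X x)"
proof (rule ring_hom_memI)
  fix T assume "T \<in> carrier (stalk Y (pmap f x))"
  then obtain V t where "(V, t) \<in> presections Y (pmap f x)" "T = germ Y (pmap f x) V t"
    by (rule target.stalkE)
  then show "stalk_map X f x T \<in> carrier (stalk X x)"
    using x by (simp add: stalk_map_germ presections_comorph source.germ_closed)
next
  fix S T assume "S \<in> carrier (stalk Y (pmap f x))" "T \<in> carrier (stalk Y (pmap f x))"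
  then obtain V s t where V: "(V, s) \<in> presections Y (pmap f x)" "(V, t) \<in> presections Y (pmap f x)"
    "S = germ Y (pmap f x) V s" "T = germ Y (pmap f x) V t"
    by (rule target.stalkE2)
  have op: "openin (topol Y) V" "s \<in> carrier (sect Y V)" "t \<in> carrier (sect Y V)" "pmap f x \<in> V"
    using V by (auto simp: target.presections_iff)
  interpret sec: cring "sect Y V" by (rule target.cring_sect[OF op(1)])
  have p: "(V, s \<otimes>\<^bsub>sect Y V\<^esub> t) \<in> presections Y (pmap f x)"
    "(V, s \<oplus>\<^bsub>sect Y V\<^esub> t) \<in> presections Y (pmap f x)"
    using op by (auto simp: target.presections_iff)
  show "stalk_map X f x (S \<otimes>\<^bsub>stalk Y (pmap f x)\<^esub> T) = stalk_map X f x S \<otimes>\<^bsub>stalk X x\<^esub> stalk_map X f x T"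
    using V p op x presections_comorph[OF x] by (simp add: target.stalk_mult stalk_map_germ source.stalk_mult
        ring_hom_mult[OF comorph_hom])
  show "stalk_map X f x (S \<oplus>\<^bsub>stalk Y (pmap f x)\<^esub> T) = stalk_map X f x S \<oplus>\<^bsub>stalk X x\<^esub> stalk_map X f x T"
    using V p op x presections_comorph[OF x] by (simp add: target.stalk_add stalk_map_germ source.stalk_add
        ring_hom_add[OF comorph_hom])
next
  let ?T = "topspace (topol Y)"
  have T: "pmap f x \<in> ?T" by (rule pmap_in_topspace[OF x])
  have "x \<in> preim X f ?T" using x T by (simp add: preim_def)
  then show "stalk_map X f x \<one>\<^bsub>stalk Y (pmap f x)\<^esub> = \<one>\<^bsub>stalk X x\<^esub>"
    using target.stalk_one[OF openin_topspace T] target.presections_one[OF openin_topspace T]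
      source.stalk_one[OF openin_preim[OF openin_topspace]] ring_hom_one[OF comorph_hom[OF openin_topspace]]
    by (simp add: stalk_map_germ[OF x])
qed

end

lemma (in lrs_morphism) rs_morphism: "rs_morphism X Y f"
  by unfold_locales (use continuous comorph_hom comorph_restr in auto)


section \<open>The spectrum as a locally ringed space\<close>

definition basic_open :: "('a, 'm) ring_scheme \<Rightarrow> 'a \<Rightarrow> 'a set set" where
  "basic_open R f = {p. primeideal p R \<and> f \<notin> p}"

lemma topspace_zariski: "topspace (zariski R) = {p. primeideal p R}"
proof
  show "topspace (zariski R) \<subseteq> {p. primeideal p R}"
    using openin_topspace[of "zariski R"] unfolding openin_zariski by auto
  have "\<not> carrier R \<subseteq> p" if "primeideal p R" for p
    using that primeideal.I_notcarr[OF that] additive_subgroup.a_subset[of p R]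
      ideal.axioms(1)[OF primeideal.axioms(1)[OF that]] by auto
  then have "openin (zariski R) {p. primeideal p R}"
    unfolding openin_zariski by (intro exI[of _ "carrier R"]) auto
  then show "{p. primeideal p R} \<subseteq> topspace (zariski R)" by (rule openin_subset)
qed

lemma openin_basic_open: "f \<in> carrier R \<Longrightarrow> openin (zariski R) (basic_open R f)"
  unfolding openin_zariski basic_open_def by (intro exI[of _ "{f}"]) auto

lemma openin_zariski_basic:
  assumes "openin (zariski R) U" "p \<in> U"
  obtains f where "f \<in> carrier R" "p \<in> basic_open R f" "basic_open R f \<subseteq> U"
proof -
  obtain E where E: "E \<subseteq> carrier R" "U = {p. primeideal p R \<and> \<not> E \<subseteq> p}"
    using assms(1) unfolding openin_zariski by auto
  then obtain f where "f \<in> E" "f \<notin> p" using assms(2) by auto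
  then show thesis using that[of f] E assms(2) by (auto simp: basic_open_def)
qed

lemma openin_zariskiI:
  assumes "\<And>p. p \<in> U \<Longrightarrow> \<exists>f\<in>carrier R. p \<in> basic_open R f \<and> basic_open R f \<subseteq> U"
  shows "openin (zariski R) U"
  by (subst openin_subopen) (metis assms openin_basic_open)

lemma primeideal_mult_notin_iff:
  assumes "primeideal p R" "f \<in> carrier R" "g \<in> carrier R"
  shows "f \<otimes>\<^bsub>R\<^esub> g \<notin> p \<longleftrightarrow> f \<notin> p \<and> g \<notin> p"
proof -
  interpret primeideal p R by fact
  show ?thesis using assms(2,3) I_prime[of f g] I_l_closed[of g f] I_r_closed[of f g] by auto
qed

lemma basic_open_mult:
  "\<lbrakk>f \<in> carrier R; g \<in> carrier R\<rbrakk>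
    \<Longrightarrow> basic_open R (f \<otimes>\<^bsub>R\<^esub> g) = basic_open R f \<inter> basic_open R g"
  using primeideal_mult_notin_iff[of _ R f g] by (simp add: basic_open_def set_eq_iff) blast

lemma basic_openD: "\<lbrakk>p \<in> basic_open R f; f \<in> carrier R\<rbrakk> \<Longrightarrow> f \<in> carrier R - p"
  by (simp add: basic_open_def)

lemma basic_open_prime: "p \<in> basic_open R f \<Longrightarrow> primeideal p R"
  by (simp add: basic_open_def)

lemma primeideal_loc_cring: "primeideal p R \<Longrightarrow> cring (loc_at R p)"
  by (intro localized_cring.localization_cring primeideal.localized_cring_compl)

text \<open>In contrast to \<open>spec_sections\<close>, the neighbourhood is the basic open set of
  the denominator itself. A pair (a, f) then carries both the fraction and its domain, and shrinking
  the domain means expanding the fraction.\<close>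

definition has_local_fraction ::
  "('a, 'm) ring_scheme \<Rightarrow> 'a set set \<Rightarrow> ('a set \<Rightarrow> ('a \<times> 'a) set) \<Rightarrow> 'a set \<Rightarrow> 'a \<Rightarrow> 'a \<Rightarrow> bool" where
  "has_local_fraction R U s p a f \<longleftrightarrow> a \<in> carrier R \<and> f \<in> carrier R \<and> p \<in> basic_open R f \<and>
     basic_open R f \<subseteq> U \<and> (\<forall>q\<in>basic_open R f. s q = frac_at R q a f)"

lemma has_local_fractionD:
  assumes "has_local_fraction R U s p a f"
  shows "a \<in> carrier R" "f \<in> carrier R" "p \<in> basic_open R f" "basic_open R f \<subseteq> U"
    "q \<in> basic_open R f \<Longrightarrow> s q = frac_at R q a f"
  using assms by (auto simp: has_local_fraction_def)

lemma has_local_fraction_mult: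
  assumes s: "has_local_fraction R U s p a f" and g: "g \<in> carrier R" "p \<in> basic_open R g"
  shows "has_local_fraction R U s p (a \<otimes>\<^bsub>R\<^esub> g) (f \<otimes>\<^bsub>R\<^esub> g)"
proof -
  have R: "cring R" using g(2) unfolding basic_open_def primeideal_def by auto
  interpret cring R by (rule R)
  have m: "a \<in> carrier R" "f \<in> carrier R" using s by (simp_all add: has_local_fraction_def)
  have "s q = frac_at R q (a \<otimes>\<^bsub>R\<^esub> g) (f \<otimes>\<^bsub>R\<^esub> g)" if q: "q \<in> basic_open R (f \<otimes>\<^bsub>R\<^esub> g)" for q
  proof -
    have q': "q \<in> basic_open R f" "q \<in> basic_open R g" using q basic_open_mult[OF m(2) g(1)] by auto
    interpret L: localized_cring R "carrier R - q"
      by (rule primeideal.localized_cring_compl[OF basic_open_prime[OF q]])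
    have "s q = frac_at R q a f" using s q' by (simp add: has_local_fraction_def)
    also have "\<dots> = frac_at R q (a \<otimes>\<^bsub>R\<^esub> g) (f \<otimes>\<^bsub>R\<^esub> g)"
      using L.frac_expand[OF m(1) basic_openD[OF q'(1) m(2)] basic_openD[OF q'(2) g(1)]] by simp
    finally show ?thesis .
  qed
  then show ?thesis
    using s g m basic_open_mult[OF m(2) g(1)] unfolding has_local_fraction_def by auto
qed

lemma spec_sectionsI:
  assumes R: "\<And>p. p \<in> U \<Longrightarrow> primeideal p R" and "s \<in> extensional U"
    and "\<And>p. p \<in> U \<Longrightarrow> \<exists>a f. has_local_fraction R U s p a f"
  shows "s \<in> spec_sections R U"
proof -
  have "s p \<in> carrier (loc_at R p)" if p: "p \<in> U" for p
  proof -
    interpret L: localized_cring R "carrier R - p"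
      by (rule primeideal.localized_cring_compl[OF R[OF p]])
    obtain a f where af: "has_local_fraction R U s p a f" using assms(3)[OF p] by auto
    then have "s p = frac_at R p a f" "a \<in> carrier R" "f \<in> carrier R - p"
      using basic_openD[of p R f] by (simp_all add: has_local_fraction_def)
    then show ?thesis by simp
  qed
  moreover have "\<exists>V. openin (zariski R) V \<and> p \<in> V \<and> V \<subseteq> U \<and>
       (\<exists>a\<in>carrier R. \<exists>f\<in>carrier R. \<forall>q\<in>V. f \<notin> q \<and> s q = frac_at R q a f)"
    if p: "p \<in> U" for p
  proof -
    obtain a f where af: "has_local_fraction R U s p a f" using assms(3)[OF p] by auto
    have "\<forall>q\<in>basic_open R f. f \<notin> q \<and> s q = frac_at R q a f"
      using af by (simp add: has_local_fraction_def basic_open_def)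
    then show ?thesis
      using af openin_basic_open[of f R] unfolding has_local_fraction_def
      by (intro exI[of _ "basic_open R f"] conjI bexI[of _ a] bexI[of _ f]) simp_all
  qed
  ultimately show ?thesis
    using assms(2) unfolding spec_sections_def PiE_def Pi_def by simp
qed

lemma spec_sections_local:
  assumes s: "s \<in> spec_sections R U" and p: "p \<in> U"
  obtains a f where "has_local_fraction R U s p a f"
proof -
  obtain V a f where V: "openin (zariski R) V" "p \<in> V" "V \<subseteq> U" "a \<in> carrier R" "f \<in> carrier R"
    and af: "\<And>q. q \<in> V \<Longrightarrow> f \<notin> q \<and> s q = frac_at R q a f"
  proof -
    have "\<exists>V. openin (zariski R) V \<and> p \<in> V \<and> V \<subseteq> U \<and>
       (\<exists>a\<in>carrier R. \<exists>f\<in>carrier R. \<forall>q\<in>V. f \<notin> q \<and> s q = frac_at R q a f)"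
      using s p unfolding spec_sections_def by simp
    then show thesis using that by (elim exE conjE bexE) simp
  qed
  obtain g where g: "g \<in> carrier R" "p \<in> basic_open R g" "basic_open R g \<subseteq> V"
    using openin_zariski_basic[OF V(1,2)] .
  \<comment> \<open>The denominator f vanishes nowhere on V, which contains the basic open set of g.
    Expanding by g therefore yields a fraction whose denominator f g has precisely this basic open
    set as its domain.\<close>
  have fg: "basic_open R (f \<otimes>\<^bsub>R\<^esub> g) = basic_open R g"
    using basic_open_mult[OF V(5) g(1)] g(3) af by (auto simp: basic_open_def)
  have R: "cring R" using g(2) unfolding basic_open_def primeideal_def by auto
  interpret cring R by (rule R)
  have "s q = frac_at R q (a \<otimes>\<^bsub>R\<^esub> g) (f \<otimes>\<^bsub>R\<^esub> g)" if q: "q \<in> basic_open R g" for q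
  proof -
    interpret L: localized_cring R "carrier R - q"
      by (rule primeideal.localized_cring_compl[OF basic_open_prime[OF q]])
    have qV: "q \<in> V" using q g(3) by auto
    have "f \<in> carrier R - q" using af[OF qV] V(5) by simp
    then show ?thesis
      using L.frac_expand[OF V(4) _ basic_openD[OF q g(1)], of f] af[OF qV] by simp
  qed
  then show thesis
    using that[of "a \<otimes>\<^bsub>R\<^esub> g" "f \<otimes>\<^bsub>R\<^esub> g"] V g fg unfolding has_local_fraction_def by auto
qed

lemma spec_sections_local2:
  assumes s: "s \<in> spec_sections R U" and t: "t \<in> spec_sections R U" and p: "p \<in> U"
  obtains a b f where "has_local_fraction R U s p a f" "has_local_fraction R U t p b f"
proof -
  obtain a f where a: "has_local_fraction R U s p a f" using s p by (rule spec_sections_local)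
  obtain b g where b: "has_local_fraction R U t p b g" using t p by (rule spec_sections_local)
  have m: "f \<in> carrier R" "g \<in> carrier R" "p \<in> basic_open R f" "p \<in> basic_open R g"
    using a b by (simp_all add: has_local_fraction_def)
  have R: "cring R" using m(3) unfolding basic_open_def primeideal_def by auto
  interpret cring R by (rule R)
  show thesis
    using that[OF has_local_fraction_mult[OF a m(2,4)]] has_local_fraction_mult[OF b m(1,3)]
    by (simp add: m_comm[OF m(2,1)])
qed

lemma Spec_simps [simp]:
  "topol (Spec R) = zariski R"
  "carrier (sect (Spec R) U) = spec_sections R U"
  "restr (Spec R) U V s = restrict s V"
  "s \<otimes>\<^bsub>sect (Spec R) U\<^esub> t = (\<lambda>p\<in>U. s p \<otimes>\<^bsub>loc_at R p\<^esub> t p)"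
  "s \<oplus>\<^bsub>sect (Spec R) U\<^esub> t = (\<lambda>p\<in>U. s p \<oplus>\<^bsub>loc_at R p\<^esub> t p)"
  "\<one>\<^bsub>sect (Spec R) U\<^esub> = (\<lambda>p\<in>U. \<one>\<^bsub>loc_at R p\<^esub>)"
  "\<zero>\<^bsub>sect (Spec R) U\<^esub> = (\<lambda>p\<in>U. \<zero>\<^bsub>loc_at R p\<^esub>)"
  by (simp_all add: Spec_def)

lemma openin_zariski_prime: "\<lbrakk>openin (zariski R) U; p \<in> U\<rbrakk> \<Longrightarrow> primeideal p R"
  using openin_subset topspace_zariski by fastforce

lemma spec_sections_memD:
  assumes "s \<in> spec_sections R U"
  shows "s \<in> extensional U" "p \<in> U \<Longrightarrow> s p \<in> carrier (loc_at R p)"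
  using assms unfolding spec_sections_def PiE_def Pi_def by simp_all

lemma spec_sections_eqI:
  "\<lbrakk>s \<in> spec_sections R U; t \<in> spec_sections R U; \<And>p. p \<in> U \<Longrightarrow> s p = t p\<rbrakk> \<Longrightarrow> s = t"
  by (rule extensionalityI[OF spec_sections_memD(1) spec_sections_memD(1)])

lemma spec_sections_fraction:
  assumes U: "openin (zariski R) U" and "a \<in> carrier R" "f \<in> carrier R" "U \<subseteq> basic_open R f"
  shows "(\<lambda>p\<in>U. frac_at R p a f) \<in> spec_sections R U"
proof (rule spec_sectionsI)
  fix p assume p: "p \<in> U"
  show "primeideal p R" by (rule openin_zariski_prime[OF U p])
  then have R: "cring R" by (simp add: primeideal_def)
  interpret cring R by (rule R)
  obtain g where g: "g \<in> carrier R" "p \<in> basic_open R g" "basic_open R g \<subseteq> U"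
    using openin_zariski_basic[OF U p] .
  have fg: "basic_open R (f \<otimes>\<^bsub>R\<^esub> g) = basic_open R g"
    using basic_open_mult[OF assms(3) g(1)] g(3) assms(4) by auto
  have "frac_at R q a f = frac_at R q (a \<otimes>\<^bsub>R\<^esub> g) (f \<otimes>\<^bsub>R\<^esub> g)"
    if q: "q \<in> basic_open R g" for q
  proof -
    interpret L: localized_cring R "carrier R - q"
      by (rule primeideal.localized_cring_compl[OF basic_open_prime[OF q]])
    have "q \<in> basic_open R f" using q g(3) assms(4) by auto
    then show ?thesis
      using L.frac_expand[OF assms(2) basic_openD basic_openD[OF q g(1)]] assms(3) by simp
  qed
  then show "\<exists>b k. has_local_fraction R U (\<lambda>p\<in>U. frac_at R p a f) p b k"
    using assms(2,3) g fg unfolding has_local_fraction_def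
    by (intro exI[of _ "a \<otimes>\<^bsub>R\<^esub> g"] exI[of _ "f \<otimes>\<^bsub>R\<^esub> g"]) (auto simp: subset_iff)
qed simp

context cring
begin

lemma spec_sections_ops:
  assumes U: "openin (zariski R) U" and s: "s \<in> spec_sections R U" and t: "t \<in> spec_sections R U"
  shows "s \<oplus>\<^bsub>sect (Spec R) U\<^esub> t \<in> spec_sections R U" (is ?add)
    and "s \<otimes>\<^bsub>sect (Spec R) U\<^esub> t \<in> spec_sections R U" (is ?mult)
    and "\<exists>t\<in>spec_sections R U. t \<oplus>\<^bsub>sect (Spec R) U\<^esub> s = \<zero>\<^bsub>sect (Spec R) U\<^esub>" (is ?neg)
proof -
  \<comment> \<open>One pattern for sums, products and negatives: local fractions a / f and b / f
    with the same denominator are turned into \<open>\<phi> a b f\<close> over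
    \<open>\<psi> f\<close>, where \<open>\<psi> f\<close> vanishes at the same primes as f.\<close>
  have loc: "\<exists>c k. has_local_fraction R U u p c k"
    if p: "p \<in> U" and u: "\<And>q a b f. \<lbrakk>q \<in> U; q \<in> basic_open R f; a \<in> carrier R; b \<in> carrier R; f \<in> carrier R;
        s q = frac_at R q a f; t q = frac_at R q b f\<rbrakk>
        \<Longrightarrow> u q = frac_at R q (\<phi> a b f) (\<psi> f)"
      and cl: "\<And>a b f. \<lbrakk>a \<in> carrier R; b \<in> carrier R; f \<in> carrier R\<rbrakk> \<Longrightarrow> \<phi> a b f \<in> carrier R"
        "\<And>f. f \<in> carrier R \<Longrightarrow> \<psi> f \<in> carrier R"
        "\<And>f. f \<in> carrier R \<Longrightarrow> basic_open R (\<psi> f) = basic_open R f" for p u \<phi> \<psi>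
  proof -
    obtain a b f where a: "has_local_fraction R U s p a f" and b: "has_local_fraction R U t p b f"
      using s t p by (rule spec_sections_local2)
    then have m: "a \<in> carrier R" "b \<in> carrier R" "f \<in> carrier R" "p \<in> basic_open R f" "basic_open R f \<subseteq> U"
      by (simp_all add: has_local_fraction_def)
    have "u q = frac_at R q (\<phi> a b f) (\<psi> f)" if q: "q \<in> basic_open R f" for q
    proof (rule u[OF _ q m(1-3)])
      show "q \<in> U" using q m(5) by auto
      show "s q = frac_at R q a f" "t q = frac_at R q b f"
        using a b q unfolding has_local_fraction_def by blast+
    qed
    then have "has_local_fraction R U u p (\<phi> a b f) (\<psi> f)"
      using m cl unfolding has_local_fraction_def by simp
    then show ?thesis by blast
  qed
  note prime = openin_zariski_prime[OF U]
  show ?add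
  proof (rule spec_sectionsI)
    fix p assume p: "p \<in> U"
    show "\<exists>c k. has_local_fraction R U (s \<oplus>\<^bsub>sect (Spec R) U\<^esub> t) p c k"
    proof (rule loc[OF p, of _ "\<lambda>a b f. a \<oplus> b" "\<lambda>f. f"])
      fix q a b f assume q: "q \<in> U" "q \<in> basic_open R f" "a \<in> carrier R" "b \<in> carrier R" "f \<in> carrier R"
        "s q = frac_at R q a f" "t q = frac_at R q b f"
      interpret L: localized_cring R "carrier R - q" by (rule primeideal.localized_cring_compl[OF prime[OF q(1)]])
      show "(s \<oplus>\<^bsub>sect (Spec R) U\<^esub> t) q = frac_at R q (a \<oplus> b) f"
        using q L.frac_add_same[OF q(3,4) basic_openD[OF q(2,5)]] by simp
    qed simp_all
  qed (simp_all add: prime)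
  show ?mult
  proof (rule spec_sectionsI)
    fix p assume p: "p \<in> U"
    show "\<exists>c k. has_local_fraction R U (s \<otimes>\<^bsub>sect (Spec R) U\<^esub> t) p c k"
    proof (rule loc[OF p, of _ "\<lambda>a b f. a \<otimes> b" "\<lambda>f. f \<otimes> f"])
      fix q a b f assume q: "q \<in> U" "q \<in> basic_open R f" "a \<in> carrier R" "b \<in> carrier R" "f \<in> carrier R"
        "s q = frac_at R q a f" "t q = frac_at R q b f"
      interpret L: localized_cring R "carrier R - q" by (rule primeideal.localized_cring_compl[OF prime[OF q(1)]])
      show "(s \<otimes>\<^bsub>sect (Spec R) U\<^esub> t) q = frac_at R q (a \<otimes> b) (f \<otimes> f)"
        using q L.frac_mult[OF q(3) basic_openD[OF q(2,5)] q(4) basic_openD[OF q(2,5)]] by simp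
    qed (simp_all add: basic_open_mult)
  qed (simp_all add: prime)
  show ?neg
  proof
    let ?t = "\<lambda>p\<in>U. \<ominus>\<^bsub>loc_at R p\<^esub> s p"
    show "?t \<in> spec_sections R U"
    proof (rule spec_sectionsI)
      fix p assume p: "p \<in> U"
      show "\<exists>c k. has_local_fraction R U ?t p c k"
      proof (rule loc[OF p, of _ "\<lambda>a b f. \<ominus> a" "\<lambda>f. f"])
        fix q a b f assume q: "q \<in> U" "q \<in> basic_open R f" "a \<in> carrier R" "b \<in> carrier R" "f \<in> carrier R"
          "s q = frac_at R q a f" "t q = frac_at R q b f"
        interpret L: localized_cring R "carrier R - q" by (rule primeideal.localized_cring_compl[OF prime[OF q(1)]])
        interpret LR: cring "loc_at R q" by (rule L.localization_cring)
        note f = basic_openD[OF q(2,5)]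
        have "frac_at R q (\<ominus> a) f \<oplus>\<^bsub>loc_at R q\<^esub> frac_at R q a f = \<zero>\<^bsub>loc_at R q\<^esub>"
          using L.frac_add_same[OF _ q(3) f, of "\<ominus> a"] q(3) L.localization_zero[OF f] by (simp add: l_neg)
        then have "\<ominus>\<^bsub>loc_at R q\<^esub> frac_at R q a f = frac_at R q (\<ominus> a) f"
          using q(3) f by (intro LR.minus_equality L.frac_closed) auto
        then show "?t q = frac_at R q (\<ominus> a) f" using q by simp
      qed simp_all
    qed (simp_all add: prime)
    show "?t \<oplus>\<^bsub>sect (Spec R) U\<^esub> s = \<zero>\<^bsub>sect (Spec R) U\<^esub>"
    proof (simp, rule restrict_ext)
      fix p assume p: "p \<in> U"
      interpret LR: cring "loc_at R p" by (rule primeideal_loc_cring[OF prime[OF p]])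
      show "(if p \<in> U then \<ominus>\<^bsub>loc_at R p\<^esub> s p else undefined) \<oplus>\<^bsub>loc_at R p\<^esub> s p = \<zero>\<^bsub>loc_at R p\<^esub>"
        using p LR.l_neg[OF spec_sections_memD(2)[OF s p]] by simp
    qed
  qed
qed

lemma spec_sections_consts:
  assumes U: "openin (zariski R) U"
  shows "\<one>\<^bsub>sect (Spec R) U\<^esub> \<in> spec_sections R U" "\<zero>\<^bsub>sect (Spec R) U\<^esub> \<in> spec_sections R U"
proof -
  note prime = openin_zariski_prime[OF U]
  have one: "\<one> \<in> carrier R - p" if "p \<in> U" for p
    using primeideal.submonoid_compl[OF prime[OF that]] by (simp add: submonoid_def)
  then have D: "U \<subseteq> basic_open R \<one>" using prime by (auto simp: basic_open_def)
  have "\<one>\<^bsub>sect (Spec R) U\<^esub> = (\<lambda>p\<in>U. frac_at R p \<one> \<one>)"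
    "\<zero>\<^bsub>sect (Spec R) U\<^esub> = (\<lambda>p\<in>U. frac_at R p \<zero> \<one>)"
    by (simp_all add: localization_def)
  then show "\<one>\<^bsub>sect (Spec R) U\<^esub> \<in> spec_sections R U" "\<zero>\<^bsub>sect (Spec R) U\<^esub> \<in> spec_sections R U"
    using spec_sections_fraction[OF U _ _ D, of \<one>] spec_sections_fraction[OF U _ _ D, of \<zero>]
    by (simp_all del: Spec_simps)
qed

lemma Spec_sect_cring:
  assumes U: "openin (zariski R) U"
  shows "cring (sect (Spec R) U)"
proof -
  note prime = openin_zariski_prime[OF U]
  note ops = spec_sections_ops[OF U] and cst = spec_sections_consts[OF U]
  have cr: "cring (loc_at R p)" if "p \<in> U" for p by (rule primeideal_loc_cring[OF prime[OF that]])
  note rules = cring.cring_simprules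
  note mem = spec_sections_memD(2)
  show ?thesis
  proof (intro cringI abelian_groupI comm_monoidI)
    fix s t assume s: "s \<in> carrier (sect (Spec R) U)" and t: "t \<in> carrier (sect (Spec R) U)"
    have st: "s \<in> spec_sections R U" "t \<in> spec_sections R U" using s t by simp_all
    show "s \<oplus>\<^bsub>sect (Spec R) U\<^esub> t \<in> carrier (sect (Spec R) U)"
      "s \<otimes>\<^bsub>sect (Spec R) U\<^esub> t \<in> carrier (sect (Spec R) U)"
      using ops(1,2)[OF st] by (simp_all del: Spec_simps(4,5))
    show "s \<oplus>\<^bsub>sect (Spec R) U\<^esub> t = t \<oplus>\<^bsub>sect (Spec R) U\<^esub> s"
      unfolding Spec_simps using st by (intro restrict_ext rules(10)[OF cr] mem)
    show "s \<otimes>\<^bsub>sect (Spec R) U\<^esub> t = t \<otimes>\<^bsub>sect (Spec R) U\<^esub> s"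
      unfolding Spec_simps using st by (intro restrict_ext rules(14)[OF cr] mem)
  next
    fix s t r assume "s \<in> carrier (sect (Spec R) U)" "t \<in> carrier (sect (Spec R) U)"
      "r \<in> carrier (sect (Spec R) U)"
    then have m: "s p \<in> carrier (loc_at R p)" "t p \<in> carrier (loc_at R p)" "r p \<in> carrier (loc_at R p)"
      if "p \<in> U" for p using mem that by simp_all
    show "s \<oplus>\<^bsub>sect (Spec R) U\<^esub> t \<oplus>\<^bsub>sect (Spec R) U\<^esub> r = s \<oplus>\<^bsub>sect (Spec R) U\<^esub> (t \<oplus>\<^bsub>sect (Spec R) U\<^esub> r)"
      "s \<otimes>\<^bsub>sect (Spec R) U\<^esub> t \<otimes>\<^bsub>sect (Spec R) U\<^esub> r = s \<otimes>\<^bsub>sect (Spec R) U\<^esub> (t \<otimes>\<^bsub>sect (Spec R) U\<^esub> r)"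
      "(s \<oplus>\<^bsub>sect (Spec R) U\<^esub> t) \<otimes>\<^bsub>sect (Spec R) U\<^esub> r
        = s \<otimes>\<^bsub>sect (Spec R) U\<^esub> r \<oplus>\<^bsub>sect (Spec R) U\<^esub> t \<otimes>\<^bsub>sect (Spec R) U\<^esub> r"
      unfolding Spec_simps
      by (rule restrict_ext, simp only: restrict_apply' rules(7)[OF cr] rules(11)[OF cr] rules(13)[OF cr] m)+
  next
    fix s assume s: "s \<in> carrier (sect (Spec R) U)"
    then have m: "s p \<in> carrier (loc_at R p)" if "p \<in> U" for p using mem that by simp
    have ext: "restrict s U = s" using s by (intro extensional_restrict spec_sections_memD(1)) simp
    have "\<zero>\<^bsub>sect (Spec R) U\<^esub> \<oplus>\<^bsub>sect (Spec R) U\<^esub> s = restrict s U"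
      "\<one>\<^bsub>sect (Spec R) U\<^esub> \<otimes>\<^bsub>sect (Spec R) U\<^esub> s = restrict s U"
      unfolding Spec_simps
      by (rule restrict_ext, simp only: restrict_apply' rules(8)[OF cr] rules(12)[OF cr] m)+
    then show "\<zero>\<^bsub>sect (Spec R) U\<^esub> \<oplus>\<^bsub>sect (Spec R) U\<^esub> s = s"
      "\<one>\<^bsub>sect (Spec R) U\<^esub> \<otimes>\<^bsub>sect (Spec R) U\<^esub> s = s" by (simp_all only: ext)
    show "\<exists>t\<in>carrier (sect (Spec R) U). t \<oplus>\<^bsub>sect (Spec R) U\<^esub> s = \<zero>\<^bsub>sect (Spec R) U\<^esub>"
      using ops(3)[of s s] s by (simp only: Spec_simps(2))
  qed (simp_all only: Spec_simps(2) cst)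
qed

lemma spec_sections_restrict:
  assumes U: "openin (zariski R) U" "openin (zariski R) V" "V \<subseteq> U" and s: "s \<in> spec_sections R U"
  shows "restrict s V \<in> spec_sections R V"
proof (rule spec_sectionsI)
  fix p assume p: "p \<in> V"
  show "primeideal p R" by (rule openin_zariski_prime[OF U(2) p])
  obtain a f where af: "has_local_fraction R U s p a f" using s p U(3) by (blast intro: spec_sections_local)
  obtain g where g: "g \<in> carrier R" "p \<in> basic_open R g" "basic_open R g \<subseteq> V"
    using openin_zariski_basic[OF U(2) p] .
  have "basic_open R (f \<otimes> g) \<subseteq> V" "\<And>q. q \<in> basic_open R (f \<otimes> g) \<Longrightarrow> q \<in> V"
    using af g basic_open_mult[of f R g] by (auto simp: has_local_fraction_def)
  then have "has_local_fraction R V (restrict s V) p (a \<otimes> g) (f \<otimes> g)"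
    using has_local_fraction_mult[OF af g(1,2)] unfolding has_local_fraction_def by simp
  then show "\<exists>a f. has_local_fraction R V (restrict s V) p a f" by blast
qed simp

lemma ringed_space_Spec: "ringed_space (Spec R)"
proof (rule ringed_space.intro)
  fix U assume "openin (topol (Spec R)) U"
  then show "cring (sect (Spec R) U)" by (simp add: Spec_sect_cring)
next
  fix U V assume U: "openin (topol (Spec R)) U" "openin (topol (Spec R)) V" "V \<subseteq> U"
  show "restr (Spec R) U V \<in> ring_hom (sect (Spec R) U) (sect (Spec R) V)"
  proof (rule ring_hom_memI)
    show "restr (Spec R) U V s \<in> carrier (sect (Spec R) V)" if "s \<in> carrier (sect (Spec R) U)" for s
      using that U spec_sections_restrict by simp
  qed (use U(3) in \<open>auto simp: Int_absorb1 intro!: restrict_ext\<close>)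
next
  fix U s assume "s \<in> carrier (sect (Spec R) U)"
  then show "restr (Spec R) U U s = s" by (simp add: extensional_restrict[OF spec_sections_memD(1)])
next
  fix U V W :: "'a set set" and s assume "W \<subseteq> V" "V \<subseteq> U"
  then show "restr (Spec R) V W (restr (Spec R) U V s) = restr (Spec R) U W s"
    by (simp add: Int_absorb1)
next
  fix \<U> :: "'a set set set" and s t
  assume st: "s \<in> carrier (sect (Spec R) (\<Union>\<U>))" "t \<in> carrier (sect (Spec R) (\<Union>\<U>))"
    and eq: "\<And>V. V \<in> \<U> \<Longrightarrow> restr (Spec R) (\<Union>\<U>) V s = restr (Spec R) (\<Union>\<U>) V t"
  show "s = t"
  proof (rule spec_sections_eqI)
    fix p assume "p \<in> \<Union>\<U>"
    then obtain V where V: "V \<in> \<U>" "p \<in> V" by auto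
    then show "s p = t p" using fun_cong[OF eq[OF V(1)], of p] by simp
  qed (use st in simp_all)
next
  fix \<U> :: "'a set set set" and \<sigma>
  assume op: "\<And>V. V \<in> \<U> \<Longrightarrow> openin (topol (Spec R)) V"
    and \<sigma>: "\<And>V. V \<in> \<U> \<Longrightarrow> \<sigma> V \<in> carrier (sect (Spec R) V)"
    and comp: "\<And>V W. \<lbrakk>V \<in> \<U>; W \<in> \<U>\<rbrakk>
      \<Longrightarrow> restr (Spec R) V (V \<inter> W) (\<sigma> V) = restr (Spec R) W (V \<inter> W) (\<sigma> W)"
  have agree: "\<sigma> V p = \<sigma> W p" if "V \<in> \<U>" "W \<in> \<U>" "p \<in> V" "p \<in> W" for V W p
    using fun_cong[OF comp[OF that(1,2)], of p] that(3,4) by simp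
  \<comment> \<open>Sections are functions of the point, so they are glued pointwise. By
    \<open>agree\<close> the choice of V does not affect the value.\<close>
  define s where "s = (\<lambda>p\<in>\<Union>\<U>. \<sigma> (SOME V. V \<in> \<U> \<and> p \<in> V) p)"
  have s_eq: "s p = \<sigma> V p" if "V \<in> \<U>" "p \<in> V" for V p
  proof -
    have ex: "V \<in> \<U> \<and> p \<in> V" using that by simp
    have "p \<in> \<Union>\<U>" using that by auto
    then show ?thesis unfolding s_def using agree[OF _ that(1) _ that(2)] someI[of "\<lambda>V. V \<in> \<U> \<and> p \<in> V", OF ex]
      by simp
  qed
  show "\<exists>s\<in>carrier (sect (Spec R) (\<Union>\<U>)). \<forall>V\<in>\<U>. restr (Spec R) (\<Union>\<U>) V s = \<sigma> V"
  proof
    show "s \<in> carrier (sect (Spec R) (\<Union>\<U>))"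
      unfolding Spec_simps
    proof (rule spec_sectionsI)
      fix p assume "p \<in> \<Union>\<U>"
      then obtain V where V: "V \<in> \<U>" "p \<in> V" by auto
      show "primeideal p R" using openin_zariski_prime[of R V p] op[OF V(1)] V(2) by simp
      have "\<sigma> V \<in> spec_sections R V" using \<sigma>[OF V(1)] by simp
      then obtain a f where "has_local_fraction R V (\<sigma> V) p a f" using V(2) by (rule spec_sections_local)
      then have "has_local_fraction R (\<Union>\<U>) s p a f"
        unfolding has_local_fraction_def using s_eq[OF V(1)] V(1) by (auto simp: subset_iff)
      then show "\<exists>a f. has_local_fraction R (\<Union>\<U>) s p a f" by blast
    qed (simp add: s_def)
    show "\<forall>V\<in>\<U>. restr (Spec R) (\<Union>\<U>) V s = \<sigma> V"
    proof
      fix V assume V: "V \<in> \<U>"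
      have "restrict s V = restrict (\<sigma> V) V" using s_eq[OF V] by (intro restrict_ext)
      also have "\<dots> = \<sigma> V" using \<sigma>[OF V] by (intro extensional_restrict spec_sections_memD(1)) simp
      finally show "restr (Spec R) (\<Union>\<U>) V s = \<sigma> V" by simp
    qed
  qed
qed

end


section \<open>Units and locality of the stalks of the structure sheaf\<close>

lemma loc_at_Units_add:
  assumes p: "primeideal p R"
    and x: "x \<in> carrier (loc_at R p)" "x \<notin> Units (loc_at R p)"
    and y: "y \<in> carrier (loc_at R p)" "y \<notin> Units (loc_at R p)"
  shows "x \<oplus>\<^bsub>loc_at R p\<^esub> y \<notin> Units (loc_at R p)"
proof -
  interpret p: primeideal p R by (rule p)
  interpret L: localized_cring R "carrier R - p" by (rule p.localized_cring_compl)
  obtain a b s where m: "a \<in> carrier R" "b \<in> carrier R" "s \<in> carrier R - p"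
    "x = frac_at R p a s" "y = frac_at R p b s"
    using x(1) y(1) by (rule L.common_denom2)
  have "a \<in> p" "b \<in> p" using x(2) y(2) m p.frac_in_Units_iff by simp_all
  then have "a \<oplus>\<^bsub>R\<^esub> b \<in> p" by simp
  then show ?thesis
    using m p.frac_in_Units_iff[of "a \<oplus>\<^bsub>R\<^esub> b" s] L.frac_add_same[OF m(1-3)] by simp
qed

lemma loc_at_zero_not_Unit:
  assumes p: "primeideal p R"
  shows "\<zero>\<^bsub>loc_at R p\<^esub> \<notin> Units (loc_at R p)"
proof -
  interpret p: primeideal p R by (rule p)
  interpret L: localized_cring R "carrier R - p" by (rule p.localized_cring_compl)
  show ?thesis
    using p.frac_in_Units_iff[OF _ L.S.one_closed, of "\<zero>\<^bsub>R\<^esub>"] L.localization_zero[OF L.S.one_closed] by simp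
qed

context cring
begin

interpretation Spec: ringed_space "Spec R" by (rule ringed_space_Spec)

lemma Spec_presections_iff:
  "(U, s) \<in> presections (Spec R) p \<longleftrightarrow> openin (zariski R) U \<and> p \<in> U \<and> s \<in> spec_sections R U"
  by (simp add: Spec.presections_iff)

lemma Spec_germ_eqD:
  assumes "(U, s) \<in> presections (Spec R) p" "(V, t) \<in> presections (Spec R) p"
    "germ (Spec R) p U s = germ (Spec R) p V t"
  shows "s p = t p"
proof -
  obtain W where W: "p \<in> W" "restrict s W = restrict t W"
    using Spec.germ_eq_iff[OF assms(1,2)] assms(3) by auto
  have "restrict s W p = restrict t W p" by (simp only: W(2))
  then show ?thesis using W(1) by simp
qed

text \<open>This takes the place of the isomorphism between the stalk at p and the local ring:
  locality concerns units only, and evaluation at p detects them. An inverse germ evaluates to an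
  inverse at p.\<close>

lemma Spec_germ_in_Units_iff:
  assumes s: "(U, s) \<in> presections (Spec R) p"
  shows "germ (Spec R) p U s \<in> Units (stalk (Spec R) p) \<longleftrightarrow> s p \<in> Units (loc_at R p)"
proof
  have U: "openin (zariski R) U" "p \<in> U" "s \<in> spec_sections R U" using s by (auto simp: Spec_presections_iff)
  have p: "primeideal p R" by (rule openin_zariski_prime[OF U(1,2)])
  interpret p: primeideal p R by (rule p)
  interpret L: localized_cring R "carrier R - p" by (rule p.localized_cring_compl)
  interpret LR: cring "loc_at R p" by (rule L.localization_cring)
  interpret st: cring "stalk (Spec R) p"
    by (rule Spec.stalk_cring) (simp add: topspace_zariski p)
  {
    assume "germ (Spec R) p U s \<in> Units (stalk (Spec R) p)"
    then obtain T where T: "T \<in> carrier (stalk (Spec R) p)"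
      "germ (Spec R) p U s \<otimes>\<^bsub>stalk (Spec R) p\<^esub> T = \<one>\<^bsub>stalk (Spec R) p\<^esub>"
      using st.Units_r_inv_ex by auto
    obtain W r t where W: "(W, r) \<in> presections (Spec R) p" "(W, t) \<in> presections (Spec R) p"
      "germ (Spec R) p U s = germ (Spec R) p W r" "T = germ (Spec R) p W t"
      using Spec.germ_closed[OF s] T(1) by (rule Spec.stalkE2)
    have W': "openin (zariski R) W" "p \<in> W" "r \<in> spec_sections R W" "t \<in> spec_sections R W"
      using W(1,2) by (auto simp: Spec_presections_iff)
    have rt: "(W, r \<otimes>\<^bsub>sect (Spec R) W\<^esub> t) \<in> presections (Spec R) p"
      using W' spec_sections_ops(2)[OF W'(1,3,4)] by (simp only: Spec_presections_iff)
    have one: "(W, \<one>\<^bsub>sect (Spec R) W\<^esub>) \<in> presections (Spec R) p"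
      using W' by (intro Spec.presections_one) simp_all
    have "germ (Spec R) p W (r \<otimes>\<^bsub>sect (Spec R) W\<^esub> t) = germ (Spec R) p W \<one>\<^bsub>sect (Spec R) W\<^esub>"
      using T(2) W Spec.stalk_mult[OF W(1,2)] Spec.stalk_one[of W p] W' by (simp del: Spec_simps(3-7))
    then have "(r \<otimes>\<^bsub>sect (Spec R) W\<^esub> t) p = \<one>\<^bsub>sect (Spec R) W\<^esub> p"
      by (rule Spec_germ_eqD[OF rt one])
    then have *: "r p \<otimes>\<^bsub>loc_at R p\<^esub> t p = \<one>\<^bsub>loc_at R p\<^esub>" using W'(2) by simp
    have m: "r p \<in> carrier (loc_at R p)" "t p \<in> carrier (loc_at R p)"
      using W' spec_sections_memD(2) by auto
    have "s p = r p" by (rule Spec_germ_eqD[OF s W(1,3)])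
    then show "s p \<in> Units (loc_at R p)"
      using LR.Units_I[OF m *] by simp
  next
    assume u: "s p \<in> Units (loc_at R p)"
    obtain a f where af: "has_local_fraction R U s p a f" using U(3,2) by (rule spec_sections_local)
    note m = has_local_fractionD(1-4)[OF af] and s_eq = has_local_fractionD(5)[OF af]
    have "a \<notin> p" using u s_eq[OF m(3)] p.frac_in_Units_iff[OF m(1) basic_openD[OF m(3,2)]] by simp
    then have pa: "p \<in> basic_open R a" using p by (simp add: basic_open_def)
    \<comment> \<open>Both a and f are invertible on this set, so f / a is a section there and
      inverts s = a / f.\<close>
    let ?W = "basic_open R (a \<otimes> f)"
    have W_eq: "?W = basic_open R a \<inter> basic_open R f" by (rule basic_open_mult[OF m(1,2)])
    have W: "openin (zariski R) ?W" "p \<in> ?W" "?W \<subseteq> U"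
      using openin_basic_open[of "a \<otimes> f" R] m pa W_eq by auto
    have "?W \<subseteq> basic_open R a" using W_eq by auto
    note t = spec_sections_fraction[OF W(1) m(2,1) this]
    let ?t = "\<lambda>q\<in>?W. frac_at R q f a"
    let ?s = "restrict s ?W"
    have s': "?s \<in> spec_sections R ?W" by (rule spec_sections_restrict[OF U(1) W(1,3) U(3)])
    have pr: "(?W, ?s) \<in> presections (Spec R) p" "(?W, ?t) \<in> presections (Spec R) p"
      using s' t W by (simp_all only: Spec_presections_iff)
    have "?s \<otimes>\<^bsub>sect (Spec R) ?W\<^esub> ?t = \<one>\<^bsub>sect (Spec R) ?W\<^esub>"
      unfolding Spec_simps
    proof (rule restrict_ext)
      fix q assume q: "q \<in> ?W"
      then have q': "q \<in> basic_open R a" "q \<in> basic_open R f" using W_eq by auto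
      interpret Lq: localized_cring R "carrier R - q"
        by (rule primeideal.localized_cring_compl[OF basic_open_prime[OF q]])
      note d = basic_openD[OF q'(1) m(1)] basic_openD[OF q'(2) m(2)]
      have "s q \<otimes>\<^bsub>loc_at R q\<^esub> frac_at R q f a = frac_at R q (a \<otimes> f) (f \<otimes> a)"
        unfolding s_eq[OF q'(2)] by (rule Lq.frac_mult[OF m(1) d(2) m(2) d(1)])
      also have "\<dots> = \<one>\<^bsub>loc_at R q\<^esub>"
        unfolding m_comm[OF m(2,1)] by (rule Lq.localization_one[OF Lq.S.m_closed[OF d], symmetric])
      finally have "s q \<otimes>\<^bsub>loc_at R q\<^esub> frac_at R q f a = \<one>\<^bsub>loc_at R q\<^esub>" .
      then show "?s q \<otimes>\<^bsub>loc_at R q\<^esub> ?t q = \<one>\<^bsub>loc_at R q\<^esub>" using q by simp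
    qed
    then have "germ (Spec R) p ?W ?s \<otimes>\<^bsub>stalk (Spec R) p\<^esub> germ (Spec R) p ?W ?t = \<one>\<^bsub>stalk (Spec R) p\<^esub>"
      using Spec.stalk_mult[OF pr] Spec.stalk_one[of ?W p] W by (simp del: Spec_simps(3-7))
    moreover have "germ (Spec R) p ?W ?s = germ (Spec R) p U s"
      using Spec.germ_restr[OF s, of ?W] W by simp
    ultimately have "germ (Spec R) p U s \<otimes>\<^bsub>stalk (Spec R) p\<^esub> germ (Spec R) p ?W ?t = \<one>\<^bsub>stalk (Spec R) p\<^esub>"
      by simp
    then show "germ (Spec R) p U s \<in> Units (stalk (Spec R) p)"
      by (rule st.Units_I[OF Spec.germ_closed[OF s] Spec.germ_closed[OF pr(2)]])
  }
qed

lemma Spec_stalk_cring: "primeideal p R \<Longrightarrow> cring (stalk (Spec R) p)"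
  by (rule Spec.stalk_cring) (simp add: topspace_zariski)

lemma Spec_stalk_nonunits:
  assumes p: "primeideal p R"
  shows "ideal (carrier (stalk (Spec R) p) - Units (stalk (Spec R) p)) (stalk (Spec R) p)"
proof (rule cring.nonunits_ideal[OF Spec_stalk_cring[OF p]])
  let ?T = "topspace (zariski R)"
  have T: "openin (zariski R) ?T" "p \<in> ?T"
    using p openin_topspace[of "zariski R"] by (simp_all add: topspace_zariski)
  then have "(?T, \<zero>\<^bsub>sect (Spec R) ?T\<^esub>) \<in> presections (Spec R) p"
    by (intro Spec.presections_zero) simp_all
  from Spec_germ_in_Units_iff[OF this] show "\<zero>\<^bsub>stalk (Spec R) p\<^esub> \<notin> Units (stalk (Spec R) p)"
    using Spec.stalk_zero[of ?T p] T loc_at_zero_not_Unit[OF p] by simp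
next
  fix S T
  assume S: "S \<in> carrier (stalk (Spec R) p) - Units (stalk (Spec R) p)"
    and T: "T \<in> carrier (stalk (Spec R) p) - Units (stalk (Spec R) p)"
  obtain U s t where U: "(U, s) \<in> presections (Spec R) p" "(U, t) \<in> presections (Spec R) p"
    "S = germ (Spec R) p U s" "T = germ (Spec R) p U t"
    using S T by (blast intro: Spec.stalkE2)
  have U': "openin (zariski R) U" "p \<in> U" "s \<in> spec_sections R U" "t \<in> spec_sections R U"
    using U(1,2) by (auto simp: Spec_presections_iff)
  have st: "(U, s \<oplus>\<^bsub>sect (Spec R) U\<^esub> t) \<in> presections (Spec R) p"
    using U' spec_sections_ops(1)[OF U'(1,3,4)] by (simp only: Spec_presections_iff)
  have "s p \<notin> Units (loc_at R p)" "t p \<notin> Units (loc_at R p)"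
    using S T U Spec_germ_in_Units_iff by simp_all
  then have "s p \<oplus>\<^bsub>loc_at R p\<^esub> t p \<notin> Units (loc_at R p)"
    using loc_at_Units_add[OF p] U' spec_sections_memD(2) by blast
  then show "S \<oplus>\<^bsub>stalk (Spec R) p\<^esub> T \<notin> Units (stalk (Spec R) p)"
    using Spec.stalk_add[OF U(1,2)] Spec_germ_in_Units_iff[OF st] U(3,4) U'(2) by simp
qed

lemma locally_ringed_space_Spec: "locally_ringed_space (Spec R)"
proof (intro locally_ringed_space.intro ringed_space_Spec locally_ringed_space_axioms.intro)
  fix p assume "p \<in> topspace (topol (Spec R))"
  then have p: "primeideal p R" by (simp add: topspace_zariski)
  show "local_ring (stalk (Spec R) p)"
    by (rule cring.local_ringI[OF Spec_stalk_cring[OF p] Spec_stalk_nonunits[OF p]])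
qed

end


section \<open>Morphisms of spectra\<close>

lemma Spec_map_simps [simp]:
  "pmap (Spec_map R S h) = contraction R h"
  "comorph (Spec_map R S h) V t = (\<lambda>q\<in>{q. primeideal q S \<and> contraction R h q \<in> V}.
       loc_map S h q (t (contraction R h q)))"
  "preim (Spec S) (Spec_map R S h) V = {q. primeideal q S \<and> contraction R h q \<in> V}"
  by (simp_all add: Spec_map_def preim_def topspace_zariski)

context
  fixes R :: "('a, 'm) ring_scheme" and S :: "('b, 'n) ring_scheme" and h
  assumes R: "cring R" and S: "cring S" and h: "h \<in> ring_hom R S"
begin

interpretation R: cring R by (rule R)
interpretation S: cring S by (rule S)

lemma contraction_prime: "primeideal q S \<Longrightarrow> primeideal (contraction R h q) R"
  by (rule contraction_primeideal[OF R h])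

lemma contraction_preimage_open:
  assumes "openin (zariski R) V"
  shows "openin (zariski S) {q. primeideal q S \<and> contraction R h q \<in> V}"
proof -
  obtain E where E: "E \<subseteq> carrier R" "V = {p. primeideal p R \<and> \<not> E \<subseteq> p}"
    using assms unfolding openin_zariski by auto
  have "{q. primeideal q S \<and> contraction R h q \<in> V} = {q. primeideal q S \<and> \<not> h ` E \<subseteq> q}"
    using E contraction_prime by (auto simp: contraction_def)
  moreover have "h ` E \<subseteq> carrier S" using E(1) ring_hom_closed[OF h] by auto
  ultimately show ?thesis unfolding openin_zariski by auto
qed

lemma basic_open_contraction:
  "f \<in> carrier R \<Longrightarrow> primeideal q S \<Longrightarrow> contraction R h q \<in> basic_open R f \<longleftrightarrow> q \<in> basic_open S (h f)"
  using contraction_prime by (auto simp: basic_open_def contraction_def)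

lemma Spec_map_section:
  assumes V: "openin (zariski R) V" and t: "t \<in> spec_sections R V"
  shows "comorph (Spec_map R S h) V t \<in> spec_sections S (preim (Spec S) (Spec_map R S h) V)"
  unfolding Spec_map_simps
proof (rule spec_sectionsI)
  let ?U = "{q. primeideal q S \<and> contraction R h q \<in> V}"
  let ?t = "\<lambda>q\<in>?U. loc_map S h q (t (contraction R h q))"
  fix q assume q: "q \<in> ?U"
  then show q': "primeideal q S" by simp
  obtain a f where af: "has_local_fraction R V t (contraction R h q) a f"
    using t q by (blast intro: spec_sections_local)
  note m = has_local_fractionD(1-4)[OF af] and t_eq = has_local_fractionD(5)[OF af]
  have sub: "basic_open S (h f) \<subseteq> ?U"
  proof
    fix r assume r: "r \<in> basic_open S (h f)"
    then have "contraction R h r \<in> basic_open R f"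
      using basic_open_contraction[OF m(2) basic_open_prime[OF r]] by simp
    then show "r \<in> ?U" using m(4) basic_open_prime[OF r] by auto
  qed
  have "?t r = frac_at S r (h a) (h f)" if r: "r \<in> basic_open S (h f)" for r
  proof -
    have r': "primeideal r S" by (rule basic_open_prime[OF r])
    then have c: "contraction R h r \<in> basic_open R f" using basic_open_contraction[OF m(2)] r by simp
    have "?t r = loc_map S h r (t (contraction R h r))" using r sub by auto
    also have "\<dots> = frac_at S r (h a) (h f)"
      unfolding t_eq[OF c] by (rule loc_map_frac[OF R h r' m(1) basic_openD[OF c m(2)]])
    finally show ?thesis .
  qed
  then have "has_local_fraction S ?U ?t q (h a) (h f)"
    using m sub basic_open_contraction[OF m(2) q'] ring_hom_closed[OF h]
    unfolding has_local_fraction_def by simp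
  then show "\<exists>a f. has_local_fraction S ?U ?t q a f" by blast
qed simp

lemma rs_morphism_Spec_map: "rs_morphism (Spec S) (Spec R) (Spec_map R S h)"
proof (intro rs_morphism.intro rs_morphism_axioms.intro R.ringed_space_Spec S.ringed_space_Spec)
  show "continuous_map (topol (Spec S)) (topol (Spec R)) (pmap (Spec_map R S h))"
    using contraction_preimage_open contraction_prime
    by (simp add: continuous_map_def topspace_zariski Pi_iff)
next
  fix V assume V: "openin (topol (Spec R)) V"
  let ?U = "preim (Spec S) (Spec_map R S h) V"
  have V': "openin (zariski R) V" using V by simp
  have lh: "loc_map S h q \<in> ring_hom (loc_at R (contraction R h q)) (loc_at S q)" if "q \<in> ?U" for q
    using loc_map_ring_hom[OF R h] that by simp
  show "comorph (Spec_map R S h) V \<in> ring_hom (sect (Spec R) V) (sect (Spec S) ?U)"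
  proof (rule ring_hom_memI)
    fix t assume "t \<in> carrier (sect (Spec R) V)"
    then show "comorph (Spec_map R S h) V t \<in> carrier (sect (Spec S) ?U)"
      using Spec_map_section[OF V', of t] by (simp only: Spec_simps(2))
  next
    fix s t assume "s \<in> carrier (sect (Spec R) V)" "t \<in> carrier (sect (Spec R) V)"
    then have m: "s p \<in> carrier (loc_at R p)" "t p \<in> carrier (loc_at R p)" if "p \<in> V" for p
      using spec_sections_memD(2) that by auto
    show "comorph (Spec_map R S h) V (s \<otimes>\<^bsub>sect (Spec R) V\<^esub> t)
        = comorph (Spec_map R S h) V s \<otimes>\<^bsub>sect (Spec S) ?U\<^esub> comorph (Spec_map R S h) V t"
      using ring_hom_mult[OF lh] m by (auto intro!: restrict_ext)
    show "comorph (Spec_map R S h) V (s \<oplus>\<^bsub>sect (Spec R) V\<^esub> t)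
        = comorph (Spec_map R S h) V s \<oplus>\<^bsub>sect (Spec S) ?U\<^esub> comorph (Spec_map R S h) V t"
      using ring_hom_add[OF lh] m by (auto intro!: restrict_ext)
  next
    show "comorph (Spec_map R S h) V \<one>\<^bsub>sect (Spec R) V\<^esub> = \<one>\<^bsub>sect (Spec S) ?U\<^esub>"
      using ring_hom_one[OF lh] by (auto intro!: restrict_ext)
  qed
next
  fix V W :: "'a set set" and t assume "W \<subseteq> V"
  then show "comorph (Spec_map R S h) W (restr (Spec R) V W t)
    = restr (Spec S) (preim (Spec S) (Spec_map R S h) V) (preim (Spec S) (Spec_map R S h) W)
        (comorph (Spec_map R S h) V t)"
    by (auto simp: restrict_def fun_eq_iff)
qed

text \<open>Locality on stalks: where t has the value a / s, its pullback has the value h a / h s at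
  q. This is a unit exactly if h a is outside q, that is, if a is outside the contraction of
  q.\<close>

lemma lrs_morphism_Spec_map: "lrs_morphism (Spec S) (Spec R) (Spec_map R S h)"
proof -
  interpret m: rs_morphism "Spec S" "Spec R" "Spec_map R S h" by (rule rs_morphism_Spec_map)
  have "local_hom (stalk (Spec R) (contraction R h q)) (stalk (Spec S) q) (stalk_map (Spec S) (Spec_map R S h) q)"
    if q: "primeideal q S" for q
  proof -
    let ?p = "contraction R h q"
    have p: "primeideal ?p R" by (rule contraction_prime[OF q])
    interpret p: primeideal ?p R by (rule p)
    interpret q: primeideal q S by (rule q)
    interpret L: localized_cring R "carrier R - ?p" by (rule p.localized_cring_compl)
    have qT: "q \<in> topspace (topol (Spec S))" using q by (simp add: topspace_zariski)
    have hom: "stalk_map (Spec S) (Spec_map R S h) q \<in> ring_hom (stalk (Spec R) ?p) (stalk (Spec S) q)"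
      using m.stalk_map_hom[OF qT] by simp
    show ?thesis
    proof (rule local_homI[OF R.Spec_stalk_cring[OF p] S.Spec_stalk_cring[OF q] hom
          R.Spec_stalk_nonunits[OF p] S.Spec_stalk_nonunits[OF q]])
      fix T assume "T \<in> carrier (stalk (Spec R) ?p)"
        and u: "stalk_map (Spec S) (Spec_map R S h) q T \<in> Units (stalk (Spec S) q)"
      then obtain V t where V: "(V, t) \<in> presections (Spec R) ?p" "T = germ (Spec R) ?p V t"
        by (blast intro: ringed_space.stalkE[OF R.ringed_space_Spec])
      then have V': "?p \<in> V" "t \<in> spec_sections R V" by (simp_all add: R.Spec_presections_iff)
      have pr: "(V, t) \<in> presections (Spec R) (pmap (Spec_map R S h) q)" using V(1) by simp
      note smg = m.stalk_map_germ[OF qT pr, unfolded Spec_map_simps(1)]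
      have "comorph (Spec_map R S h) V t q \<in> Units (loc_at S q)"
        using u S.Spec_germ_in_Units_iff[OF m.presections_comorph[OF qT pr]] unfolding V(2) smg by blast
      then have u': "loc_map S h q (t ?p) \<in> Units (loc_at S q)" using q V'(1) by simp
      obtain a s where a: "a \<in> carrier R" "s \<in> carrier R - ?p" "t ?p = frac_at R ?p a s"
        using spec_sections_memD(2)[OF V'(2,1)] by (rule L.localizationE)
      have "h a \<notin> q"
        using u' q.frac_in_Units_iff[OF ring_hom_closed[OF h a(1)] contraction_compl[OF h a(2)]]
        unfolding a(3) loc_map_frac[OF R h q a(1,2)] by blast
      then have "a \<notin> ?p" unfolding contraction_def by blast
      then have "t ?p \<in> Units (loc_at R ?p)" unfolding a(3) p.frac_in_Units_iff[OF a(1,2)] .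
      then show "T \<in> Units (stalk (Spec R) ?p)" unfolding V(2) R.Spec_germ_in_Units_iff[OF V(1)] .
    qed
  qed
  then have loc: "local_hom (stalk (Spec R) (pmap (Spec_map R S h) q)) (stalk (Spec S) q)
      (stalk_map (Spec S) (Spec_map R S h) q)" if "q \<in> topspace (topol (Spec S))" for q
    using that by (simp add: topspace_zariski)
  show ?thesis
    by (rule lrs_morphism.intro[OF S.locally_ringed_space_Spec R.locally_ringed_space_Spec
          lrs_morphism_axioms.intro[OF m.continuous m.comorph_hom m.comorph_restr loc]])
qed

end


section \<open>Graded rings and the coaction\<close>

context graded_cring
begin

abbreviation (input) degree_zero_part ("\<B>") where "\<B> \<equiv> \<A> \<one>\<^bsub>D\<^esub>"
abbreviation (input) A0 where "A0 \<equiv> degree_zero_ring A D \<A>"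
abbreviation (input) AD where "AD \<equiv> group_ring A D"
abbreviation (input) coact where "coact \<equiv> coaction A D \<A>"
abbreviation (input) const where "const \<equiv> (\<lambda>a. gmonom A D a \<one>\<^bsub>D\<^esub>)"

lemma A_cring: "cring A" by (rule is_cring)

lemma D_comm_group: "comm_group D" by (rule D.comm_group_axioms)

sublocale AD: cring "group_ring A D"
  by (rule group_ring_cring[OF A_cring D_comm_group])

lemmas group_ring_memD' = group_ring_memD[OF A_cring D_comm_group]
lemmas gmonom_closed' = gmonom_closed[OF A_cring D_comm_group]
lemmas gmonom_mult_gmonom' = gmonom_mult_gmonom[OF A_cring D_comm_group]
lemmas const_hom = const_ring_hom[OF A_cring D_comm_group]

lemma graded_closed: "\<lbrakk>d \<in> carrier D; a \<in> \<A> d\<rbrakk> \<Longrightarrow> a \<in> carrier A"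
  using additive_subgroup.a_subset[OF additive] by auto

text \<open>On A[D] this is the augmentation, which sends T^d to 1. On the families x with every x_d
  in A_d it is the inverse of the coaction.\<close>

definition coeff_sum :: "('d \<Rightarrow> 'a) \<Rightarrow> 'a" where
  "coeff_sum x = (\<Oplus>d\<in>supp A D x. x d)"

lemma coeff_sum_on:
  assumes x: "x \<in> carrier AD" and F: "finite F" "supp A D x \<subseteq> F" "F \<subseteq> carrier D"
  shows "coeff_sum x = (\<Oplus>d\<in>F. x d)"
  unfolding coeff_sum_def using F group_ring_memD'[OF x]
  by (intro add.finprod_mono_neutral_cong_left) (auto simp: subset_iff)

lemma coeff_sum_add:
  assumes x: "x \<in> carrier AD" and y: "y \<in> carrier AD"
  shows "coeff_sum (x \<oplus>\<^bsub>AD\<^esub> y) = coeff_sum x \<oplus> coeff_sum y"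
proof -
  let ?F = "supp A D x \<union> supp A D y"
  note X = group_ring_memD'[OF x] and Y = group_ring_memD'[OF y]
  have F: "finite ?F" "?F \<subseteq> carrier D" using X(3,4) Y(3,4) by auto
  have sub: "supp A D (x \<oplus>\<^bsub>AD\<^esub> y) \<subseteq> ?F"
    by (auto simp: supp_def group_ring_add_app[OF A_cring D_comm_group])
  have FD: "d \<in> carrier D" if "d \<in> ?F" for d using that F(2) by blast
  have "coeff_sum (x \<oplus>\<^bsub>AD\<^esub> y) = (\<Oplus>d\<in>?F. (x \<oplus>\<^bsub>AD\<^esub> y) d)"
    using x y F sub by (intro coeff_sum_on) auto
  also have "\<dots> = (\<Oplus>d\<in>?F. x d \<oplus> y d)"
    using X(1) Y(1) FD by (intro finsum_cong') (auto simp: group_ring_add_app[OF A_cring D_comm_group])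
  also have "\<dots> = (\<Oplus>d\<in>?F. x d) \<oplus> (\<Oplus>d\<in>?F. y d)"
    using X(1) Y(1) FD by (intro finsum_addf) auto
  also have "\<dots> = coeff_sum x \<oplus> coeff_sum y"
    using coeff_sum_on[OF x F(1) _ F(2)] coeff_sum_on[OF y F(1) _ F(2)] by simp
  finally show ?thesis .
qed

lemma decomposition_components:
  "a \<in> carrier A \<Longrightarrow> decomposition A D \<A> a (components A D \<A> a)"
  unfolding components_def by (rule theI'[OF direct_sum])

lemma coact_closed: "a \<in> carrier A \<Longrightarrow> coact a \<in> carrier AD"
  using decomposition_components[of a] graded_closed
  by (auto simp: decomposition_def coaction_def group_ring_def PiE_def Pi_def)

lemma coact_graded: "\<lbrakk>a \<in> carrier A; d \<in> carrier D\<rbrakk> \<Longrightarrow> coact a d \<in> \<A> d"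
  using decomposition_components[of a] by (auto simp: decomposition_def coaction_def)

lemma coact_in_carrier: "\<lbrakk>a \<in> carrier A; d \<in> carrier D\<rbrakk> \<Longrightarrow> coact a d \<in> carrier A"
  using coact_graded graded_closed by blast

lemma coeff_sum_coact: "a \<in> carrier A \<Longrightarrow> coeff_sum (coact a) = a"
  using decomposition_components[of a] by (simp add: decomposition_def coaction_def coeff_sum_def)

lemma coact_unique:
  assumes x: "x \<in> carrier AD" and "\<And>d. d \<in> carrier D \<Longrightarrow> x d \<in> \<A> d"
  shows "coact (coeff_sum x) = x"
proof -
  have c: "coeff_sum x \<in> carrier A"
    unfolding coeff_sum_def using group_ring_memD'[OF x] by (intro finsum_closed) (auto simp: subset_iff)
  have "decomposition A D \<A> (coeff_sum x) x"
    using assms group_ring_memD'(2,3)[OF x] unfolding decomposition_def coeff_sum_def PiE_def by auto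
  then show ?thesis unfolding coaction_def components_def using direct_sum[OF c] by (intro the1_equality)
qed

lemma coact_add:
  assumes "a \<in> carrier A" "b \<in> carrier A"
  shows "coact (a \<oplus> b) = coact a \<oplus>\<^bsub>AD\<^esub> coact b"
proof -
  have "coact (coeff_sum (coact a \<oplus>\<^bsub>AD\<^esub> coact b)) = coact a \<oplus>\<^bsub>AD\<^esub> coact b"
  proof (rule coact_unique)
    fix d assume d: "d \<in> carrier D"
    interpret additive_subgroup "\<A> d" A by (rule additive[OF d])
    show "(coact a \<oplus>\<^bsub>AD\<^esub> coact b) d \<in> \<A> d"
      using assms d by (simp add: group_ring_add_app[OF A_cring D_comm_group] coact_graded)
  qed (use assms coact_closed in simp)
  then show ?thesis using assms by (simp add: coeff_sum_add coact_closed coeff_sum_coact)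
qed

lemma gmonom_zero: "gmonom A D \<zero> d = \<zero>\<^bsub>AD\<^esub>"
  by (simp add: gmonom_def group_ring_def)

lemma coact_zero: "coact \<zero> = \<zero>\<^bsub>AD\<^esub>"
  using coaction_homogeneous[of "\<one>\<^bsub>D\<^esub>" \<zero>] additive_subgroup.zero_closed[OF additive, of "\<one>\<^bsub>D\<^esub>"]
  by (simp add: gmonom_zero)

lemma coact_finsum:
  assumes "finite F" "\<And>i. i \<in> F \<Longrightarrow> t i \<in> carrier A"
  shows "coact (\<Oplus>i\<in>F. t i) = (\<Oplus>\<^bsub>AD\<^esub>i\<in>F. coact (t i))"
  using assms
proof (induction F rule: finite_induct)
  case (insert i F)
  then show ?case by (simp add: coact_add coact_closed Pi_def finsum_closed)
qed (simp add: coact_zero)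

lemma supp_coact:
  assumes a: "a \<in> carrier A"
  shows "finite (supp A D (coact a))" "supp A D (coact a) \<subseteq> carrier D"
    "a = (\<Oplus>d\<in>supp A D (coact a). coact a d)"
  using group_ring_memD'(3,4)[OF coact_closed[OF a]] coeff_sum_coact[OF a] by (simp_all add: coeff_sum_def)

text \<open>Multiplication by a homogeneous element only shifts components: b is expanded into its
  components b_e, and each a b_e is homogeneous of degree d e. Expanding the first factor as well
  then gives multiplicativity of the coaction.\<close>

lemma coact_mult_homogeneous:
  assumes d: "d \<in> carrier D" and a: "a \<in> \<A> d" and b: "b \<in> carrier A"
  shows "coact (a \<otimes> b) = gmonom A D a d \<otimes>\<^bsub>AD\<^esub> coact b"
proof -
  let ?F = "supp A D (coact b)"
  note S = supp_coact[OF b]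
  have aA: "a \<in> carrier A" by (rule graded_closed[OF d a])
  have FD: "e \<in> carrier D" "coact b e \<in> carrier A" "coact b e \<in> \<A> e" if "e \<in> ?F" for e
  proof -
    show "e \<in> carrier D" using that S(2) by blast
    then show "coact b e \<in> carrier A" "coact b e \<in> \<A> e" using coact_graded[OF b] coact_in_carrier[OF b] by auto
  qed
  have "a \<otimes> b = a \<otimes> (\<Oplus>e\<in>?F. coact b e)" using S(3) by simp
  also have "\<dots> = (\<Oplus>e\<in>?F. a \<otimes> coact b e)"
    using S(1) FD aA by (intro finsum_rdistr) auto
  finally have "coact (a \<otimes> b) = (\<Oplus>\<^bsub>AD\<^esub>e\<in>?F. coact (a \<otimes> coact b e))"
    using coact_finsum[OF S(1), of "\<lambda>e. a \<otimes> coact b e"] FD aA by simp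
  also have "\<dots> = (\<Oplus>\<^bsub>AD\<^esub>e\<in>?F. gmonom A D a d \<otimes>\<^bsub>AD\<^esub> gmonom A D (coact b e) e)"
  proof (rule AD.finsum_cong')
    fix e assume e: "e \<in> ?F"
    have "coact (a \<otimes> coact b e) = gmonom A D (a \<otimes> coact b e) (d \<otimes>\<^bsub>D\<^esub> e)"
      using FD[OF e] d a graded_mult by (intro coaction_homogeneous) auto
    then show "coact (a \<otimes> coact b e) = gmonom A D a d \<otimes>\<^bsub>AD\<^esub> gmonom A D (coact b e) e"
      using FD[OF e] aA d by (simp add: gmonom_mult_gmonom')
  qed (use FD aA gmonom_closed' in auto)
  also have "\<dots> = gmonom A D a d \<otimes>\<^bsub>AD\<^esub> (\<Oplus>\<^bsub>AD\<^esub>e\<in>?F. gmonom A D (coact b e) e)"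
    using S(1) FD aA gmonom_closed' by (intro AD.finsum_rdistr[symmetric]) auto
  also have "(\<Oplus>\<^bsub>AD\<^esub>e\<in>?F. gmonom A D (coact b e) e) = coact b"
    by (rule group_ring_expand[OF A_cring D_comm_group coact_closed[OF b], symmetric])
  finally show ?thesis .
qed

lemma coact_mult:
  assumes a: "a \<in> carrier A" and b: "b \<in> carrier A"
  shows "coact (a \<otimes> b) = coact a \<otimes>\<^bsub>AD\<^esub> coact b"
proof -
  let ?F = "supp A D (coact a)"
  note S = supp_coact[OF a]
  have FD: "e \<in> carrier D" "coact a e \<in> carrier A" "coact a e \<in> \<A> e" if "e \<in> ?F" for e
  proof -
    show "e \<in> carrier D" using that S(2) by blast
    then show "coact a e \<in> carrier A" "coact a e \<in> \<A> e" using coact_graded[OF a] coact_in_carrier[OF a] by auto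
  qed
  have "a \<otimes> b = (\<Oplus>e\<in>?F. coact a e) \<otimes> b" using S(3) by simp
  also have "\<dots> = (\<Oplus>e\<in>?F. coact a e \<otimes> b)"
    using S(1) FD b by (intro finsum_ldistr) auto
  finally have "coact (a \<otimes> b) = (\<Oplus>\<^bsub>AD\<^esub>e\<in>?F. coact (coact a e \<otimes> b))"
    using coact_finsum[OF S(1), of "\<lambda>e. coact a e \<otimes> b"] FD b by simp
  also have "\<dots> = (\<Oplus>\<^bsub>AD\<^esub>e\<in>?F. gmonom A D (coact a e) e \<otimes>\<^bsub>AD\<^esub> coact b)"
    using FD b coact_mult_homogeneous gmonom_closed' coact_closed by (intro AD.finsum_cong') auto
  also have "\<dots> = (\<Oplus>\<^bsub>AD\<^esub>e\<in>?F. gmonom A D (coact a e) e) \<otimes>\<^bsub>AD\<^esub> coact b"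
    using S(1) FD b gmonom_closed' coact_closed by (intro AD.finsum_ldistr[symmetric]) auto
  also have "(\<Oplus>\<^bsub>AD\<^esub>e\<in>?F. gmonom A D (coact a e) e) = coact a"
    by (rule group_ring_expand[OF A_cring D_comm_group coact_closed[OF a], symmetric])
  finally show ?thesis .
qed

lemma coact_mult_homogeneous_app:
  assumes e: "e \<in> carrier D" and a: "a \<in> \<A> e" and b: "b \<in> carrier A" and d: "d \<in> carrier D"
  shows "coact (a \<otimes> b) d = a \<otimes> coact b (inv\<^bsub>D\<^esub> e \<otimes>\<^bsub>D\<^esub> d)"
  using coact_mult_homogeneous[OF e a b]
    gmonom_mult_app[OF A_cring D_comm_group coact_closed[OF b] graded_closed[OF e a] d e] by simp

lemma coact_homogeneous_app:
  "\<lbrakk>d \<in> carrier D; a \<in> \<A> d\<rbrakk> \<Longrightarrow> coact a d = a"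
  by (simp add: coaction_homogeneous gmonom_def)

text \<open>That 1 has degree zero is not among the axioms of \<open>graded_cring\<close>. Let e be
  the degree zero component of 1. Comparing components of degree d in a 1 = a shows a e = a for a
  homogeneous of degree d; applied to the components of 1 and summed up, this gives e = 1.\<close>

lemma one_degree_zero: "\<one> \<in> \<B>"
proof -
  let ?e = "coact \<one> \<one>\<^bsub>D\<^esub>"
  have e: "?e \<in> carrier A" by (rule coact_in_carrier) auto
  have fix_homog: "a \<otimes> ?e = a" if "d \<in> carrier D" "a \<in> \<A> d" for a d
    using coact_mult_homogeneous_app[OF that one_closed that(1)] that graded_closed[OF that]
    by (simp add: coact_homogeneous_app)
  let ?F = "supp A D (coact \<one>)"
  note S = supp_coact[OF one_closed]
  have FD: "d \<in> carrier D" "coact \<one> d \<in> \<A> d" "coact \<one> d \<in> carrier A" if "d \<in> ?F" for d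
  proof -
    show "d \<in> carrier D" using that S(2) by blast
    then show "coact \<one> d \<in> \<A> d" "coact \<one> d \<in> carrier A"
      using coact_graded coact_in_carrier one_closed by auto
  qed
  have "?e = \<one> \<otimes> ?e" using e by simp
  also have "\<dots> = (\<Oplus>d\<in>?F. coact \<one> d) \<otimes> ?e" using S(3) by simp
  also have "\<dots> = (\<Oplus>d\<in>?F. coact \<one> d \<otimes> ?e)"
    using S(1) FD e by (intro finsum_ldistr) auto
  also have "\<dots> = (\<Oplus>d\<in>?F. coact \<one> d)" using FD by (intro finsum_cong') (simp_all add: fix_homog[OF FD(1,2)])
  also have "\<dots> = \<one>" using S(3) by simp
  finally show ?thesis using coact_graded[of \<one> "\<one>\<^bsub>D\<^esub>"] by simp
qed

lemma degree_zero_closed: "a \<in> \<B> \<Longrightarrow> a \<in> carrier A"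
  by (rule graded_closed[of "\<one>\<^bsub>D\<^esub>"]) auto

lemma degree_zero_mult: "\<lbrakk>a \<in> \<B>; b \<in> \<B>\<rbrakk> \<Longrightarrow> a \<otimes> b \<in> \<B>"
  using graded_mult[of "\<one>\<^bsub>D\<^esub>" "\<one>\<^bsub>D\<^esub>" a b] by simp

lemma coact_degree_zero: "a \<in> \<B> \<Longrightarrow> coact a = const a"
  by (rule coaction_homogeneous) auto

lemma coact_mult_degree_zero:
  "\<lbrakk>a \<in> \<B>; b \<in> carrier A; d \<in> carrier D\<rbrakk> \<Longrightarrow> coact (a \<otimes> b) d = a \<otimes> coact b d"
  using coact_mult_homogeneous_app[of "\<one>\<^bsub>D\<^esub>" a b d] by simp

lemma coact_hom: "coact \<in> ring_hom A AD"
  by (rule ring_hom_memI)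
    (simp_all add: coact_closed coact_mult coact_add coact_degree_zero[OF one_degree_zero]
      group_ring_one[OF A_cring D_comm_group])

lemma degree_zero_subring: "subring (\<B>) A"
proof -
  interpret additive_subgroup "\<B>" A by (rule additive) simp
  show ?thesis
    using degree_zero_closed one_degree_zero degree_zero_mult by (intro subringI) auto
qed

lemma degree_zero_cring: "cring A0"
proof -
  interpret sub: subring "\<B>" A by (rule degree_zero_subring)
  show ?thesis using subcring_iff[OF sub.subset] subcringI'[OF degree_zero_subring] by simp
qed

sublocale A0: cring "degree_zero_ring A D \<A>"
  by (rule degree_zero_cring)

lemma degree_zero_inclusion_hom: "(\<lambda>a. a) \<in> ring_hom A0 A"
  by (rule ring_hom_memI) (simp_all add: degree_zero_closed)

end


section \<open>Points of the group ring and homogeneous ideals\<close>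

context graded_cring
begin

abbreviation (input) contr0 where "contr0 P \<equiv> contraction A0 (\<lambda>a. a) P"
abbreviation (input) act_pt where "act_pt q \<equiv> contraction A coact q"
abbreviation (input) proj_pt where "proj_pt q \<equiv> contraction A const q"

text \<open>For an ideal J this is J[D], the ideal that J generates in A[D], described by
  coefficients.\<close>

definition ext_ideal :: "'a set \<Rightarrow> ('d \<Rightarrow> 'a) set" where
  "ext_ideal J = {x \<in> carrier AD. \<forall>d\<in>carrier D. x d \<in> J}"

lemma ext_ideal_ideal:
  assumes J: "ideal J A"
  shows "ideal (ext_ideal J) AD"
proof -
  interpret J: ideal J A by (rule J)
  have mult: "y \<otimes>\<^bsub>AD\<^esub> x \<in> ext_ideal J" if x: "x \<in> ext_ideal J" and y: "y \<in> carrier AD" for x y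
  proof -
    have xc: "x \<in> carrier AD" and xJ: "\<And>d. d \<in> carrier D \<Longrightarrow> x d \<in> J"
      using x by (auto simp: ext_ideal_def)
    note Y = group_ring_memD'[OF y]
    have "(y \<otimes>\<^bsub>AD\<^esub> x) d \<in> J" if d: "d \<in> carrier D" for d
    proof -
      have "(\<Oplus>e\<in>supp A D y. y e \<otimes> x (inv\<^bsub>D\<^esub> e \<otimes>\<^bsub>D\<^esub> d)) \<in> J"
      proof (rule J.finsum_mem[OF Y(3)])
        fix e assume "e \<in> supp A D y"
        then have "e \<in> carrier D" using Y(4) by blast
        then show "y e \<otimes> x (inv\<^bsub>D\<^esub> e \<otimes>\<^bsub>D\<^esub> d) \<in> J"
          using d Y(1) by (intro J.I_l_closed xJ) auto
      qed
      then show ?thesis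
        using group_ring_mult_app[OF A_cring D_comm_group y xc d Y(3) order.refl Y(4)] Y(3,4) by simp
    qed
    then show ?thesis using xc y by (simp add: ext_ideal_def)
  qed
  show ?thesis
  proof (rule idealI[OF AD.ring_axioms])
    show "subgroup (ext_ideal J) (add_monoid AD)"
    proof (rule subgroup.intro)
      fix x assume x: "x \<in> ext_ideal J"
      then have "x \<in> carrier AD" by (simp add: ext_ideal_def)
      then have "\<ominus>\<^bsub>AD\<^esub> x = (\<ominus>\<^bsub>AD\<^esub> \<one>\<^bsub>AD\<^esub>) \<otimes>\<^bsub>AD\<^esub> x" by (simp add: AD.l_minus)
      then have "\<ominus>\<^bsub>AD\<^esub> x \<in> ext_ideal J" using mult[OF x, of "\<ominus>\<^bsub>AD\<^esub> \<one>\<^bsub>AD\<^esub>"] by simp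
      then show "inv\<^bsub>add_monoid AD\<^esub> x \<in> ext_ideal J" unfolding a_inv_def .
    qed (auto simp: ext_ideal_def group_ring_add_app[OF A_cring D_comm_group]
        group_ring_zero_app[OF A_cring D_comm_group])
    fix x y assume x: "x \<in> ext_ideal J" and y: "y \<in> carrier AD"
    show "y \<otimes>\<^bsub>AD\<^esub> x \<in> ext_ideal J" by (rule mult[OF x y])
    then show "x \<otimes>\<^bsub>AD\<^esub> y \<in> ext_ideal J"
      using x y AD.m_comm[of x y] by (simp add: ext_ideal_def)
  qed
qed

lemma const_in_ext_ideal:
  assumes J: "ideal J A" and c: "c \<in> J"
  shows "const c \<in> ext_ideal J"
  using gmonom_closed'[of c] ideal.Icarr[OF J c] c additive_subgroup.zero_closed[OF ideal.axioms(1)[OF J]]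
  by (auto simp: ext_ideal_def gmonom_def)

lemma const_mult_app:
  assumes "c \<in> carrier A" "x \<in> carrier AD" "d \<in> carrier D"
  shows "(const c \<otimes>\<^bsub>AD\<^esub> x) d = c \<otimes> x d"
  using gmonom_mult_app[OF A_cring D_comm_group assms(2,1,3), of "\<one>\<^bsub>D\<^esub>"] assms(3) by simp

lemma const_closed: "a \<in> carrier A \<Longrightarrow> const a \<in> carrier AD"
  by (rule gmonom_closed')

lemma act_pt_prime: "primeideal q AD \<Longrightarrow> primeideal (act_pt q) A"
  by (rule contraction_primeideal[OF A_cring coact_hom])

lemma proj_pt_prime: "primeideal q AD \<Longrightarrow> primeideal (proj_pt q) A"
  by (rule contraction_primeideal[OF A_cring const_hom])

lemma contr0_prime: "primeideal P A \<Longrightarrow> primeideal (contr0 P) A0"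
  by (rule contraction_primeideal[OF degree_zero_cring degree_zero_inclusion_hom])

lemma contr0_mem: "a \<in> contr0 P \<longleftrightarrow> a \<in> \<B> \<and> a \<in> P"
  by (simp add: contraction_def)

text \<open>On degree zero elements the coaction is the constant embedding.\<close>

lemma contr0_act_proj: "contr0 (act_pt q) = contr0 (proj_pt q)"
  using degree_zero_closed by (auto simp: contraction_def coact_degree_zero)

text \<open>Krull's lemma in A[D] for the ideal J[D]. The coefficients of const c times coact a are
  the products c a_d, so \<open>nz\<close> says that none of the products with a in S and c in T
  lies in J[D]. The last conclusion bounds the image under the action from below, the conditions on
  S and T bound the two images from above.\<close>

lemma exists_group_ring_prime:
  assumes J: "ideal J A" and S: "submonoid S A" and T: "submonoid T A"
    and nz: "\<And>a c. \<lbrakk>a \<in> S; c \<in> T\<rbrakk> \<Longrightarrow> \<exists>d\<in>carrier D. c \<otimes> coact a d \<notin> J"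
  obtains q where "primeideal q AD" "J \<subseteq> proj_pt q" "act_pt q \<inter> S = {}" "proj_pt q \<inter> T = {}"
    "\<And>a. \<lbrakk>a \<in> carrier A; \<And>d. d \<in> carrier D \<Longrightarrow> coact a d \<in> J\<rbrakk> \<Longrightarrow> a \<in> act_pt q"
proof -
  interpret J: ideal J A by (rule J)
  interpret S: submonoid S A by (rule S)
  interpret T: submonoid T A by (rule T)
  interpret coact: ring_hom_cring A AD coact
    by (rule ring_hom_cringI[OF A_cring AD.is_cring coact_hom])
  interpret const: ring_hom_cring A AD const
    by (rule ring_hom_cringI[OF A_cring AD.is_cring const_hom])
  have Sc: "a \<in> carrier A" if "a \<in> S" for a using that S.subset by blast
  have Tc: "a \<in> carrier A" if "a \<in> T" for a using that T.subset by blast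
  \<comment> \<open>A single submonoid enforces both upper bounds: a prime that misses all these
    products misses every factor coact a and every factor const c.\<close>
  let ?W = "{const c \<otimes>\<^bsub>AD\<^esub> coact a | a c. a \<in> S \<and> c \<in> T}"
  have W: "submonoid ?W AD"
  proof
    show "?W \<subseteq> carrier AD" using Sc Tc by auto
    have "const \<one> \<otimes>\<^bsub>AD\<^esub> coact \<one> = \<one>\<^bsub>AD\<^esub>" by simp
    then show "\<one>\<^bsub>AD\<^esub> \<in> ?W" using S.one_closed T.one_closed by (smt (verit) mem_Collect_eq)
  next
    fix x y assume "x \<in> ?W" "y \<in> ?W"
    then obtain a c b e where m: "a \<in> S" "c \<in> T" "b \<in> S" "e \<in> T"
      "x = const c \<otimes>\<^bsub>AD\<^esub> coact a" "y = const e \<otimes>\<^bsub>AD\<^esub> coact b" by auto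
    have "x \<otimes>\<^bsub>AD\<^esub> y = const (c \<otimes> e) \<otimes>\<^bsub>AD\<^esub> coact (a \<otimes> b)"
      using m Sc Tc by (simp add: AD.m_ac)
    moreover have "a \<otimes> b \<in> S" "c \<otimes> e \<in> T" using m by auto
    ultimately show "x \<otimes>\<^bsub>AD\<^esub> y \<in> ?W" by blast
  qed
  have disj: "ext_ideal J \<inter> ?W = {}"
  proof -
    have "const c \<otimes>\<^bsub>AD\<^esub> coact a \<notin> ext_ideal J" if ac: "a \<in> S" "c \<in> T" for a c
    proof -
      obtain d where d: "d \<in> carrier D" "c \<otimes> coact a d \<notin> J" using nz[OF ac] by auto
      then have "(const c \<otimes>\<^bsub>AD\<^esub> coact a) d \<notin> J"
        using const_mult_app[OF Tc[OF ac(2)] coact_closed[OF Sc[OF ac(1)]] d(1)] by simp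
      then show ?thesis using d(1) by (auto simp: ext_ideal_def)
    qed
    then show ?thesis by blast
  qed
  obtain q where q: "primeideal q AD" "ext_ideal J \<subseteq> q" "q \<inter> ?W = {}"
    using AD.exists_primeideal_disjoint[OF ext_ideal_ideal[OF J] W disj] .
  interpret q: primeideal q AD by (rule q(1))
  have nq: "const c \<otimes>\<^bsub>AD\<^esub> coact a \<notin> q" if "a \<in> S" "c \<in> T" for a c
    using q(3) that by blast
  show thesis
  proof (rule that[OF q(1)])
    show "J \<subseteq> proj_pt q"
      using q(2) const_in_ext_ideal[OF J] J.Icarr by (auto simp: contraction_def)
    have "coact a \<notin> q" if "a \<in> S" for a
      using nq[OF that T.one_closed] that Sc by (auto simp: AD.m_comm q.I_l_closed)
    then show "act_pt q \<inter> S = {}" by (auto simp: contraction_def)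
    have "const c \<notin> q" if "c \<in> T" for c
      using nq[OF S.one_closed that] that Tc by auto
    then show "proj_pt q \<inter> T = {}" by (auto simp: contraction_def)
    show "a \<in> act_pt q" if "a \<in> carrier A" "\<And>d. d \<in> carrier D \<Longrightarrow> coact a d \<in> J" for a
    proof -
      have "coact a \<in> ext_ideal J" using that coact_closed by (simp add: ext_ideal_def)
      then show ?thesis using q(2) that(1) by (auto simp: contraction_def)
    qed
  qed
qed

text \<open>For an ideal J this is the largest homogeneous ideal inside J.\<close>

definition homogeneous_core :: "'a set \<Rightarrow> 'a set" where
  "homogeneous_core J = {a \<in> carrier A. \<forall>d\<in>carrier D. coact a d \<in> J}"

lemma homogeneous_core_subset:
  assumes J: "ideal J A"
  shows "homogeneous_core J \<subseteq> J"
proof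
  interpret J: ideal J A by (rule J)
  fix a assume a: "a \<in> homogeneous_core J"
  then have aA: "a \<in> carrier A" and aJ: "\<And>d. d \<in> carrier D \<Longrightarrow> coact a d \<in> J"
    by (auto simp: homogeneous_core_def)
  have "(\<Oplus>d\<in>supp A D (coact a). coact a d) \<in> J"
    using supp_coact(1,2)[OF aA] aJ by (intro J.finsum_mem) auto
  then show "a \<in> J" using supp_coact(3)[OF aA] by simp
qed

text \<open>The core is the preimage of J[D] under the coaction, hence an ideal. It is closed under
  components because the only components of a homogeneous element are the element itself and
  zero.\<close>

lemma homogeneous_core_homogeneous:
  assumes J: "ideal J A"
  shows "homogeneous_ideal A D \<A> (homogeneous_core J)"
proof -
  interpret J: ideal J A by (rule J)
  have "homogeneous_core J = contraction A coact (ext_ideal J)"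
    using coact_closed by (auto simp: homogeneous_core_def contraction_def ext_ideal_def)
  then have "ideal (homogeneous_core J) A"
    using contraction_ideal[OF A_cring AD.is_cring coact_hom ext_ideal_ideal[OF J]] by simp
  moreover have "coact a d \<in> homogeneous_core J" if "a \<in> homogeneous_core J" "d \<in> carrier D" for a d
    using that coact_graded[of a d] coact_in_carrier[of a d] coaction_homogeneous[of d "coact a d"]
    by (auto simp: homogeneous_core_def gmonom_def)
  ultimately show ?thesis by (auto simp: homogeneous_ideal_def coaction_def)
qed

text \<open>Multiplication by x of degree zero preserves degrees, so it acts on each component of w
  separately.\<close>

lemma annihilator_homogeneous:
  assumes x: "x \<in> \<B>"
  shows "homogeneous_ideal A D \<A> {w \<in> carrier A. w \<otimes> x = \<zero>}"
proof -
  note xA = degree_zero_closed[OF x]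
  have "coact w d \<otimes> x = \<zero>" if w: "w \<in> carrier A" "w \<otimes> x = \<zero>" and d: "d \<in> carrier D" for w d
  proof -
    have "x \<otimes> w = \<zero>" using w xA by (simp add: m_comm)
    then have "x \<otimes> coact w d = coact \<zero> d" using coact_mult_degree_zero[OF x w(1) d] by simp
    also have "\<dots> = \<zero>" using d by (simp add: coact_zero group_ring_zero_app[OF A_cring D_comm_group])
    finally show ?thesis using w(1) d xA coact_in_carrier[OF w(1) d] by (simp add: m_comm)
  qed
  then show ?thesis
    unfolding homogeneous_ideal_def
    using annihilator_ideal[OF xA] coact_in_carrier by (auto simp: coaction_def)
qed

text \<open>Multiplication by f shifts degrees by d, so each component of x f is again a component
  of x times f.\<close>

lemma principal_homogeneous:
  assumes d: "d \<in> carrier D" and f: "f \<in> \<A> d"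
  shows "homogeneous_ideal A D \<A> (PIdl f)"
proof -
  note fA = graded_closed[OF d f]
  have "coact a e \<in> PIdl f" if a: "a \<in> PIdl f" and e: "e \<in> carrier D" for a e
  proof -
    obtain x where x: "x \<in> carrier A" "a = x \<otimes> f" using a by (auto simp: cgenideal_def)
    have i: "inv\<^bsub>D\<^esub> d \<otimes>\<^bsub>D\<^esub> e \<in> carrier D" using d e by simp
    have "coact a e = f \<otimes> coact x (inv\<^bsub>D\<^esub> d \<otimes>\<^bsub>D\<^esub> e)"
      using coact_mult_homogeneous_app[OF d f x(1) e] x fA by (simp add: m_comm)
    also have "\<dots> = coact x (inv\<^bsub>D\<^esub> d \<otimes>\<^bsub>D\<^esub> e) \<otimes> f" using coact_in_carrier[OF x(1) i] fA by (simp add: m_comm)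
    finally show ?thesis using coact_in_carrier[OF x(1) i] by (auto simp: cgenideal_def)
  qed
  then show ?thesis
    unfolding homogeneous_ideal_def using cgenideal_ideal[OF fA] by (simp add: coaction_def)
qed

text \<open>The projection of A onto its degree zero part is A_0-linear. Hence the ideal
  \<open>?K\<close> contains p, and taking y = 1 in its definition shows that it meets A_0 only
  inside p. Any prime over \<open>?K\<close> that avoids the rest of A_0 contracts to p.\<close>

lemma exists_prime_over:
  assumes p: "primeideal p A0"
  obtains P where "primeideal P A" "contr0 P = p"
proof -
  interpret p: primeideal p A0 by (rule p)
  have pA: "a \<in> \<B>" if "a \<in> p" for a using p.Icarr[OF that] by simp
  have c: "coact a \<one>\<^bsub>D\<^esub> \<in> \<B>" if "a \<in> carrier A" for a using coact_graded[OF that] by simp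
  (* the largest ideal whose elements have their degree zero component in p *)
  let ?K = "{a \<in> carrier A. \<forall>y\<in>carrier A. coact (a \<otimes> y) \<one>\<^bsub>D\<^esub> \<in> p}"
  have mult: "x \<otimes> a \<in> ?K" if a: "a \<in> ?K" and x: "x \<in> carrier A" for a x
  proof -
    have "coact (x \<otimes> a \<otimes> y) \<one>\<^bsub>D\<^esub> \<in> p" if y: "y \<in> carrier A" for y
    proof -
      have "x \<otimes> a \<otimes> y = a \<otimes> (x \<otimes> y)" using a x y by (simp add: m_ac)
      then show ?thesis using a x y by simp
    qed
    then show ?thesis using a x by simp
  qed
  have K: "ideal ?K A"
  proof (rule idealI[OF ring_axioms])
    show "subgroup ?K (add_monoid A)"
    proof (rule subgroup.intro)
      show "\<one>\<^bsub>add_monoid A\<^esub> \<in> ?K"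
        using p.zero_closed by (simp add: coact_zero group_ring_zero_app[OF A_cring D_comm_group])
    next
      fix a b assume a: "a \<in> ?K" and b: "b \<in> ?K"
      have "coact ((a \<oplus> b) \<otimes> y) \<one>\<^bsub>D\<^esub> \<in> p" if y: "y \<in> carrier A" for y
      proof -
        have "coact ((a \<oplus> b) \<otimes> y) \<one>\<^bsub>D\<^esub> = coact (a \<otimes> y) \<one>\<^bsub>D\<^esub> \<oplus> coact (b \<otimes> y) \<one>\<^bsub>D\<^esub>"
          using a b y by (simp add: l_distr coact_add group_ring_add_app[OF A_cring D_comm_group])
        then show ?thesis using p.a_closed[of "coact (a \<otimes> y) \<one>\<^bsub>D\<^esub>" "coact (b \<otimes> y) \<one>\<^bsub>D\<^esub>"] a b y by simp
      qed
      then show "a \<otimes>\<^bsub>add_monoid A\<^esub> b \<in> ?K" using a b by simp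
    next
      fix a assume a: "a \<in> ?K"
      then have "\<ominus> a = (\<ominus> \<one>) \<otimes> a" by (simp add: l_minus)
      then have "\<ominus> a \<in> ?K" using mult[OF a, of "\<ominus> \<one>"] by simp
      then show "inv\<^bsub>add_monoid A\<^esub> a \<in> ?K" by (simp flip: a_inv_def)
    qed auto
    fix a x assume a: "a \<in> ?K" and x: "x \<in> carrier A"
    show "x \<otimes> a \<in> ?K" by (rule mult[OF a x])
    then show "a \<otimes> x \<in> ?K" using a x m_comm[of a x] by simp
  qed
  have S: "submonoid (\<B> - p) A"
    using primeideal.submonoid_compl[OF p] degree_zero_closed by (auto simp: submonoid_def)
  have disj: "?K \<inter> (\<B> - p) = {}"
  proof -
    have "a \<in> p" if a: "a \<in> \<B>" "a \<in> ?K" for a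
    proof -
      have "coact (a \<otimes> \<one>) \<one>\<^bsub>D\<^esub> \<in> p" using a(2) one_closed by blast
      then show ?thesis using a degree_zero_closed[OF a(1)] by (simp add: coact_homogeneous_app)
    qed
    then show ?thesis by blast
  qed
  obtain P where P: "primeideal P A" "?K \<subseteq> P" "P \<inter> (\<B> - p) = {}"
    using exists_primeideal_disjoint[OF K S disj] .
  have "a \<in> ?K" if a: "a \<in> p" for a
  proof -
    have "coact (a \<otimes> y) \<one>\<^bsub>D\<^esub> \<in> p" if y: "y \<in> carrier A" for y
      using coact_mult_degree_zero[OF pA[OF a] y, of "\<one>\<^bsub>D\<^esub>"] p.I_r_closed[OF a, of "coact y \<one>\<^bsub>D\<^esub>"] c[OF y] by simp
    then show ?thesis using degree_zero_closed[OF pA[OF a]] by simp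
  qed
  then have "p \<subseteq> P" using P(2) by blast
  then have "contr0 P = p" using P(3) pA by (auto simp: contr0_mem)
  then show thesis using that P(1) by blast
qed

text \<open>A witness in \<open>A[D]\<close> for the equality of two fractions can be replaced by one of its coefficients.\<close>

lemma loc_map_const_inj:
  assumes q: "primeideal q AD" and a: "a \<in> carrier A" "b \<in> carrier A"
    and s: "s \<in> carrier A - proj_pt q" "t \<in> carrier A - proj_pt q"
    and eq: "frac_at AD q (const a) (const s) = frac_at AD q (const b) (const t)"
  shows "frac_at A (proj_pt q) a s = frac_at A (proj_pt q) b t"
proof -
  interpret q: primeideal q AD by (rule q)
  interpret M: localized_cring AD "carrier AD - q" by (rule q.localized_cring_compl)
  interpret L: localized_cring A "carrier A - proj_pt q"
    by (rule primeideal.localized_cring_compl[OF proj_pt_prime[OF q]])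
  have sA: "s \<in> carrier A" "t \<in> carrier A" using s by blast+
  have "\<exists>w\<in>carrier AD - q. w \<otimes>\<^bsub>AD\<^esub> (const a \<otimes>\<^bsub>AD\<^esub> const t) = w \<otimes>\<^bsub>AD\<^esub> (const b \<otimes>\<^bsub>AD\<^esub> const s)"
    using eq M.frac_eq_iff[OF const_closed[OF a(1)] contraction_compl[OF const_hom s(1)]
        const_closed[OF a(2)] contraction_compl[OF const_hom s(2)]] by blast
  then obtain w where w: "w \<in> carrier AD" "w \<notin> q"
    "w \<otimes>\<^bsub>AD\<^esub> (const a \<otimes>\<^bsub>AD\<^esub> const t) = w \<otimes>\<^bsub>AD\<^esub> (const b \<otimes>\<^bsub>AD\<^esub> const s)" by blast
  have cc: "const a \<otimes>\<^bsub>AD\<^esub> const t = const (a \<otimes> t)" "const b \<otimes>\<^bsub>AD\<^esub> const s = const (b \<otimes> s)"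
    using a sA by (simp_all add: gmonom_mult_gmonom')
  have wm: "w \<otimes>\<^bsub>AD\<^esub> const c = const c \<otimes>\<^bsub>AD\<^esub> w" if "c \<in> carrier A" for c
    by (rule AD.m_comm[OF w(1) const_closed[OF that]])
  have app: "w d \<otimes> (a \<otimes> t) = w d \<otimes> (b \<otimes> s)" if d: "d \<in> carrier D" for d
  proof -
    have "(const (a \<otimes> t) \<otimes>\<^bsub>AD\<^esub> w) d = (const (b \<otimes> s) \<otimes>\<^bsub>AD\<^esub> w) d"
      using w(3) wm[of "a \<otimes> t"] wm[of "b \<otimes> s"] a sA unfolding cc by simp
    then have "(a \<otimes> t) \<otimes> w d = (b \<otimes> s) \<otimes> w d"
      using const_mult_app[OF _ w(1) d] a sA by simp
    then show ?thesis using a sA group_ring_memD'(1)[OF w(1) d] by (simp add: m_comm)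
  qed
  \<comment> \<open>If all coefficients of w were in q as constants, their multiples by the
    monomials T^d would be too, and so would w, which is the sum of these.\<close>
  have "\<exists>d\<in>carrier D. const (w d) \<notin> q"
  proof (rule ccontr)
    assume "\<not> (\<exists>d\<in>carrier D. const (w d) \<notin> q)"
    then have cq: "const (w d) \<in> q" if "d \<in> carrier D" for d using that by blast
    have mq: "gmonom A D (w d) d \<in> q" if d: "d \<in> carrier D" for d
    proof -
      have "gmonom A D (w d) d = gmonom A D \<one> d \<otimes>\<^bsub>AD\<^esub> const (w d)"
        using gmonom_mult_gmonom'[of \<one> "w d" d "\<one>\<^bsub>D\<^esub>"] d group_ring_memD'(1)[OF w(1) d] by simp
      then show ?thesis using q.I_l_closed[OF cq[OF d] gmonom_closed'[of \<one> d]] by simp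
    qed
    have "(\<Oplus>\<^bsub>AD\<^esub>d\<in>supp A D w. gmonom A D (w d) d) \<in> q"
      using group_ring_memD'(3,4)[OF w(1)] mq by (intro q.finsum_mem) auto
    then show False
      using w(2) group_ring_expand[OF A_cring D_comm_group w(1)] by simp
  qed
  then obtain d where d: "d \<in> carrier D" "const (w d) \<notin> q" by blast
  have wd: "w d \<in> carrier A - proj_pt q"
    using d group_ring_memD'(1)[OF w(1) d(1)] unfolding contraction_def by blast
  show ?thesis
    using L.frac_eq_iff[OF a(1) s(1) a(2) s(2)] app[OF d(1)] wd by blast
qed

end


section \<open>Homogeneous ideals generated in degree zero up to radical\<close>

locale degree_zero_radical = graded_cring A D \<A>
  for A :: "('a, 'm) ring_scheme" (structure) and D :: "('d, 'n) monoid_scheme" and \<A> +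
  assumes radical_degree_zero: "homogeneous_ideal A D \<A> I
    \<Longrightarrow> radical A I = radical A (Idl (I \<inter> \<B>))"
begin

text \<open>The form in which \<open>radical_degree_zero\<close> is applied throughout: a prime that
  contains the degree zero part of I contains the ideal generated by it, hence a power of each
  element of I.\<close>

lemma homogeneous_subset_prime:
  assumes I: "homogeneous_ideal A D \<A> I" and P: "primeideal P A" and sub: "I \<inter> \<B> \<subseteq> P"
  shows "I \<subseteq> P"
proof
  interpret P: primeideal P A by (rule P)
  interpret I: ideal I A using I by (simp add: homogeneous_ideal_def)
  fix a assume a: "a \<in> I"
  have "a [^] (1::nat) = a" using I.Icarr[OF a] by simp
  then have "a \<in> radical A I" using a I.Icarr[OF a] unfolding radical_def by (metis (mono_tags, lifting) mem_Collect_eq)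
  then have "a \<in> radical A (Idl (I \<inter> \<B>))" using radical_degree_zero[OF I] by simp
  then obtain n :: nat where n: "a [^] n \<in> Idl (I \<inter> \<B>)" by (auto simp: radical_def)
  have "Idl (I \<inter> \<B>) \<subseteq> P" by (rule genideal_minimal[OF P.is_ideal sub])
  then have "a [^] n \<in> P" using n by blast
  then show "a \<in> P" by (rule P.pow_mem[OF I.Icarr[OF a]])
qed

text \<open>The principal ideal of f is homogeneous and not inside P, so it has a degree zero
  element y = f x outside P. In the degree zero component of f x only the component of x in the
  degree inverse to d occurs, and it serves as b.\<close>

lemma exists_degree_zero_multiple:
  assumes P: "primeideal P A" and d: "d \<in> carrier D" and f: "f \<in> \<A> d" "f \<notin> P"
  obtains b where "b \<in> \<A> (inv\<^bsub>D\<^esub> d)" "f \<otimes> b \<in> \<B>" "f \<otimes> b \<notin> P"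
proof -
  note fA = graded_closed[OF d f(1)]
  have "\<not> PIdl f \<subseteq> P" using cgenideal_self[OF fA] f(2) by blast
  then have "\<not> PIdl f \<inter> \<B> \<subseteq> P"
    using homogeneous_subset_prime[OF principal_homogeneous[OF d f(1)] P] by blast
  then obtain y where y: "y \<in> PIdl f" "y \<in> \<B>" "y \<notin> P" by blast
  obtain x where x: "x \<in> carrier A" "y = x \<otimes> f" using y(1) by (auto simp: cgenideal_def)
  let ?b = "coact x (inv\<^bsub>D\<^esub> d)"
  have "y = coact y \<one>\<^bsub>D\<^esub>" using y(2) by (simp add: coact_homogeneous_app)
  also have "\<dots> = coact (f \<otimes> x) \<one>\<^bsub>D\<^esub>" using x fA by (simp add: m_comm)
  also have "\<dots> = f \<otimes> ?b" using coact_mult_homogeneous_app[OF d f(1) x(1), of "\<one>\<^bsub>D\<^esub>"] d by simp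
  finally have "y = f \<otimes> ?b" .
  then show thesis using that[of ?b] y(2,3) coact_graded[OF x(1), of "inv\<^bsub>D\<^esub> d"] d by simp
qed

text \<open>
  Two primes with the same contraction to \<open>A\<^sub>0\<close> have the same homogeneous core. A minimal prime \<open>N\<close>
  over that core is reached by the action from both of them.
\<close>

lemma same_contr0_related:
  assumes P: "primeideal P A" and Q: "primeideal Q A" and PQ: "contr0 P = contr0 Q"
  obtains q q' where "primeideal q AD" "primeideal q' AD" "proj_pt q = P" "proj_pt q' = Q"
    "act_pt q = act_pt q'"
proof -
  have id: "ideal P A" "ideal Q A" using P Q primeideal.axioms(1) by auto
  \<comment> \<open>The degree zero part of the core of P' lies in the common contraction, so the
    whole core lies in Q'. As the core is closed under components, it even lies in the core of
    Q'.\<close>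
  have core_sub: "homogeneous_core P' \<subseteq> homogeneous_core Q'"
    if P': "primeideal P' A" and Q': "primeideal Q' A" and eq: "contr0 P' = contr0 Q'" for P' Q'
  proof -
    have id: "ideal P' A" using P' primeideal.axioms(1) by auto
    note hom = homogeneous_core_homogeneous[OF id]
    have "homogeneous_core P' \<inter> \<B> \<subseteq> Q'"
      using homogeneous_core_subset[OF id] eq by (auto simp: contr0_mem set_eq_iff)
    from homogeneous_subset_prime[OF hom Q' this] have sub: "homogeneous_core P' \<subseteq> Q'" .
    have "coact a d \<in> Q'" if "a \<in> homogeneous_core P'" "d \<in> carrier D" for a d
      using hom that sub by (auto simp: homogeneous_ideal_def coaction_def)
    then show ?thesis by (auto simp: homogeneous_core_def)
  qed
  have core: "homogeneous_core P = homogeneous_core Q"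
    using core_sub[OF P Q PQ] core_sub[OF Q P PQ[symmetric]] by blast
  obtain N where N: "primeideal N A" "homogeneous_core P \<subseteq> N"
    and min: "\<And>N'. \<lbrakk>primeideal N' A; homogeneous_core P \<subseteq> N'; N' \<subseteq> N\<rbrakk> \<Longrightarrow> N' = N"
    using exists_minimal_prime[OF P homogeneous_core_subset[OF id(1)]] by metis
  have ex: "\<exists>q. primeideal q AD \<and> proj_pt q = P' \<and> act_pt q = N"
    if P': "primeideal P' A" and core': "homogeneous_core P' = homogeneous_core P" for P'
  proof -
    have id': "ideal P' A" using P' primeideal.axioms(1) by auto
    \<comment> \<open>An element outside N is outside the core of P', so one of its components is
      outside P', and it stays outside after multiplication by c because P' is prime.\<close>
    have nz: "\<exists>d\<in>carrier D. c \<otimes> coact a d \<notin> P'" if a: "a \<in> carrier A - N" and c: "c \<in> carrier A - P'" for a c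
    proof -
      have "a \<notin> homogeneous_core P'" using a N(2) core' by blast
      then obtain d where d: "d \<in> carrier D" "coact a d \<notin> P'" using a by (auto simp: homogeneous_core_def)
      have "c \<otimes> coact a d \<notin> P'"
        using primeideal_mult_notin_iff[OF P', of c "coact a d"] c d a coact_in_carrier by auto
      then show ?thesis using d(1) by blast
    qed
    obtain q where q: "primeideal q AD" "P' \<subseteq> proj_pt q" "act_pt q \<inter> (carrier A - N) = {}"
      "proj_pt q \<inter> (carrier A - P') = {}"
      "\<And>a. \<lbrakk>a \<in> carrier A; \<And>d. d \<in> carrier D \<Longrightarrow> coact a d \<in> P'\<rbrakk> \<Longrightarrow> a \<in> act_pt q"
      using exists_group_ring_prime[OF id' primeideal.submonoid_compl[OF N(1)]
          primeideal.submonoid_compl[OF P'] nz] by metis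
    have "proj_pt q = P'" using q(2,4) unfolding contraction_def by blast
    \<comment> \<open>The image of q under the action now lies between the core and N, so it equals
      N by minimality.\<close>
    moreover have "homogeneous_core P \<subseteq> act_pt q"
      using q(5) unfolding core'[symmetric] by (auto simp: homogeneous_core_def)
    moreover have "act_pt q \<subseteq> N" using q(3) unfolding contraction_def by blast
    ultimately show ?thesis using q(1) min[OF act_pt_prime[OF q(1)]] by blast
  qed
  show thesis using that ex[OF P refl] ex[OF Q core[symmetric]] by metis
qed

text \<open>This is the statement that the topology of \<open>Spec A_0\<close> is the quotient
  topology. The preimage of U is the complement of V(J), and since points related by the action have
  the same contraction, V(J) is invariant. Invariance makes V(J) depend only on the homogeneous core
  of J.\<close>

lemma openin_degree_zero_iff:
  assumes U: "\<And>p. p \<in> U \<Longrightarrow> primeideal p A0"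
    and op: "openin (zariski A) {P. primeideal P A \<and> contr0 P \<in> U}"
  shows "openin (zariski A0) U"
proof (rule openin_zariskiI)
  let ?O = "{P. primeideal P A \<and> contr0 P \<in> U}"
  fix p assume p: "p \<in> U"
  obtain P where P: "primeideal P A" "contr0 P = p" using exists_prime_over[OF U[OF p]] .
  obtain E where E: "E \<subseteq> carrier A" "?O = {P. primeideal P A \<and> \<not> E \<subseteq> P}"
    using op unfolding openin_zariski by auto
  let ?J = "Idl E"
  have J: "ideal ?J A" by (rule genideal_ideal[OF E(1)])
  have EJ: "E \<subseteq> Q \<longleftrightarrow> ?J \<subseteq> Q" if "primeideal Q A" for Q
    using Idl_subset_ideal[OF primeideal.axioms(1)[OF that] E(1)] by simp
  have O_iff: "contr0 Q \<in> U \<longleftrightarrow> \<not> ?J \<subseteq> Q" if "primeideal Q A" for Q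
  proof -
    have "Q \<in> ?O \<longleftrightarrow> Q \<in> {P. primeideal P A \<and> \<not> E \<subseteq> P}" by (simp only: E(2))
    then show ?thesis using EJ[OF that] that by simp
  qed
  have "\<not> homogeneous_core ?J \<subseteq> P"
  proof
    assume sub: "homogeneous_core ?J \<subseteq> P"
    \<comment> \<open>Only the lower bound J is wanted for the projection of q, hence the trivial
      submonoid for c. The prime q then projects into V(J), the action carries it to a prime inside
      P, and by invariance of V(J) this prime contains J, so P does too.\<close>
    have nz: "\<exists>d\<in>carrier D. c \<otimes> coact a d \<notin> ?J" if a: "a \<in> carrier A - P" and c: "c \<in> {\<one>}" for a c
    proof -
      have "a \<notin> homogeneous_core ?J" using a sub by blast
      then obtain d where d: "d \<in> carrier D" "coact a d \<notin> ?J" using a by (auto simp: homogeneous_core_def)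
      then show ?thesis using a c coact_in_carrier[of a d] by (intro bexI[of _ d]) auto
    qed
    have one: "submonoid {\<one>} A" by unfold_locales auto
    obtain q where q: "primeideal q AD" "?J \<subseteq> proj_pt q" "act_pt q \<inter> (carrier A - P) = {}"
      using exists_group_ring_prime[OF J primeideal.submonoid_compl[OF P(1)] one nz] by metis
    have "contr0 (proj_pt q) \<notin> U" using O_iff[OF proj_pt_prime[OF q(1)]] q(2) by simp
    then have "?J \<subseteq> act_pt q" using O_iff[OF act_pt_prime[OF q(1)]] contr0_act_proj[of q] by simp
    moreover have "act_pt q \<subseteq> P" using q(3) unfolding contraction_def by blast
    ultimately have "?J \<subseteq> P" by (rule order_trans)
    then show False using O_iff[OF P(1)] P(2) p by simp
  qed
  then have "\<not> homogeneous_core ?J \<inter> \<B> \<subseteq> P"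
    using homogeneous_subset_prime[OF homogeneous_core_homogeneous[OF J] P(1)] by blast
  then obtain u where u: "u \<in> homogeneous_core ?J" "u \<in> \<B>" "u \<notin> P" by blast
  have uJ: "u \<in> ?J" using u(1) homogeneous_core_subset[OF J] by blast
  \<comment> \<open>Each prime of A_0 that omits u is the contraction of some P'; then P' omits u,
    which is in J, so P' is outside V(J).\<close>
  have "basic_open A0 u \<subseteq> U"
  proof
    fix p' assume p': "p' \<in> basic_open A0 u"
    obtain P' where P': "primeideal P' A" "contr0 P' = p'" using exists_prime_over[OF basic_open_prime[OF p']] .
    have "u \<notin> P'" using p' u(2) unfolding P'(2)[symmetric] basic_open_def by (simp add: contr0_mem)
    then show "p' \<in> U" using O_iff[OF P'(1)] P'(2) uJ by blast
  qed
  moreover have "p \<in> basic_open A0 u"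
    using U[OF p] u(3) unfolding P(2)[symmetric] basic_open_def by (simp add: contr0_mem)
  ultimately show "\<exists>f\<in>carrier A0. p \<in> basic_open A0 f \<and> basic_open A0 f \<subseteq> U"
    using u(2) by auto
qed

text \<open>The equality in A_P means that a t - b s, an element of A_0, is annihilated by some w
  outside P. Its annihilator is homogeneous, so it also has a degree zero element outside P, and
  this is a witness over A_0.\<close>

lemma loc_map_degree_zero_inj:
  assumes P: "primeideal P A" and ab: "a \<in> \<B>" "b \<in> \<B>"
    and s: "s \<in> \<B> - P" and t: "t \<in> \<B> - P"
    and eq: "frac_at A P a s = frac_at A P b t"
  shows "frac_at A0 (contr0 P) a s = frac_at A0 (contr0 P) b t"
proof -
  interpret L: localized_cring A "carrier A - P" by (rule primeideal.localized_cring_compl[OF P])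
  interpret M: localized_cring A0 "carrier A0 - contr0 P"
    by (rule primeideal.localized_cring_compl[OF contr0_prime[OF P]])
  have c: "a \<in> carrier A" "b \<in> carrier A" "s \<in> carrier A" "t \<in> carrier A"
    using ab s t degree_zero_closed by auto
  have st: "s \<in> carrier A - P" "t \<in> carrier A - P" using s t degree_zero_closed by auto
  obtain w where w: "w \<in> carrier A - P" "w \<otimes> (a \<otimes> t) = w \<otimes> (b \<otimes> s)"
    using eq L.frac_eq_iff[OF c(1) st(1) c(2) st(2)] by blast
  let ?x = "a \<otimes> t \<ominus> b \<otimes> s"
  have x: "?x \<in> \<B>"
  proof -
    interpret additive_subgroup "\<B>" A by (rule additive) simp
    show ?thesis using ab s t degree_zero_mult unfolding a_minus_def by (simp add: a_inv_closed)
  qed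
  have zero_iff: "v \<otimes> ?x = \<zero> \<longleftrightarrow> v \<otimes> (a \<otimes> t) = v \<otimes> (b \<otimes> s)" if "v \<in> carrier A" for v
  proof -
    have "v \<otimes> ?x = v \<otimes> (a \<otimes> t) \<ominus> v \<otimes> (b \<otimes> s)"
      using that c by (simp add: a_minus_def r_distr r_minus)
    then show ?thesis using that c r_right_minus_eq[of "v \<otimes> (a \<otimes> t)" "v \<otimes> (b \<otimes> s)"] by simp
  qed
  let ?I = "{v \<in> carrier A. v \<otimes> ?x = \<zero>}"
  have "w \<in> ?I" using w zero_iff[of w] by blast
  then have "\<not> ?I \<subseteq> P" using w(1) by blast
  then have "\<not> ?I \<inter> \<B> \<subseteq> P"
    using homogeneous_subset_prime[OF annihilator_homogeneous[OF x] P] by blast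
  then obtain v where v: "v \<in> carrier A" "v \<otimes> ?x = \<zero>" "v \<in> \<B>" "v \<notin> P" by blast
  have mem: "a \<in> carrier A0" "b \<in> carrier A0" using ab by simp_all
  have mem': "s \<in> carrier A0 - contr0 P" "t \<in> carrier A0 - contr0 P" "v \<in> carrier A0 - contr0 P"
    using s t v by (simp_all add: contr0_mem)
  have "v \<otimes>\<^bsub>A0\<^esub> (a \<otimes>\<^bsub>A0\<^esub> t) = v \<otimes>\<^bsub>A0\<^esub> (b \<otimes>\<^bsub>A0\<^esub> s)"
    using zero_iff[OF v(1)] v(2) by simp
  then show ?thesis using M.frac_eq_iff[OF mem(1) mem'(1) mem(2) mem'(2)] mem'(3) by blast
qed

end


section \<open>Descent of invariant sections\<close>

context degree_zero_radical
begin

abbreviation (input) preim0 :: "'a set set \<Rightarrow> 'a set set" where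
  "preim0 V \<equiv> {P. primeideal P A \<and> contr0 P \<in> V}"

text \<open>Equality of the pullbacks of s along the action and the projection, stated at each point
  q of \<open>Spec A[D]\<close>. By \<open>contr0_act_proj\<close> both pullbacks are defined at the
  same points q.\<close>

definition invariant_section :: "'a set set \<Rightarrow> ('a set \<Rightarrow> ('a \<times> 'a) set) \<Rightarrow> bool" where
  "invariant_section V s \<longleftrightarrow> openin (zariski A0) V \<and> s \<in> spec_sections A (preim0 V) \<and>
     (\<forall>q. primeideal q AD \<and> contr0 (proj_pt q) \<in> V \<longrightarrow>
        loc_map AD coact q (s (act_pt q)) = loc_map AD const q (s (proj_pt q)))"

text \<open>
  Near \<open>P\<close> write \<open>s = a / f\<close>. Invariance says that \<open>a\<close> times the coaction of \<open>f\<close> and \<open>f\<close> times the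
  coaction of \<open>a\<close> agree after multiplication by a power of \<open>f\<close> times its coaction. Absorbing this
  power into \<open>a\<close> and \<open>f\<close>, one gets \<open>a f\<^sub>d = f a\<^sub>d\<close> for all \<open>d\<close>, so \<open>s = a\<^sub>d / f\<^sub>d\<close> for some \<open>f\<^sub>d \<notin> P\<close>.
\<close>

lemma invariant_section_local:
  assumes s: "invariant_section V s" and P: "P \<in> preim0 V"
  obtains a u where "a \<in> \<B>" "u \<in> \<B> - P" "s P = frac_at A P a u"
proof -
  have P': "primeideal P A" using P by simp
  interpret P: primeideal P A by (rule P')
  interpret L: localized_cring A "carrier A - P" by (rule P.localized_cring_compl)
  interpret coact: ring_hom_cring A AD coact
    by (rule ring_hom_cringI[OF A_cring AD.is_cring coact_hom])
  interpret const: ring_hom_cring A AD const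
    by (rule ring_hom_cringI[OF A_cring AD.is_cring const_hom])
  have "s \<in> spec_sections A (preim0 V)" using s by (simp add: invariant_section_def)
  then obtain a f where af: "has_local_fraction A (preim0 V) s P a f"
    using P by (rule spec_sections_local)
  note m = has_local_fractionD(1-4)[OF af] and s_eq = has_local_fractionD(5)[OF af]
  let ?l = "const a \<otimes>\<^bsub>AD\<^esub> coact f" and ?r = "coact a \<otimes>\<^bsub>AD\<^esub> const f"
  let ?x = "?l \<ominus>\<^bsub>AD\<^esub> ?r"
  let ?F = "const f \<otimes>\<^bsub>AD\<^esub> coact f"
  have c: "const a \<in> carrier AD" "const f \<in> carrier AD" "coact a \<in> carrier AD" "coact f \<in> carrier AD"
    using m by simp_all
  have x: "?x \<in> carrier AD" "?l \<in> carrier AD" "?r \<in> carrier AD" using c by simp_all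
  have zero_iff: "w \<otimes>\<^bsub>AD\<^esub> ?x = \<zero>\<^bsub>AD\<^esub> \<longleftrightarrow> w \<otimes>\<^bsub>AD\<^esub> ?l = w \<otimes>\<^bsub>AD\<^esub> ?r" if "w \<in> carrier AD" for w
  proof -
    have "w \<otimes>\<^bsub>AD\<^esub> ?x = w \<otimes>\<^bsub>AD\<^esub> ?l \<ominus>\<^bsub>AD\<^esub> w \<otimes>\<^bsub>AD\<^esub> ?r"
      using that x(2,3) unfolding a_minus_def by (simp only: AD.r_distr AD.r_minus AD.a_inv_closed)
    then show ?thesis using that x AD.r_right_minus_eq[of "w \<otimes>\<^bsub>AD\<^esub> ?l" "w \<otimes>\<^bsub>AD\<^esub> ?r"] by simp
  qed
  let ?I = "{w \<in> carrier AD. w \<otimes>\<^bsub>AD\<^esub> ?x = \<zero>\<^bsub>AD\<^esub>}"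
  have F: "?F \<in> carrier AD" using c by simp
  \<comment> \<open>At a prime q that omits F, neither image of q contains f, so s is a / f at both
    images. Invariance then provides an element outside q that annihilates x, so q cannot contain
    the annihilator of x.\<close>
  have all: "?F \<in> q" if q: "primeideal q AD" and I: "?I \<subseteq> q" for q
  proof (rule ccontr)
    assume "?F \<notin> q"
    then have nq: "const f \<notin> q" "coact f \<notin> q" using primeideal_mult_notin_iff[OF q c(2,4)] by simp_all
    have D: "proj_pt q \<in> basic_open A f" "act_pt q \<in> basic_open A f"
      using nq proj_pt_prime[OF q] act_pt_prime[OF q] unfolding basic_open_def contraction_def by simp_all
    have eq: "loc_map AD coact q (s (act_pt q)) = loc_map AD const q (s (proj_pt q))"
      using s q D(1) m(4) unfolding invariant_section_def by blast
    interpret M: localized_cring AD "carrier AD - q" by (rule primeideal.localized_cring_compl[OF q])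
    have f: "f \<in> carrier A - proj_pt q" "f \<in> carrier A - act_pt q"
      by (rule basic_openD[OF D(1) m(2)], rule basic_openD[OF D(2) m(2)])
    have "frac_at AD q (coact a) (coact f) = frac_at AD q (const a) (const f)"
      using eq unfolding s_eq[OF D(1)] s_eq[OF D(2)] loc_map_frac[OF A_cring coact_hom q m(1) f(2)]
        loc_map_frac[OF A_cring const_hom q m(1) f(1)] .
    then obtain w where w: "w \<in> carrier AD - q" "w \<otimes>\<^bsub>AD\<^esub> ?r = w \<otimes>\<^bsub>AD\<^esub> ?l"
      using M.frac_eq_iff[OF c(3) contraction_compl[OF coact_hom f(2)] c(1) contraction_compl[OF const_hom f(1)]]
      by blast
    then have "w \<in> ?I" using zero_iff[of w] by simp
    then show False using I w(1) by blast
  qed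
  obtain n :: nat where n: "?F [^]\<^bsub>AD\<^esub> n \<in> ?I"
    using AD.mem_radical_if_mem_primes[OF AD.annihilator_ideal[OF x(1)] F all] .
  then have Fn: "?F [^]\<^bsub>AD\<^esub> n \<otimes>\<^bsub>AD\<^esub> ?l = ?F [^]\<^bsub>AD\<^esub> n \<otimes>\<^bsub>AD\<^esub> ?r"
    using zero_iff[OF AD.nat_pow_closed[OF F]] by blast
  let ?cn = "const f [^]\<^bsub>AD\<^esub> n" and ?an = "coact f [^]\<^bsub>AD\<^esub> n"
  have cn: "?cn \<in> carrier AD" "?an \<in> carrier AD" using c by simp_all
  have Fn': "?F [^]\<^bsub>AD\<^esub> n = ?cn \<otimes>\<^bsub>AD\<^esub> ?an" by (rule AD.nat_pow_distrib[OF c(2,4)])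
  define b where "b = a \<otimes> f [^] n"
  define g where "g = f \<otimes> f [^] n"
  have bg: "b \<in> carrier A" "g \<in> carrier A" using m by (simp_all add: b_def g_def)
  have hp: "const (f [^] n) = ?cn" "coact (f [^] n) = ?an"
    using m(2) by (simp_all add: const.ring.hom_nat_pow coact.ring.hom_nat_pow)
  have h: "const b = const a \<otimes>\<^bsub>AD\<^esub> ?cn" "const g = const f \<otimes>\<^bsub>AD\<^esub> ?cn"
    "coact b = coact a \<otimes>\<^bsub>AD\<^esub> ?an" "coact g = coact f \<otimes>\<^bsub>AD\<^esub> ?an"
    using m unfolding b_def g_def hp[symmetric] by simp_all
  have "const b \<otimes>\<^bsub>AD\<^esub> coact g = (?cn \<otimes>\<^bsub>AD\<^esub> ?an) \<otimes>\<^bsub>AD\<^esub> ?l"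
    unfolding h using c cn by (simp add: AD.m_ac)
  also have "\<dots> = (?cn \<otimes>\<^bsub>AD\<^esub> ?an) \<otimes>\<^bsub>AD\<^esub> ?r" using Fn unfolding Fn' .
  also have "\<dots> = const g \<otimes>\<^bsub>AD\<^esub> coact b"
    unfolding h using c cn by (simp add: AD.m_ac)
  finally have key: "const b \<otimes>\<^bsub>AD\<^esub> coact g = const g \<otimes>\<^bsub>AD\<^esub> coact b" .
  have comp: "b \<otimes> coact g d = g \<otimes> coact b d" if d: "d \<in> carrier D" for d
    using key const_mult_app[OF bg(1) coact_closed[OF bg(2)] d] const_mult_app[OF bg(2) coact_closed[OF bg(1)] d]
    by simp
  have fP: "f \<notin> P" using m(3) by (simp add: basic_open_def)
  \<comment> \<open>Next, g is outside P like f; hence g is outside the homogeneous core of P, and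
    some component of g is outside P.\<close>
  then have fn: "f [^] n \<in> carrier A - P" using P.pow_mem[OF m(2)] m(2) by auto
  then have "g \<notin> P" using primeideal_mult_notin_iff[OF P' m(2), of "f [^] n"] fP unfolding g_def by blast
  then have "g \<notin> homogeneous_core P" using homogeneous_core_subset[OF P.is_ideal] by blast
  then obtain d where d: "d \<in> carrier D" "coact g d \<notin> P" using bg(2) by (auto simp: homogeneous_core_def)
  have gd: "coact g d \<in> \<A> d" by (rule coact_graded[OF bg(2) d(1)])
  obtain e where e: "e \<in> \<A> (inv\<^bsub>D\<^esub> d)" "coact g d \<otimes> e \<in> \<B>" "coact g d \<otimes> e \<notin> P"
    using exists_degree_zero_multiple[OF P' d(1) gd d(2)] .
  have cl: "coact g d \<in> carrier A" "coact b d \<in> carrier A" "e \<in> carrier A"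
    using coact_in_carrier[OF bg(2) d(1)] coact_in_carrier[OF bg(1) d(1)] graded_closed[OF _ e(1)] d(1) by simp_all
  \<comment> \<open>The components of b and g in degree d have the same degree, so the factor e that
    moves the denominator to degree zero does the same for the numerator.\<close>
  have num: "coact b d \<otimes> e \<in> \<B>"
    using graded_mult[OF d(1) _ coact_graded[OF bg(1) d(1)] e(1)] d(1) by simp
  have gP: "g \<in> carrier A - P" using \<open>g \<notin> P\<close> bg(2) by blast
  have ue: "coact g d \<otimes> e \<in> carrier A - P" using e(3) cl by blast
  have "s P = frac_at A P a f" by (rule s_eq[OF m(3)])
  also have "\<dots> = frac_at A P b g"
    unfolding b_def g_def using L.frac_expand[OF m(1) basic_openD[OF m(3,2)] fn] by simp
  also have "\<dots> = frac_at A P (coact b d \<otimes> e) (coact g d \<otimes> e)"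
  proof (rule L.frac_eqI[OF bg(1) gP _ ue])
    have "b \<otimes> (coact g d \<otimes> e) = (b \<otimes> coact g d) \<otimes> e" using bg cl by (simp add: m_assoc)
    also have "\<dots> = (coact b d \<otimes> e) \<otimes> g" unfolding comp[OF d(1)] using bg cl by (simp add: m_ac)
    finally show "b \<otimes> (coact g d \<otimes> e) = (coact b d \<otimes> e) \<otimes> g" .
  qed (use cl in simp)
  finally show thesis using that[OF num _] e(2,3) by blast
qed

text \<open>The coaction and the constant embedding agree on b and v, so invariance at q becomes an
  equality of two fractions of constants in the local ring of A[D] at q. It descends first to A by
  \<open>loc_map_const_inj\<close>, then to A_0 by \<open>loc_map_degree_zero_inj\<close>.\<close>

lemma invariant_section_proj_act:
  assumes s: "invariant_section V s" and q: "primeideal q AD" "contr0 (proj_pt q) \<in> V"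
    and a: "a \<in> \<B>" "u \<in> \<B> - proj_pt q"
    and b: "b \<in> \<B>" "v \<in> \<B> - act_pt q"
    and sp: "s (proj_pt q) = frac_at A (proj_pt q) a u"
    and sa: "s (act_pt q) = frac_at A (act_pt q) b v"
  shows "frac_at A0 (contr0 (proj_pt q)) a u = frac_at A0 (contr0 (proj_pt q)) b v"
proof -
  have c: "a \<in> carrier A" "b \<in> carrier A" "u \<in> carrier A" "v \<in> carrier A"
    using a b degree_zero_closed by blast+
  have u: "u \<in> carrier A - proj_pt q" using a c by blast
  have v: "v \<in> carrier A - act_pt q" using b c by blast
  have bv: "coact b = const b" "coact v = const v" using b coact_degree_zero by blast+
  have "v \<notin> proj_pt q" using v bv(2) c(4) unfolding contraction_def by simp
  then have v': "v \<in> carrier A - proj_pt q" "v \<in> \<B> - proj_pt q" using c(4) b(2) by blast+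
  have "loc_map AD coact q (s (act_pt q)) = loc_map AD const q (s (proj_pt q))"
    using s q by (simp add: invariant_section_def)
  then have "frac_at AD q (const b) (const v) = frac_at AD q (const a) (const u)"
    unfolding sp sa loc_map_frac[OF A_cring coact_hom q(1) c(2) v] loc_map_frac[OF A_cring const_hom q(1) c(1) u] bv .
  from loc_map_const_inj[OF q(1) c(1,2) u v'(1) this[symmetric]] show ?thesis
    by (rule loc_map_degree_zero_inj[OF proj_pt_prime[OF q(1)] a(1) b(1) a(2) v'(2)])
qed

text \<open>Both P and Q are joined by points of \<open>Spec A[D]\<close> to a common third prime.
  There s is again a fraction c / w over A_0, and both given fractions are compared with it.\<close>

lemma invariant_section_fibre:
  assumes s: "invariant_section V s" and P: "P \<in> preim0 V" and Q: "primeideal Q A" "contr0 Q = contr0 P"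
    and a: "a \<in> \<B>" "u \<in> \<B> - P" and b: "b \<in> \<B>" "v \<in> \<B> - Q"
    and sP: "s P = frac_at A P a u" and sQ: "s Q = frac_at A Q b v"
  shows "frac_at A0 (contr0 P) a u = frac_at A0 (contr0 P) b v"
proof -
  have P': "primeideal P A" "contr0 P \<in> V" using P by simp_all
  obtain q q' where q: "primeideal q AD" "primeideal q' AD" "proj_pt q = P" "proj_pt q' = Q"
    "act_pt q = act_pt q'"
    using same_contr0_related[OF P'(1) Q(1) Q(2)[symmetric]] .
  have V: "contr0 (proj_pt q) \<in> V" "contr0 (proj_pt q') \<in> V" using P'(2) Q(2) q(3,4) by simp_all
  have N: "act_pt q \<in> preim0 V"
    using act_pt_prime[OF q(1)] V(1) by (simp add: contr0_act_proj)
  obtain c w where c: "c \<in> \<B>" "w \<in> \<B> - act_pt q"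
    "s (act_pt q) = frac_at A (act_pt q) c w"
    using invariant_section_local[OF s N] .
  have 1: "frac_at A0 (contr0 P) a u = frac_at A0 (contr0 P) c w"
    by (rule invariant_section_proj_act[OF s q(1) V(1) a(1) _ c(1,2) _ c(3), unfolded q(3), OF a(2) sP])
  have 2: "frac_at A0 (contr0 Q) b v = frac_at A0 (contr0 Q) c w"
    by (rule invariant_section_proj_act[OF s q(2) V(2) b(1) _ c(1,2)[unfolded q(5)] _ c(3)[unfolded q(5)],
          unfolded q(4), OF b(2) sQ])
  show ?thesis using 1 2 unfolding Q(2) by simp
qed

lemma loc_map_inclusion_frac:
  assumes "primeideal P A" "a \<in> \<B>" "u \<in> \<B> - P"
  shows "loc_map A (\<lambda>a. a) P (frac_at A0 (contr0 P) a u) = frac_at A P a u"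
  by (rule loc_map_frac[OF degree_zero_cring degree_zero_inclusion_hom assms(1)])
    (use assms in \<open>simp_all add: contr0_mem\<close>)

lemma loc_map_inclusion_inj:
  assumes P: "primeideal P A" and x: "x \<in> carrier (loc_at A0 (contr0 P))" and y: "y \<in> carrier (loc_at A0 (contr0 P))"
    and eq: "loc_map A (\<lambda>a. a) P x = loc_map A (\<lambda>a. a) P y"
  shows "x = y"
proof -
  interpret M: localized_cring A0 "carrier A0 - contr0 P"
    by (rule primeideal.localized_cring_compl[OF contr0_prime[OF P]])
  have compl: "u \<in> \<B> - P" if "u \<in> carrier A0 - contr0 P" for u
    using that by (simp add: contr0_mem)
  obtain a u where a: "a \<in> carrier A0" "u \<in> carrier A0 - contr0 P" "x = frac_at A0 (contr0 P) a u"
    using x by (rule M.localizationE)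
  obtain b v where b: "b \<in> carrier A0" "v \<in> carrier A0 - contr0 P" "y = frac_at A0 (contr0 P) b v"
    using y by (rule M.localizationE)
  have ab: "a \<in> \<B>" "b \<in> \<B>" using a(1) b(1) by simp_all
  have "frac_at A P a u = frac_at A P b v"
    using eq unfolding a(3) b(3) loc_map_inclusion_frac[OF P ab(1) compl[OF a(2)]]
      loc_map_inclusion_frac[OF P ab(2) compl[OF b(2)]] .
  from loc_map_degree_zero_inj[OF P ab compl[OF a(2)] compl[OF b(2)] this] show ?thesis
    unfolding a(3) b(3) .
qed

lemma invariant_section_descends:
  assumes s: "invariant_section V s"
  obtains t where "t \<in> spec_sections A0 V"
    "\<forall>P\<in>preim0 V. s P = loc_map A (\<lambda>a. a) P (t (contr0 P))"
proof -
  have V: "openin (zariski A0) V" and sS: "s \<in> spec_sections A (preim0 V)"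
    using s by (simp_all add: invariant_section_def)
  \<comment> \<open>The relation \<open>val p x\<close> collects the candidates for the value at p,
    one for each prime over p and each degree zero fraction that represents s there. By
    \<open>invariant_section_fibre\<close> all candidates coincide, so the choice in
    \<open>t\<close> is harmless.\<close>
  define val where "val p x \<longleftrightarrow> (\<exists>P a u. primeideal P A \<and> contr0 P = p \<and> a \<in> \<B> \<and> u \<in> \<B> - P \<and>
    s P = frac_at A P a u \<and> x = frac_at A0 p a u)" for p x
  define t where "t = (\<lambda>p\<in>V. SOME x. val p x)"
  have t_eq: "t (contr0 P) = frac_at A0 (contr0 P) a u"
    if P: "P \<in> preim0 V" and a: "a \<in> \<B>" "u \<in> \<B> - P" and sP: "s P = frac_at A P a u" for P a u
  proof -
    have P': "primeideal P A" "contr0 P \<in> V" using P by simp_all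
    have "val (contr0 P) (frac_at A0 (contr0 P) a u)"
      unfolding val_def using P'(1) a sP by blast
    then have "val (contr0 P) (t (contr0 P))"
      unfolding t_def using P'(2) someI[of "val (contr0 P)"] by simp
    then obtain Q b v where Q: "primeideal Q A" "contr0 Q = contr0 P" "b \<in> \<B>" "v \<in> \<B> - Q"
      "s Q = frac_at A Q b v" "t (contr0 P) = frac_at A0 (contr0 P) b v"
      unfolding val_def by blast
    from invariant_section_fibre[OF s P Q(1,2) a Q(3,4) sP Q(5)] show ?thesis unfolding Q(6) by (rule sym)
  qed
  have image: "s P = loc_map A (\<lambda>a. a) P (t (contr0 P))" if P: "P \<in> preim0 V" for P
  proof -
    obtain a u where a: "a \<in> \<B>" "u \<in> \<B> - P" "s P = frac_at A P a u"
      using invariant_section_local[OF s P] .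
    have P': "primeideal P A" using P by simp
    show ?thesis unfolding t_eq[OF P a] loc_map_inclusion_frac[OF P' a(1,2)] by (rule a(3))
  qed
  have prime: "primeideal p A0" if "p \<in> V" for p by (rule openin_zariski_prime[OF V that])
  have local: "\<exists>W a u. openin (zariski A0) W \<and> p \<in> W \<and> W \<subseteq> V \<and> a \<in> \<B> \<and> u \<in> \<B> \<and>
      (\<forall>p'\<in>W. u \<notin> p' \<and> t p' = frac_at A0 p' a u)" if p: "p \<in> V" for p
  proof -
    obtain P where P: "primeideal P A" "contr0 P = p" using exists_prime_over[OF prime[OF p]] .
    have PV: "P \<in> preim0 V" using P p by simp
    obtain a u where a: "a \<in> \<B>" "u \<in> \<B> - P" "s P = frac_at A P a u"
      using invariant_section_local[OF s PV] .
    have au: "a \<in> carrier A" "u \<in> carrier A" using a degree_zero_closed by blast+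
    \<comment> \<open>The locus on which t is given by one fixed fraction a / u. Its openness, which
      makes t a section, is checked on the preimage in \<open>Spec A\<close>: this is the locus
      where s is a / u, and there local fractions of s are at hand.\<close>
    define W where "W = {p' \<in> V. u \<notin> p' \<and> t p' = frac_at A0 p' a u}"
    have W_iff: "contr0 Q \<in> W \<longleftrightarrow> u \<notin> Q \<and> s Q = frac_at A Q a u"
      if Q: "Q \<in> preim0 V" for Q
    proof -
      have Q': "primeideal Q A" "contr0 Q \<in> V" using Q by simp_all
      have uQ: "u \<notin> contr0 Q \<longleftrightarrow> u \<notin> Q" using a(2) by (simp add: contr0_mem)
      show ?thesis
      proof
        assume "contr0 Q \<in> W"
        then have W: "u \<notin> Q" "t (contr0 Q) = frac_at A0 (contr0 Q) a u"
          using uQ unfolding W_def by simp_all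
        have "u \<in> \<B> - Q" using W(1) a(2) by blast
        from loc_map_inclusion_frac[OF Q'(1) a(1) this] image[OF Q] W
        show "u \<notin> Q \<and> s Q = frac_at A Q a u" by simp
      next
        assume W: "u \<notin> Q \<and> s Q = frac_at A Q a u"
        then have "u \<in> \<B> - Q" using a(2) by blast
        from t_eq[OF Q a(1) this] W uQ Q'(2) show "contr0 Q \<in> W" unfolding W_def by simp
      qed
    qed
    have "openin (zariski A) {Q. primeideal Q A \<and> contr0 Q \<in> W}"
    proof (rule openin_zariskiI)
      fix Q assume "Q \<in> {Q. primeideal Q A \<and> contr0 Q \<in> W}"
      then have Q: "primeideal Q A" "contr0 Q \<in> W" "Q \<in> preim0 V" unfolding W_def by simp_all
      interpret L: localized_cring A "carrier A - Q" by (rule primeideal.localized_cring_compl[OF Q(1)])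
      have uQ: "u \<in> carrier A - Q" and sQ: "s Q = frac_at A Q a u"
        using W_iff[OF Q(3)] Q(2) au(2) by simp_all
      obtain b f where bf: "has_local_fraction A (preim0 V) s Q b f"
        using sS Q(3) by (rule spec_sections_local)
      note m = has_local_fractionD(1-4)[OF bf] and s_eq = has_local_fractionD(5)[OF bf]
      have "frac_at A Q b f = frac_at A Q a u" using sQ s_eq[OF m(3)] by simp
      then obtain w where w: "w \<in> carrier A - Q" "w \<otimes> (b \<otimes> u) = w \<otimes> (a \<otimes> f)"
        using L.frac_eq_iff[OF m(1) basic_openD[OF m(3,2)] au(1) uQ] by blast
      \<comment> \<open>On the basic open set of this product s is still b / f, u is still a
        denominator, and w still witnesses b / f = a / u.\<close>
      let ?g = "f \<otimes> (u \<otimes> w)"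
      have wA: "w \<in> carrier A" using w(1) by blast
      have g: "basic_open A ?g = basic_open A f \<inter> (basic_open A u \<inter> basic_open A w)"
        using m(2) au(2) wA by (simp add: basic_open_mult)
      have "Q \<in> basic_open A ?g" unfolding g using m(3) uQ w(1) Q(1) by (simp add: basic_open_def)
      moreover have "basic_open A ?g \<subseteq> {Q. primeideal Q A \<and> contr0 Q \<in> W}"
      proof
        fix Q' assume "Q' \<in> basic_open A ?g"
        then have Q': "Q' \<in> basic_open A f" "Q' \<in> basic_open A u" "Q' \<in> basic_open A w" unfolding g by blast+
        have pQ': "primeideal Q' A" by (rule basic_open_prime[OF Q'(1)])
        interpret L': localized_cring A "carrier A - Q'" by (rule primeideal.localized_cring_compl[OF pQ'])
        note u' = basic_openD[OF Q'(2) au(2)]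
        have sQ': "s Q' = frac_at A Q' a u"
          unfolding s_eq[OF Q'(1)] L'.frac_eq_iff[OF m(1) basic_openD[OF Q'(1) m(2)] au(1) u']
          using w(2) basic_openD[OF Q'(3) wA] by (rule bexI)
        have Q'V: "Q' \<in> preim0 V" using Q'(1) m(4) by (rule subsetD[rotated])
        have "u \<notin> Q'" using u' unfolding Diff_iff by (rule conjunct2)
        then have "contr0 Q' \<in> W" using W_iff[OF Q'V] sQ' by (simp only: simp_thms)
        then show "Q' \<in> {Q. primeideal Q A \<and> contr0 Q \<in> W}" using pQ' by simp
      qed
      ultimately show "\<exists>g\<in>carrier A. Q \<in> basic_open A g \<and> basic_open A g \<subseteq> {Q. primeideal Q A \<and> contr0 Q \<in> W}"
        using m(2) au(2) wA by (intro bexI[of _ ?g] conjI) simp_all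
    qed
    then have opW: "openin (zariski A0) W"
    proof (rule openin_degree_zero_iff[rotated])
      show "primeideal p' A0" if "p' \<in> W" for p' using that prime unfolding W_def by simp
    qed
    have pW: "p \<in> W" using W_iff[OF PV] a(2,3) unfolding P(2) by simp
    have "W \<subseteq> V" "\<forall>p'\<in>W. u \<notin> p' \<and> t p' = frac_at A0 p' a u"
      unfolding W_def by simp_all
    then show ?thesis
      using opW pW a(1,2) by (intro exI[of _ W] exI[of _ a] exI[of _ u]) simp
  qed
  have "t \<in> spec_sections A0 V"
  proof -
    have "t p \<in> carrier (loc_at A0 p)" if p: "p \<in> V" for p
    proof -
      obtain W a u where W: "p \<in> W" "a \<in> \<B>" "u \<in> \<B>"
        "\<forall>p'\<in>W. u \<notin> p' \<and> t p' = frac_at A0 p' a u"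
        using local[OF p] by blast
      interpret M: localized_cring A0 "carrier A0 - p" by (rule primeideal.localized_cring_compl[OF prime[OF p]])
      show ?thesis using W M.frac_closed[of a u] by simp
    qed
    moreover have "\<exists>W. openin (zariski A0) W \<and> p \<in> W \<and> W \<subseteq> V \<and> (\<exists>a\<in>carrier A0. \<exists>u\<in>carrier A0.
        \<forall>p'\<in>W. u \<notin> p' \<and> t p' = frac_at A0 p' a u)" if "p \<in> V" for p
      using local[OF that] by simp blast
    ultimately show ?thesis
      unfolding spec_sections_def PiE_def Pi_def by (simp add: t_def)
  qed
  then show thesis using that image by blast
qed

end


section \<open>The quotient\<close>

context degree_zero_radical
begin

abbreviation (input) quot where "quot \<equiv> Spec_map A0 A (\<lambda>a. a)"

lemma lrs_morphism_quot: "lrs_morphism (Spec A) (Spec A0) quot"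
  by (rule lrs_morphism_Spec_map[OF degree_zero_cring A_cring degree_zero_inclusion_hom])

lemma lrs_morphism_action: "lrs_morphism (Spec AD) (Spec A) (action_map A D \<A>)"
  unfolding action_map_def by (rule lrs_morphism_Spec_map[OF A_cring AD.is_cring coact_hom])

lemma lrs_morphism_proj: "lrs_morphism (Spec AD) (Spec A) (proj_map A D)"
  unfolding proj_map_def by (rule lrs_morphism_Spec_map[OF A_cring AD.is_cring const_hom])

lemma quot_preim: "preim (Spec A) quot V = preim0 V"
  by simp

text \<open>Sections are compared at a prime over each p, where the map of local rings is injective.
  Identities between sections over A_0 can therefore be checked after pullback; this gives the ring
  homomorphism laws, the compatibility with restrictions and the uniqueness of the
  factorization.\<close>

lemma quot_comorph_inj:
  assumes t: "t \<in> spec_sections A0 V" "t' \<in> spec_sections A0 V" and V: "openin (zariski A0) V"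
    and eq: "comorph quot V t = comorph quot V t'"
  shows "t = t'"
proof (rule spec_sections_eqI[OF t])
  fix p assume p: "p \<in> V"
  obtain P where P: "primeideal P A" "contr0 P = p"
    using exists_prime_over[OF openin_zariski_prime[OF V p]] .
  have "loc_map A (\<lambda>a. a) P (t p) = loc_map A (\<lambda>a. a) P (t' p)"
    using fun_cong[OF eq, of P] P p by simp
  moreover have "t p \<in> carrier (loc_at A0 (contr0 P))" "t' p \<in> carrier (loc_at A0 (contr0 P))"
    unfolding P(2) by (rule spec_sections_memD(2)[OF t(1) p], rule spec_sections_memD(2)[OF t(2) p])
  ultimately show "t p = t' p" using loc_map_inclusion_inj[OF P(1)] by blast
qed

lemma quot_comorph_surj:
  assumes s: "invariant_section V s"
  obtains t where "t \<in> spec_sections A0 V" "comorph quot V t = s"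
proof -
  obtain t where t: "t \<in> spec_sections A0 V"
    "\<forall>P\<in>preim0 V. s P = loc_map A (\<lambda>a. a) P (t (contr0 P))"
    using invariant_section_descends[OF s] .
  have "s \<in> extensional (preim0 V)"
    using s spec_sections_memD(1) unfolding invariant_section_def by blast
  then have "comorph quot V t = s"
    unfolding Spec_map_simps(2) by (rule extensionalityI[rotated]) (simp_all add: t(2))
  then show thesis using that t(1) by blast
qed

text \<open>The coaction and the constant embedding restrict to the same map from A_0 to A[D]. For
  sections this is verified at each q by writing the value of t as a fraction of degree zero
  elements.\<close>

lemma quot_coequalizes:
  "rs_map_eq (Spec AD) (Spec A0) (rs_comp (Spec A) quot (action_map A D \<A>)) (rs_comp (Spec A) quot (proj_map A D))"
  unfolding rs_map_eq_def
proof (intro conjI ballI allI impI)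
  fix q show "pmap (rs_comp (Spec A) quot (action_map A D \<A>)) q = pmap (rs_comp (Spec A) quot (proj_map A D)) q"
    by (simp add: rs_comp_def action_map_def proj_map_def contr0_act_proj)
next
  fix V t assume t: "openin (topol (Spec A0)) V \<and> t \<in> carrier (sect (Spec A0) V)"
  have tS: "t \<in> spec_sections A0 V" using t by simp
  have val: "loc_map AD coact q (comorph quot V t (act_pt q)) = loc_map AD const q (comorph quot V t (proj_pt q))"
    if q: "primeideal q AD" and V: "contr0 (proj_pt q) \<in> V" for q
  proof -
    note pr = act_pt_prime[OF q] proj_pt_prime[OF q]
    have p: "primeideal (contr0 (proj_pt q)) A0" by (rule contr0_prime[OF pr(2)])
    interpret M: localized_cring A0 "carrier A0 - contr0 (proj_pt q)" by (rule primeideal.localized_cring_compl[OF p])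
    obtain a u where a: "a \<in> carrier A0" "u \<in> carrier A0 - contr0 (proj_pt q)"
      "t (contr0 (proj_pt q)) = frac_at A0 (contr0 (proj_pt q)) a u"
      using spec_sections_memD(2)[OF tS V] by (rule M.localizationE)
    have a0: "a \<in> \<B>" "u \<in> \<B> - proj_pt q" using a(1,2) by (simp_all add: contr0_mem)
    have u': "u \<in> \<B> - act_pt q"
      using a(2) unfolding contr0_act_proj[symmetric] by (simp add: contr0_mem)
    have cl: "a \<in> carrier A" "u \<in> carrier A - proj_pt q" "u \<in> carrier A - act_pt q"
      using a0 u' degree_zero_closed by blast+
    have "comorph quot V t (proj_pt q) = frac_at A (proj_pt q) a u"
      using loc_map_inclusion_frac[OF pr(2) a0] pr(2) V a(3) by simp
    moreover have "comorph quot V t (act_pt q) = frac_at A (act_pt q) a u"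
      using loc_map_inclusion_frac[OF pr(1) a0(1) u'] pr(1) V a(3) by (simp add: contr0_act_proj)
    moreover have "coact a = const a" "coact u = const u" using a0 coact_degree_zero by blast+
    ultimately show ?thesis
      using loc_map_frac[OF A_cring coact_hom q cl(1,3)] loc_map_frac[OF A_cring const_hom q cl(1,2)] by simp
  qed
  have dom: "{q. primeideal q AD \<and> act_pt q \<in> preim0 V} = {q. primeideal q AD \<and> contr0 (proj_pt q) \<in> V}"
    "{q. primeideal q AD \<and> proj_pt q \<in> preim0 V} = {q. primeideal q AD \<and> contr0 (proj_pt q) \<in> V}"
    using act_pt_prime proj_pt_prime contr0_act_proj by auto
  have "comorph (action_map A D \<A>) (preim0 V) (comorph quot V t) = comorph (proj_map A D) (preim0 V) (comorph quot V t)"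
    unfolding action_map_def proj_map_def Spec_map_simps(2)[of A] dom
    by (rule restrict_ext) (use val in blast)
  then show "comorph (rs_comp (Spec A) quot (action_map A D \<A>)) V t = comorph (rs_comp (Spec A) quot (proj_map A D)) V t"
    by (simp only: rs_comp_def rs_map.simps quot_preim)
qed

section \<open>Factorization of an invariant morphism through the quotient\<close>

context
  fixes Z :: "('z, 't) rspace" and h
  assumes h: "lrs_morphism (Spec A) Z h"
    and coeq: "rs_map_eq (Spec AD) Z (rs_comp (Spec A) h (action_map A D \<A>)) (rs_comp (Spec A) h (proj_map A D))"
begin

interpretation h: lrs_morphism "Spec A" Z h by (rule h)
interpretation quot: lrs_morphism "Spec A" "Spec A0" quot by (rule lrs_morphism_quot)
interpretation rh: rs_morphism "Spec A" Z h by (rule h.rs_morphism)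
interpretation rq: rs_morphism "Spec A" "Spec A0" quot by (rule quot.rs_morphism)

lemma pmap_act_proj: "primeideal q AD \<Longrightarrow> pmap h (act_pt q) = pmap h (proj_pt q)"
  using coeq by (auto simp: rs_map_eq_def rs_comp_def action_map_def proj_map_def topspace_zariski)

lemma pmap_fibre:
  assumes "primeideal P A" "primeideal Q A" "contr0 P = contr0 Q"
  shows "pmap h P = pmap h Q"
proof -
  obtain q q' where q: "primeideal q AD" "primeideal q' AD" "proj_pt q = P" "proj_pt q' = Q"
    "act_pt q = act_pt q'"
    using same_contr0_related[OF assms] .
  then show ?thesis using pmap_act_proj[OF q(1)] pmap_act_proj[OF q(2)] by simp
qed

text \<open>By \<open>pmap_fibre\<close> any prime over p gives the same value.\<close>

definition factor_point :: "'a set \<Rightarrow> 'z" where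
  "factor_point p = pmap h (SOME P. primeideal P A \<and> contr0 P = p)"

lemma factor_point_contr0:
  assumes P: "primeideal P A"
  shows "factor_point (contr0 P) = pmap h P"
proof -
  have "primeideal P A \<and> contr0 P = contr0 P" using P by simp
  from someI[of "\<lambda>Q. primeideal Q A \<and> contr0 Q = contr0 P", OF this]
  show ?thesis unfolding factor_point_def using pmap_fibre P by blast
qed

text \<open>The preimage of W under \<open>factor_point\<close>. It is needed before
  \<open>factor\<close> exists, because the comorphism takes values in the sections over it.\<close>

definition factor_open :: "'z set \<Rightarrow> 'a set set" where
  "factor_open W = {p. primeideal p A0 \<and> factor_point p \<in> W}"

lemma preim0_factor_open: "preim0 (factor_open W) = preim (Spec A) h W"
  using contr0_prime by (auto simp: factor_open_def factor_point_contr0 preim_def topspace_zariski)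

lemma openin_factor_open:
  assumes "openin (topol Z) W"
  shows "openin (zariski A0) (factor_open W)"
proof (rule openin_degree_zero_iff)
  show "openin (zariski A) (preim0 (factor_open W))"
    unfolding preim0_factor_open using rh.openin_preim[OF assms] by simp
qed (simp add: factor_open_def)

text \<open>The two composites with h have the same comorphism; evaluated at q, this is the
  invariance condition.\<close>

lemma comorph_invariant:
  assumes W: "openin (topol Z) W" and t: "t \<in> carrier (sect Z W)"
  shows "invariant_section (factor_open W) (comorph h W t)"
  unfolding invariant_section_def
proof (intro conjI allI impI openin_factor_open[OF W])
  show "comorph h W t \<in> spec_sections A (preim0 (factor_open W))"
    unfolding preim0_factor_open using ring_hom_closed[OF h.comorph_hom[OF W] t] by simp
  fix q assume q: "primeideal q AD \<and> contr0 (proj_pt q) \<in> factor_open W"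
  have "comorph (action_map A D \<A>) (preim (Spec A) h W) (comorph h W t)
      = comorph (proj_map A D) (preim (Spec A) h W) (comorph h W t)"
    using coeq W t by (simp add: rs_map_eq_def rs_comp_def)
  from fun_cong[OF this, of q] show "loc_map AD coact q (comorph h W t (act_pt q))
      = loc_map AD const q (comorph h W t (proj_pt q))"
    unfolding action_map_def proj_map_def Spec_map_simps(2) preim0_factor_open[symmetric]
    using q act_pt_prime[of q] proj_pt_prime[of q] by (simp add: contr0_act_proj)
qed

text \<open>For a section t over an open set W such an s exists by \<open>quot_comorph_surj\<close>
  and is unique by \<open>quot_comorph_inj\<close>.\<close>

definition factor_comorph :: "'z set \<Rightarrow> 't \<Rightarrow> 'a set \<Rightarrow> ('a \<times> 'a) set" where
  "factor_comorph W t = (SOME s. s \<in> spec_sections A0 (factor_open W) \<and> comorph quot (factor_open W) s = comorph h W t)"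

lemma factor_comorph:
  assumes "openin (topol Z) W" "t \<in> carrier (sect Z W)"
  shows "factor_comorph W t \<in> spec_sections A0 (factor_open W)"
    and "comorph quot (factor_open W) (factor_comorph W t) = comorph h W t"
proof -
  obtain s where "s \<in> spec_sections A0 (factor_open W) \<and> comorph quot (factor_open W) s = comorph h W t"
    using quot_comorph_surj[OF comorph_invariant[OF assms]] by blast
  from someI[of "\<lambda>s. s \<in> spec_sections A0 (factor_open W) \<and> comorph quot (factor_open W) s = comorph h W t", OF this]
  show "factor_comorph W t \<in> spec_sections A0 (factor_open W)"
    "comorph quot (factor_open W) (factor_comorph W t) = comorph h W t"
    unfolding factor_comorph_def by blast+
qed

definition factor :: "('a set, 'a set \<Rightarrow> ('a \<times> 'a) set, 'z, 't) rs_map" where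
  "factor = \<lparr>pmap = factor_point, comorph = factor_comorph\<rparr>"

lemma factor_simps:
  "pmap factor = factor_point" "comorph factor = factor_comorph"
  "preim (Spec A0) factor W = factor_open W"
  by (simp_all add: factor_def preim_def factor_open_def topspace_zariski)

lemma quot_preim_factor_open: "preim (Spec A) quot (factor_open W) = preim (Spec A) h W"
  unfolding quot_preim by (rule preim0_factor_open)

text \<open>Every identity required of \<open>factor_comorph\<close> is checked after pullback to
  \<open>Spec A\<close>. There \<open>factor_comorph\<close> becomes the comorphism of h, for which
  the identity is known.\<close>

lemma rs_morphism_factor: "rs_morphism (Spec A0) Z factor"
proof (rule rs_morphism.intro[OF A0.ringed_space_Spec h.target.ringed_space_axioms rs_morphism_axioms.intro])
  show "continuous_map (topol (Spec A0)) (topol Z) (pmap factor)"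
    unfolding continuous_map_def
  proof (intro conjI allI impI)
    show "pmap factor \<in> topspace (topol (Spec A0)) \<rightarrow> topspace (topol Z)"
    proof
      fix p assume "p \<in> topspace (topol (Spec A0))"
      then have p: "primeideal p A0" by (simp add: topspace_zariski)
      obtain P where P: "primeideal P A" "contr0 P = p" using exists_prime_over[OF p] .
      show "pmap factor p \<in> topspace (topol Z)"
        unfolding factor_simps P(2)[symmetric] factor_point_contr0[OF P(1)]
        by (rule rh.pmap_in_topspace) (simp add: topspace_zariski P(1))
    qed
    fix W assume "openin (topol Z) W"
    then show "openin (topol (Spec A0)) {x \<in> topspace (topol (Spec A0)). pmap factor x \<in> W}"
      using openin_factor_open[of W] by (simp add: factor_simps factor_open_def topspace_zariski)
  qed
next
  fix W assume W: "openin (topol Z) W"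
  let ?V = "factor_open W"
  have V: "openin (zariski A0) ?V" by (rule openin_factor_open[OF W])
  have V': "openin (topol (Spec A0)) ?V" using V by simp
  note fc = factor_comorph[OF W]
  note hq = quot.comorph_hom[OF V', unfolded quot_preim_factor_open]
  note hh = h.comorph_hom[OF W]
  interpret sZ: cring "sect Z W" by (rule h.target.cring_sect[OF W])
  interpret sE: cring "sect (Spec A0) ?V" by (rule A0.Spec_sect_cring[OF V])
  have fc': "factor_comorph W t \<in> carrier (sect (Spec A0) ?V)" if "t \<in> carrier (sect Z W)" for t
    using fc(1)[OF that] by simp
  have inj: "x = y" if "x \<in> carrier (sect (Spec A0) ?V)" "y \<in> carrier (sect (Spec A0) ?V)"
    "comorph quot ?V x = comorph quot ?V y" for x y
    using quot_comorph_inj[OF _ _ V that(3)] that(1,2) unfolding Spec_simps(2) by blast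
  have "factor_comorph W \<in> ring_hom (sect Z W) (sect (Spec A0) ?V)"
  proof (rule ring_hom_memI)
    fix s t assume s: "s \<in> carrier (sect Z W)" and t: "t \<in> carrier (sect Z W)"
    note cs = fc'[OF s] fc'[OF t]
    show "factor_comorph W (s \<otimes>\<^bsub>sect Z W\<^esub> t)
        = factor_comorph W s \<otimes>\<^bsub>sect (Spec A0) ?V\<^esub> factor_comorph W t"
    proof (rule inj[OF fc'[OF sZ.m_closed[OF s t]] sE.m_closed[OF cs]])
      show "comorph quot ?V (factor_comorph W (s \<otimes>\<^bsub>sect Z W\<^esub> t))
        = comorph quot ?V (factor_comorph W s \<otimes>\<^bsub>sect (Spec A0) ?V\<^esub> factor_comorph W t)"
        unfolding fc(2)[OF sZ.m_closed[OF s t]] ring_hom_mult[OF hh s t] ring_hom_mult[OF hq cs] fc(2)[OF s] fc(2)[OF t]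
        by (rule refl)
    qed
    show "factor_comorph W (s \<oplus>\<^bsub>sect Z W\<^esub> t)
        = factor_comorph W s \<oplus>\<^bsub>sect (Spec A0) ?V\<^esub> factor_comorph W t"
    proof (rule inj[OF fc'[OF sZ.a_closed[OF s t]] sE.a_closed[OF cs]])
      show "comorph quot ?V (factor_comorph W (s \<oplus>\<^bsub>sect Z W\<^esub> t))
        = comorph quot ?V (factor_comorph W s \<oplus>\<^bsub>sect (Spec A0) ?V\<^esub> factor_comorph W t)"
        unfolding fc(2)[OF sZ.a_closed[OF s t]] ring_hom_add[OF hh s t] ring_hom_add[OF hq cs] fc(2)[OF s] fc(2)[OF t]
        by (rule refl)
    qed
  next
    show "factor_comorph W \<one>\<^bsub>sect Z W\<^esub> = \<one>\<^bsub>sect (Spec A0) ?V\<^esub>"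
    proof (rule inj[OF fc'[OF sZ.one_closed] sE.one_closed])
      show "comorph quot ?V (factor_comorph W \<one>\<^bsub>sect Z W\<^esub>) = comorph quot ?V \<one>\<^bsub>sect (Spec A0) ?V\<^esub>"
        unfolding fc(2)[OF sZ.one_closed] ring_hom_one[OF hh] ring_hom_one[OF hq] by (rule refl)
    qed
  qed (rule fc')
  then show "comorph factor W \<in> ring_hom (sect Z W) (sect (Spec A0) (preim (Spec A0) factor W))"
    unfolding factor_simps .
next
  fix W W' t assume W: "openin (topol Z) W" "openin (topol Z) W'" "W' \<subseteq> W" and t: "t \<in> carrier (sect Z W)"
  have V: "openin (zariski A0) (factor_open W)" "openin (zariski A0) (factor_open W')"
    using W openin_factor_open by blast+
  have sub: "factor_open W' \<subseteq> factor_open W" using W(3) by (auto simp: factor_open_def)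
  have r: "restr Z W W' t \<in> carrier (sect Z W')" by (rule h.target.restr_closed[OF W t])
  note fc = factor_comorph[OF W(1) t] and fc' = factor_comorph[OF W(2) r]
  have "factor_comorph W' (restr Z W W' t) = restrict (factor_comorph W t) (factor_open W')"
  proof (rule quot_comorph_inj[OF fc'(1) _ V(2)])
    show "restrict (factor_comorph W t) (factor_open W') \<in> spec_sections A0 (factor_open W')"
      by (rule A0.spec_sections_restrict[OF V sub fc(1)])
    have fc1: "factor_comorph W t \<in> carrier (sect (Spec A0) (factor_open W))" using fc(1) by simp
    have "comorph quot (factor_open W') (restr (Spec A0) (factor_open W) (factor_open W') (factor_comorph W t))
        = restr (Spec A) (preim (Spec A) quot (factor_open W)) (preim (Spec A) quot (factor_open W'))
            (comorph quot (factor_open W) (factor_comorph W t))"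
      by (rule quot.comorph_restr[OF _ _ sub fc1]) (use V in simp_all)
    also have "\<dots> = restr (Spec A) (preim (Spec A) h W) (preim (Spec A) h W') (comorph h W t)"
      unfolding quot_preim_factor_open fc(2) ..
    also have "\<dots> = comorph h W' (restr Z W W' t)" by (rule h.comorph_restr[OF W t, symmetric])
    finally show "comorph quot (factor_open W') (factor_comorph W' (restr Z W W' t))
        = comorph quot (factor_open W') (restrict (factor_comorph W t) (factor_open W'))"
      unfolding fc'(2) Spec_simps(3) by (rule sym)
  qed
  then show "comorph factor W' (restr Z W W' t)
      = restr (Spec A0) (preim (Spec A0) factor W) (preim (Spec A0) factor W') (comorph factor W t)"
    unfolding factor_simps Spec_simps(3) .
qed

text \<open>For P over p the stalk map of h at P is the stalk map of \<open>factor\<close> at p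
  followed by that of the quotient at P. Its locality passes to the first factor by
  \<open>local_hom_factor\<close>.\<close>

lemma lrs_morphism_factor: "lrs_morphism (Spec A0) Z factor"
proof -
  interpret f: rs_morphism "Spec A0" Z factor by (rule rs_morphism_factor)
  have loc: "local_hom (stalk Z (pmap factor p)) (stalk (Spec A0) p) (stalk_map (Spec A0) factor p)"
    if "p \<in> topspace (topol (Spec A0))" for p
  proof -
    have p: "primeideal p A0" using that by (simp add: topspace_zariski)
    obtain P where P: "primeideal P A" "contr0 P = p" using exists_prime_over[OF p] .
    have PT: "P \<in> topspace (topol (Spec A))" using P(1) by (simp add: topspace_zariski)
    have hP: "pmap h P = pmap factor p"
      unfolding factor_simps P(2)[symmetric] by (rule factor_point_contr0[OF P(1), symmetric])
    have qP: "pmap quot P = p" using P(2) by simp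
    obtain N where N: "maximalideal N (stalk (Spec A) P)"
      using h.source.local_stalk[OF PT] unfolding local_ring_def by blast
    show ?thesis
    proof (rule local_hom_factor[OF A0.Spec_stalk_cring[OF p] Spec_stalk_cring[OF P(1)]
          h.local_stalk_map[OF PT, unfolded hP] f.stalk_map_hom[OF that] rq.stalk_map_hom[OF PT, unfolded qP]
          _ N A0.Spec_stalk_nonunits[OF p]])
      fix T assume "T \<in> carrier (stalk Z (pmap factor p))"
      then obtain W t where W: "(W, t) \<in> presections Z (pmap factor p)" "T = germ Z (pmap factor p) W t"
        by (rule h.target.stalkE)
      have op: "openin (topol Z) W" "t \<in> carrier (sect Z W)" using W(1) by (auto simp: h.target.presections_iff)
      have 1: "stalk_map (Spec A0) factor p T = germ (Spec A0) p (factor_open W) (factor_comorph W t)"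
        using f.stalk_map_germ[OF that W(1)] unfolding W(2) factor_simps .
      have pr: "(factor_open W, factor_comorph W t) \<in> presections (Spec A0) (pmap quot P)"
        using f.presections_comorph[OF that W(1)] unfolding factor_simps qP .
      have 2: "stalk_map (Spec A) quot P (germ (Spec A0) p (factor_open W) (factor_comorph W t))
          = germ (Spec A) P (preim (Spec A) h W) (comorph h W t)"
        using rq.stalk_map_germ[OF PT pr] unfolding qP quot_preim_factor_open factor_comorph(2)[OF op] .
      have "stalk_map (Spec A) h P (germ Z (pmap h P) W t) = germ (Spec A) P (preim (Spec A) h W) (comorph h W t)"
        by (rule rh.stalk_map_germ[OF PT]) (use W(1) hP in simp)
      then show "stalk_map (Spec A) h P T = stalk_map (Spec A) quot P (stalk_map (Spec A0) factor p T)"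
        unfolding 1[unfolded W(2)] W(2) 2 hP .
    qed
  qed
  show ?thesis
    by (rule lrs_morphism.intro[OF A0.locally_ringed_space_Spec h.target.locally_ringed_space_axioms
          lrs_morphism_axioms.intro[OF f.continuous f.comorph_hom f.comorph_restr loc]])
qed

lemma factor_quot: "rs_map_eq (Spec A) Z (rs_comp (Spec A0) factor quot) h"
  unfolding rs_map_eq_def
proof (intro conjI ballI allI impI)
  fix P assume "P \<in> topspace (topol (Spec A))"
  then have P: "primeideal P A" by (simp add: topspace_zariski)
  then show "pmap (rs_comp (Spec A0) factor quot) P = pmap h P"
    by (simp add: rs_comp_def factor_simps factor_point_contr0)
next
  fix W t assume "openin (topol Z) W \<and> t \<in> carrier (sect Z W)"
  then have W: "openin (topol Z) W" "t \<in> carrier (sect Z W)" by blast+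
  show "comorph (rs_comp (Spec A0) factor quot) W t = comorph h W t"
    using factor_comorph(2)[OF W] unfolding rs_comp_def rs_map.simps factor_simps .
qed

text \<open>Points agree because every prime of A_0 has a prime of A over it. This makes the
  preimages under k and k' equal, so their sections live over the same open set and agree by
  \<open>quot_comorph_inj\<close>.\<close>

lemma factor_unique:
  assumes k: "lrs_morphism (Spec A0) Z k" "rs_map_eq (Spec A) Z (rs_comp (Spec A0) k quot) h"
    and k': "lrs_morphism (Spec A0) Z k'" "rs_map_eq (Spec A) Z (rs_comp (Spec A0) k' quot) h"
  shows "rs_map_eq (Spec A0) Z k k'"
proof -
  interpret k: lrs_morphism "Spec A0" Z k by (rule k(1))
  interpret k': lrs_morphism "Spec A0" Z k' by (rule k'(1))
  have pt: "pmap k p = pmap k' p" if p: "primeideal p A0" for p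
  proof -
    obtain P where P: "primeideal P A" "contr0 P = p" using exists_prime_over[OF p] .
    have "pmap k (contr0 P) = pmap h P" "pmap k' (contr0 P) = pmap h P"
      using k(2) k'(2) P(1) by (simp_all add: rs_map_eq_def rs_comp_def topspace_zariski)
    then show ?thesis using P(2) by simp
  qed
  have pre: "preim (Spec A0) k W = preim (Spec A0) k' W" for W
    using pt by (auto simp: preim_def topspace_zariski)
  show ?thesis
    unfolding rs_map_eq_def
  proof (intro conjI ballI allI impI)
    show "pmap k p = pmap k' p" if "p \<in> topspace (topol (Spec A0))" for p
      using that pt by (simp add: topspace_zariski)
    fix W t assume "openin (topol Z) W \<and> t \<in> carrier (sect Z W)"
    then have W: "openin (topol Z) W" "t \<in> carrier (sect Z W)" by blast+
    have V: "openin (zariski A0) (preim (Spec A0) k W)"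
      using rs_morphism.openin_preim[OF k.rs_morphism W(1)] by simp
    have m: "comorph k W t \<in> spec_sections A0 (preim (Spec A0) k W)"
      "comorph k' W t \<in> spec_sections A0 (preim (Spec A0) k W)"
      using ring_hom_closed[OF k.comorph_hom[OF W(1)] W(2)] ring_hom_closed[OF k'.comorph_hom[OF W(1)] W(2)]
      unfolding pre[symmetric] by simp_all
    have "comorph quot (preim (Spec A0) k W) (comorph k W t) = comorph h W t"
      using k(2) W unfolding rs_map_eq_def rs_comp_def rs_map.simps by blast
    moreover have "comorph quot (preim (Spec A0) k' W) (comorph k' W t) = comorph h W t"
      using k'(2) W unfolding rs_map_eq_def rs_comp_def rs_map.simps by blast
    ultimately show "comorph k W t = comorph k' W t"
      using quot_comorph_inj[OF m V] unfolding pre[symmetric] by simp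
  qed
qed

end

lemma lrs_coequalizer_quot:
  "lrs_coequalizer TYPE('z \<times> 't) (Spec AD) (Spec A) (action_map A D \<A>) (proj_map A D) (Spec A0) quot"
  unfolding lrs_coequalizer_def
proof (intro conjI allI impI lrs_morphism_action lrs_morphism_proj lrs_morphism_quot quot_coequalizes)
  fix Z :: "('z, 't) rspace" and h
  assume "lrs_morphism (Spec A) Z h \<and>
    rs_map_eq (Spec AD) Z (rs_comp (Spec A) h (action_map A D \<A>)) (rs_comp (Spec A) h (proj_map A D))"
  then have h: "lrs_morphism (Spec A) Z h"
    "rs_map_eq (Spec AD) Z (rs_comp (Spec A) h (action_map A D \<A>)) (rs_comp (Spec A) h (proj_map A D))"
    by blast+
  show "\<exists>k. lrs_morphism (Spec A0) Z k \<and> rs_map_eq (Spec A) Z (rs_comp (Spec A0) k quot) h"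
    using lrs_morphism_factor[OF h] factor_quot[OF h] by blast
  show "rs_map_eq (Spec A0) Z k k'"
    if "lrs_morphism (Spec A0) Z k \<and> rs_map_eq (Spec A) Z (rs_comp (Spec A0) k quot) h \<and>
      lrs_morphism (Spec A0) Z k' \<and> rs_map_eq (Spec A) Z (rs_comp (Spec A0) k' quot) h" for k k'
    using factor_unique[OF h] that by blast
qed

end

theorem mainTheorem6:
  fixes A :: "('a, 'm) ring_scheme" and D :: "('d, 'n) monoid_scheme" and \<A> :: "'d \<Rightarrow> 'a set"
  assumes "graded_cring A D \<A>"
    and "\<And>I. homogeneous_ideal A D \<A> I
           \<Longrightarrow> radical A I = radical A (Idl\<^bsub>A\<^esub> (I \<inter> \<A> \<one>\<^bsub>D\<^esub>))"
  shows "lrs_coequalizer TYPE('z \<times> 't)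
           (Spec (group_ring A D)) (Spec A) (action_map A D \<A>) (proj_map A D)
           (Spec (degree_zero_ring A D \<A>)) (Spec_map (degree_zero_ring A D \<A>) A (\<lambda>a. a))"
proof -
  interpret degree_zero_radical A D \<A>
    by (intro degree_zero_radical.intro assms degree_zero_radical_axioms.intro)
  show ?thesis by (rule lrs_coequalizer_quot)
qed

end
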